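(* Let $c\in\mathbb{C}$ with $\mathrm{Re}\, c>0$. An increasing sequence $\Lambda\subset\mathbb{R}$ is a complete interpolating sequence for $V_c^2$ if and only if $\Lambda$ is separated and there exists an enumeration $\Lambda=\{\lambda_n\}_{n\in\mathbb{Z}}$, with $\lambda_n=n+\delta_n$ for $n\in\mathbb{Z}$, such that (a) $(\delta_n)_{n\in\mathbb{Z}}\in\ell^\infty(\mathbb{Z})$; (b) there exist an integer $N\ge 1$ and a real number $\delta>0$ such that $$\sup_{n\in\mathbb{Z}}\frac{1}{N}\Big|\sum_{k=n+1}^{n+N}\delta_k\Big|\le\delta<\frac12 .$$
   Context: For $c\in\mathbb{C}$ with $\mathrm{Re}\,c>0$, the shift-invariant space generated by the (complex) Gaussian $e^{-cz^2}$ is $$V_c^2=\Big\{f(z)=\sum_{n\in\mathbb{Z}}c_n e^{-c(z-n)^2}:\ (c_n)_{n\in\mathbb{Z}}\in\ell^2(\mathbb{Z})\Big\},$$ where the coefficients $c_n$ are complex; it is regarded as a space of functions on $\mathbb{R}$ contained in $L^2(\mathbb{R})$ (its elements extend to entire functions), and it is equipped with the norm $\|f\|_{V_c^2}:=\|(c_n)\|_{\ell^2(\mathbb{Z})}$, which is equivalent to $\|f\|_{L^2(\mathbb{R})}$. A sequence $\Lambda=\{\lambda_n\}_{n\in\mathbb{Z}}\subset\mathbb{R}$ is sampling for $V_c^2$ if there are constants $A,B>0$ such that $A\|f\|_{V_c^2}^2\le\sum_{n\in\mathbb{Z}}|f(\lambda_n)|^2\le B\|f\|_{V_c^2}^2$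 for all $f\in V_c^2$. It is interpolating for $V_c^2$ if for every $(a_n)\in\ell^2(\mathbb{Z})$ there exists $f\in V_c^2$ with $f(\lambda_n)=a_n$ for all $n$. It is a complete interpolating sequence for $V_c^2$ if it is both sampling and interpolating. $\Lambda$ is separated if $\inf_{\lambda,\lambda'\in\Lambda,\ \lambda\ne\lambda'}|\lambda-\lambda'|>0$. *)

theory Defs
  imports "HOL-Analysis.Analysis"
begin

definition ell2 :: "(int \<Rightarrow> complex) set" where
  "ell2 = {a. (\<lambda>n. (cmod (a n))\<^sup>2) summable_on UNIV}"

definition ell2_norm :: "(int \<Rightarrow> complex) \<Rightarrow> real" where
  "ell2_norm a = sqrt (\<Sum>\<^sub>\<infinity>n. (cmod (a n))\<^sup>2)"

(* For Re c > 0 and a in ell2 the series converges absolutely at every point. *)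
definition gauss_series :: "complex \<Rightarrow> (int \<Rightarrow> complex) \<Rightarrow> real \<Rightarrow> complex" where
  "gauss_series c a x = (\<Sum>\<^sub>\<infinity>n. a n * exp (- c * (of_real x - of_int n)\<^sup>2))"

definition gauss_space :: "complex \<Rightarrow> (real \<Rightarrow> complex) set" where
  "gauss_space c = gauss_series c ` ell2"

(* For Re c > 0 the coefficients of an f in gauss_space c are unique: if
   gauss_series c a vanishes on the reals, then so does the entire function
   z |-> (SUM n. a n * exp (- c * n^2) * exp (2 * c * n * z)), hence it vanishes
   identically, and restricting it to z = i * pi * t / c with t real gives an absolutely
   convergent Fourier series that is identically zero. *)
definition gauss_coeffs :: "complex \<Rightarrow> (real \<Rightarrow> complex) \<Rightarrow> int \<Rightarrow> complex" where
  "gauss_coeffs c f = (THE a. a \<in> ell2 \<and> f = gauss_series c a)"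

definition gauss_norm :: "complex \<Rightarrow> (real \<Rightarrow> complex) \<Rightarrow> real" where
  "gauss_norm c f = ell2_norm (gauss_coeffs c f)"

(* Summability is required explicitly because infsum is 0 on families that are not summable. *)
definition sampling :: "complex \<Rightarrow> (int \<Rightarrow> real) \<Rightarrow> bool" where
  "sampling c \<Lambda> \<longleftrightarrow>
     (\<exists>A>0. \<exists>B>0. \<forall>f\<in>gauss_space c.
        (\<lambda>n. (cmod (f (\<Lambda> n)))\<^sup>2) summable_on UNIV \<and>
        A * (gauss_norm c f)\<^sup>2 \<le> (\<Sum>\<^sub>\<infinity>n. (cmod (f (\<Lambda> n)))\<^sup>2) \<and>
        (\<Sum>\<^sub>\<infinity>n. (cmod (f (\<Lambda> n)))\<^sup>2) \<le> B * (gauss_norm c f)\<^sup>2)"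

definition interpolating :: "complex \<Rightarrow> (int \<Rightarrow> real) \<Rightarrow> bool" where
  "interpolating c \<Lambda> \<longleftrightarrow> (\<forall>a\<in>ell2. \<exists>f\<in>gauss_space c. \<forall>n. f (\<Lambda> n) = a n)"

definition complete_interpolating :: "complex \<Rightarrow> (int \<Rightarrow> real) \<Rightarrow> bool" where
  "complete_interpolating c \<Lambda> \<longleftrightarrow> sampling c \<Lambda> \<and> interpolating c \<Lambda>"

(* Only meaningful for sets with at least two points: Inf {} is unspecified on the reals. *)
definition separated :: "real set \<Rightarrow> bool" where
  "separated S \<longleftrightarrow> 0 < Inf {\<bar>x - y\<bar> | x y. x \<in> S \<and> y \<in> S \<and> x \<noteq> y}"

end

theory Submission
  imports Defs "HOL-Computational_Algebra.Polynomial" "HOL-Complex_Analysis.Great_Picard"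
begin

text \<open>
  Let \<open>A\<close> be the matrix \<open>exp (- c (\<lambda> k - n)\<^sup>2)\<close> of the sampling map. The sequence is complete
  interpolating iff \<open>A\<close> has an inverse \<open>B\<close> with exponential off-diagonal decay.

  Sufficiency: up to diagonal factors the finite sections of \<open>A\<close> are Vandermonde matrices. Lagrange
  interpolation bounds the entries of their inverses by
  \<open>exp (- Re c (\<bar>n - k\<bar> + 2 (\<delta> (k + 1) + \<dots> + \<delta> n)))\<close> for \<open>k \<le> n\<close>, and symmetrically for \<open>n < k\<close>;
  the average condition makes this decay exponentially, and \<open>B\<close> is a limit of the sections.

  Necessity: conjugation by exponential weights shows that \<open>B\<close> decays, and comparing traces of
  corners of \<open>A B\<close> and \<open>B A\<close> shows that \<open>\<delta>\<close> is bounded. Testing \<open>B A = 1\<close> on the coefficients of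
  a polynomial vanishing on a window of nodes, and \<open>A B = 1\<close> on divided differences over a window,
  shows for every half-integer \<open>h\<close> that the averages of \<open>\<delta>\<close> over long blocks are all above \<open>h\<close> or
  all below \<open>h\<close>, by a fixed margin. Hence they lie strictly between two consecutive half-integers,
  and a shift of the enumeration centres this interval at \<open>0\<close>.
\<close>

section \<open>Infinite sums\<close>

text \<open>Expanding the square makes row k of the matrix, up to diagonal factors, the sequence of
  powers of w k = exp (2 c \<lambda> k). The moduli exp (2 Re c \<lambda> k) grow geometrically, so
  in a product of factors w k - w i each factor can be replaced by the larger of its two moduli at
  the price of one bounded constant. All estimates thereby become identities between sums of
  positions, and only Re c survives in them. Half-integers appear because the positions up to t sum
  to t (t + 1) / 2 plus the sum of \<delta>, while the Gaussian factors contribute (t + h)^2 / 2: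
  the difference has slope h - 1 / 2. Sliding the frequency window by h against the node window thus
  probes one half-integer at a time. The strict margin comes from the decay of the inverse. Each of
  the two tests says that a middle value of the profile, respectively of its negative, is
  exponentially dominated by the values at the two ends. A function with both properties cannot turn
  around on long scales, so it moves in one direction over all long blocks.\<close>

lemma summable_on_norm_comparison:
  fixes f :: "'a \<Rightarrow> 'b::banach"
  assumes "g summable_on A" "\<And>x. x \<in> A \<Longrightarrow> norm (f x) \<le> g x"
  shows "f summable_on A" "(\<lambda>x. norm (f x)) summable_on A" "norm (infsum f A) \<le> infsum g A"
proof -
  show *: "(\<lambda>x. norm (f x)) summable_on A"
    by (rule Infinite_Sum.abs_summable_on_comparison_test'[OF assms])
  then show f: "f summable_on A"
    by (rule abs_summable_summable)
  show "norm (infsum f A) \<le> infsum g A"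
    by (rule norm_infsum_le[OF has_sum_infsum[OF f] has_sum_infsum[OF assms(1)] assms(2)])
qed

text \<open>Lets the identities for finite sections pass to the limit. A finite set carrying all but
  \<open>e / 4\<close> of the mass of \<open>g\<close> makes the tails uniformly small, and on it
  convergence is termwise.\<close>

lemma infsum_dominated_convergence:
  fixes f :: "nat \<Rightarrow> 'a \<Rightarrow> 'b::banach"
  assumes lim: "\<And>x. (\<lambda>n. f n x) \<longlonglongrightarrow> h x"
    and dom: "\<And>n x. norm (f n x) \<le> g x"
    and g: "g summable_on UNIV"
  shows "(\<lambda>n. infsum (f n) UNIV) \<longlonglongrightarrow> infsum h UNIV"
proof (rule LIMSEQ_I)
  fix e :: real assume e: "e > 0"
  have domh: "norm (h x) \<le> g x" for x
    by (rule LIMSEQ_le_const2[OF tendsto_norm[OF lim[of x]]]) (use dom in auto)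
  obtain F where F: "finite F" "dist (sum g F) (infsum g UNIV) \<le> e / 4"
    using infsum_finite_approximation[OF g, of "e / 4"] e by auto
  have split: "infsum k UNIV = sum k F + infsum k (- F)" and tail: "norm (infsum k (- F)) \<le> e / 4"
    if k: "\<And>x. norm (k x) \<le> g x" for k :: "'a \<Rightarrow> 'b"
  proof -
    have ks: "k summable_on A" for A
      using summable_on_norm_comparison(1)[OF g k] summable_on_subset_banach by blast
    have gs: "g summable_on A" for A
      using g summable_on_subset_banach by blast
    show "infsum k UNIV = sum k F + infsum k (- F)"
      using infsum_Un_disjoint[OF ks ks, of F "- F"] F(1) by simp
    have "infsum g UNIV = sum g F + infsum g (- F)"
      using infsum_Un_disjoint[OF gs gs, of F "- F"] F(1) by simp
    moreover have "norm (infsum k (- F)) \<le> infsum g (- F)"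
      using summable_on_norm_comparison(3)[OF gs k] .
    ultimately show "norm (infsum k (- F)) \<le> e / 4"
      using F(2) by (simp add: dist_real_def)
  qed
  have "(\<lambda>n. sum (f n) F) \<longlonglongrightarrow> sum h F"
    by (intro tendsto_sum lim)
  then obtain N where N: "\<And>n. n \<ge> N \<Longrightarrow> norm (sum (f n) F - sum h F) < e / 4"
    using LIMSEQ_D[of "\<lambda>n. sum (f n) F" "sum h F" "e / 4"] e by auto
  show "\<exists>N. \<forall>n\<ge>N. norm (infsum (f n) UNIV - infsum h UNIV) < e"
  proof (intro exI allI impI)
    fix n assume "n \<ge> N"
    have "infsum (f n) UNIV - infsum h UNIV
        = (sum (f n) F - sum h F) + (infsum (f n) (- F) - infsum h (- F))"
      using split[OF dom[of n]] split[OF domh] by (simp add: algebra_simps)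
    also have "norm \<dots> \<le> norm (sum (f n) F - sum h F) + (norm (infsum (f n) (- F)) + norm (infsum h (- F)))"
      by (meson norm_triangle_ineq norm_triangle_ineq4 add_left_mono order_trans)
    also have "\<dots> < e"
      using N[OF \<open>n \<ge> N\<close>] tail[OF dom[of n]] tail[OF domh] e by linarith
    finally show "norm (infsum (f n) UNIV - infsum h UNIV) < e" .
  qed
qed

text \<open>A majorant of product form with uniformly bounded inner sums gives absolute summability
  over all pairs, so the sums may be exchanged.\<close>

lemma infsum_swap_product_bound:
  fixes f :: "'a \<Rightarrow> 'b \<Rightarrow> 'c::banach"
  assumes g: "g summable_on UNIV" and h: "\<And>x. h x summable_on UNIV"
    and hS: "\<And>x. infsum (h x) UNIV \<le> S"
    and f: "\<And>x y. norm (f x y) \<le> g x * h x y" and nn: "\<And>x. 0 \<le> g x" "\<And>x y. 0 \<le> h x y"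
  shows "(\<Sum>\<^sub>\<infinity>x. \<Sum>\<^sub>\<infinity>y. f x y) = (\<Sum>\<^sub>\<infinity>y. \<Sum>\<^sub>\<infinity>x. f x y)"
proof (rule infsum_swap_banach)
  have gh: "g x * infsum (h x) UNIV \<le> S * g x" for x
    using mult_left_mono[OF hS nn(1)] by (simp add: mult.commute)
  have "(\<lambda>(x, y). g x * h x y) summable_on UNIV \<times> UNIV"
  proof (rule summable_on_SigmaI[where g = "\<lambda>x. g x * infsum (h x) UNIV"])
    show "((\<lambda>y. case (x, y) of (x, y) \<Rightarrow> g x * h x y) has_sum g x * infsum (h x) UNIV) UNIV" for x
      by (simp add: has_sum_cmult_right h)
    show "(\<lambda>x. g x * infsum (h x) UNIV) summable_on UNIV"
      by (rule summable_on_comparison_test[OF summable_on_cmult_right[OF g] gh]) (simp add: nn infsum_nonneg)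
  qed (simp add: nn)
  then show "(\<lambda>(x, y). f x y) summable_on UNIV \<times> UNIV"
    by (rule summable_on_norm_comparison(1)) (auto simp: f)
qed

lemma has_sum_sum:
  fixes f :: "'i \<Rightarrow> 'a \<Rightarrow> 'b::topological_comm_monoid_add"
  assumes "\<And>i. i \<in> F \<Longrightarrow> (f i has_sum S i) A"
  shows "((\<lambda>x. \<Sum>i\<in>F. f i x) has_sum (\<Sum>i\<in>F. S i)) A"
  using assms by (induction F rule: infinite_finite_induct) (auto intro: has_sum_add has_sum_0)

text \<open>Cauchy-Schwarz on each row, with \<open>K\<close> split into two square roots, costs the
  row bound \<open>R\<close>; exchanging the sums then costs the column bound
  \<open>R'\<close>.\<close>

lemma schur_test:
  fixes M :: "'a \<Rightarrow> 'b \<Rightarrow> complex" and K :: "'a \<Rightarrow> 'b \<Rightarrow> real"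
  assumes MK: "\<And>k n. cmod (M k n) \<le> K k n"
    and rows: "\<And>k. K k summable_on UNIV" "\<And>k. infsum (K k) UNIV \<le> R"
    and cols: "\<And>n. (\<lambda>k. K k n) summable_on UNIV" "\<And>n. (\<Sum>\<^sub>\<infinity>k. K k n) \<le> R'"
    and a: "(\<lambda>n. (cmod (a n))\<^sup>2) summable_on UNIV"
  shows "(\<lambda>k. (cmod (\<Sum>\<^sub>\<infinity>n. M k n * a n))\<^sup>2) summable_on UNIV"
    and "(\<Sum>\<^sub>\<infinity>k. (cmod (\<Sum>\<^sub>\<infinity>n. M k n * a n))\<^sup>2) \<le> R * R' * (\<Sum>\<^sub>\<infinity>n. (cmod (a n))\<^sup>2)"
proof -
  let ?Q = "\<Sum>\<^sub>\<infinity>n. (cmod (a n))\<^sup>2"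
  have K0: "0 \<le> K k n" for k n
    using order_trans[OF norm_ge_zero MK] .
  have R0: "0 \<le> R"
    using order_trans[OF infsum_nonneg rows(2)] K0 by blast
  \<comment> \<open>A single entry is at most its column sum, which makes the weighted sums of
    squares converge.\<close>
  have Kle: "K k n \<le> R'" for k n
    using finite_sum_le_infsum[OF cols(1), of "{k}" n] cols(2)[of n] K0 by force
  have Ka: "(\<lambda>n. K k n * (cmod (a n))\<^sup>2) summable_on UNIV" for k
    by (rule summable_on_comparison_test[OF summable_on_cmult_right[OF a, of R']])
       (auto intro!: mult_right_mono Kle simp: K0)
  have Ksum: "sum (K k) F \<le> R" if "finite F" for F k
    using finite_sum_le_infsum[OF rows(1) that, of k] rows(2)[of k] K0 by force
  have row: "(cmod (\<Sum>\<^sub>\<infinity>n. M k n * a n))\<^sup>2 \<le> R * (\<Sum>\<^sub>\<infinity>n. K k n * (cmod (a n))\<^sup>2)" for k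
  proof -
    let ?q = "R * (\<Sum>\<^sub>\<infinity>n. K k n * (cmod (a n))\<^sup>2)"
    have fin: "(\<Sum>n\<in>F. K k n * cmod (a n)) \<le> sqrt ?q" if F: "finite F" for F
    proof (rule real_le_rsqrt)
      have "(\<Sum>n\<in>F. K k n * cmod (a n))\<^sup>2
          = (\<Sum>n\<in>F. sqrt (K k n) * (sqrt (K k n) * cmod (a n)))\<^sup>2"
        using K0 by (simp add: mult.assoc[symmetric])
      also have "\<dots> \<le> (\<Sum>n\<in>F. (sqrt (K k n))\<^sup>2) * (\<Sum>n\<in>F. (sqrt (K k n) * cmod (a n))\<^sup>2)"
        by (rule Cauchy_Schwarz_ineq_sum)
      also have "\<dots> = sum (K k) F * (\<Sum>n\<in>F. K k n * (cmod (a n))\<^sup>2)"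
        using K0 by (simp add: power_mult_distrib)
      also have "\<dots> \<le> ?q"
      proof (rule mult_mono)
        show "(\<Sum>n\<in>F. K k n * (cmod (a n))\<^sup>2) \<le> (\<Sum>\<^sub>\<infinity>n. K k n * (cmod (a n))\<^sup>2)"
          by (rule finite_sum_le_infsum[OF Ka F]) (auto simp: K0)
      qed (auto simp: R0 Ksum F K0 intro!: sum_nonneg)
      finally show "(\<Sum>n\<in>F. K k n * cmod (a n))\<^sup>2 \<le> ?q" .
    qed
    have s: "(\<lambda>n. K k n * cmod (a n)) summable_on UNIV"
      by (rule nonneg_bdd_above_summable_on) (use fin in \<open>auto simp: K0 intro!: bdd_aboveI2\<close>)
    have "cmod (\<Sum>\<^sub>\<infinity>n. M k n * a n) \<le> (\<Sum>\<^sub>\<infinity>n. K k n * cmod (a n))"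
      by (rule summable_on_norm_comparison(3)[OF s]) (auto simp: norm_mult intro!: mult_right_mono MK)
    also have "\<dots> \<le> sqrt ?q"
      by (rule infsum_le_finite_sums[OF s fin])
    finally have "cmod (\<Sum>\<^sub>\<infinity>n. M k n * a n) \<le> sqrt ?q" .
    then have "(cmod (\<Sum>\<^sub>\<infinity>n. M k n * a n))\<^sup>2 \<le> (sqrt ?q)\<^sup>2"
      by (rule power_mono) simp
    then show ?thesis
      by (simp add: R0 K0 infsum_nonneg)
  qed
  have fin: "(\<Sum>k\<in>F. (cmod (\<Sum>\<^sub>\<infinity>n. M k n * a n))\<^sup>2) \<le> R * R' * ?Q" if F: "finite F" for F
  proof -
    have "(\<Sum>k\<in>F. (cmod (\<Sum>\<^sub>\<infinity>n. M k n * a n))\<^sup>2) \<le> (\<Sum>k\<in>F. R * (\<Sum>\<^sub>\<infinity>n. K k n * (cmod (a n))\<^sup>2))"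
      by (rule sum_mono[OF row])
    also have "\<dots> = R * (\<Sum>\<^sub>\<infinity>n. \<Sum>k\<in>F. K k n * (cmod (a n))\<^sup>2)"
      by (simp add: sum_distrib_left[symmetric] infsumI[OF has_sum_sum[OF has_sum_infsum[OF Ka]]])
    also have "\<dots> \<le> R * (\<Sum>\<^sub>\<infinity>n. R' * (cmod (a n))\<^sup>2)"
    proof (rule mult_left_mono[OF infsum_mono R0])
      show "(\<lambda>n. \<Sum>k\<in>F. K k n * (cmod (a n))\<^sup>2) summable_on UNIV"
        by (rule has_sum_imp_summable[OF has_sum_sum[OF has_sum_infsum[OF Ka]]])
      show "(\<lambda>n. R' * (cmod (a n))\<^sup>2) summable_on UNIV"
        by (intro summable_on_cmult_right a)
      show "(\<Sum>k\<in>F. K k n * (cmod (a n))\<^sup>2) \<le> R' * (cmod (a n))\<^sup>2" for n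
        unfolding sum_distrib_right[symmetric]
        using finite_sum_le_infsum[OF cols(1) F, of n] cols(2)[of n] K0
        by (intro mult_right_mono) force+
    qed
    also have "\<dots> = R * R' * ?Q"
      by (simp add: infsum_cmult_right')
    finally show ?thesis .
  qed
  show s: "(\<lambda>k. (cmod (\<Sum>\<^sub>\<infinity>n. M k n * a n))\<^sup>2) summable_on UNIV"
    by (rule nonneg_bdd_above_summable_on) (use fin in \<open>auto intro!: bdd_aboveI2\<close>)
  show "(\<Sum>\<^sub>\<infinity>k. (cmod (\<Sum>\<^sub>\<infinity>n. M k n * a n))\<^sup>2) \<le> R * R' * ?Q"
    by (rule infsum_le_finite_sums[OF s fin])
qed

section \<open>Localized matrices\<close>

text \<open>Absolute convergence needs only summable rows and a bounded vector, so the rule serves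
  square-summable data as well as merely bounded coefficients.\<close>

lemma infsum_matrix_assoc:
  fixes M1 :: "'a \<Rightarrow> complex" and M2 :: "'a \<Rightarrow> 'b \<Rightarrow> complex"
  assumes g: "g summable_on UNIV" "\<And>x. cmod (M1 x) \<le> g x"
    and h: "\<And>x. h x summable_on UNIV" "\<And>x. infsum (h x) UNIV \<le> S" "\<And>x y. cmod (M2 x y) \<le> h x y"
    and v: "\<And>y. cmod (v y) \<le> V"
  shows "(\<Sum>\<^sub>\<infinity>x. M1 x * (\<Sum>\<^sub>\<infinity>y. M2 x y * v y)) = (\<Sum>\<^sub>\<infinity>y. (\<Sum>\<^sub>\<infinity>x. M1 x * M2 x y) * v y)"
proof -
  have nn: "0 \<le> g x" "0 \<le> h x y" "0 \<le> V" for x y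
    using order_trans[OF norm_ge_zero g(2)] order_trans[OF norm_ge_zero h(3)]
      order_trans[OF norm_ge_zero v] by blast+
  have "(\<Sum>\<^sub>\<infinity>x. M1 x * (\<Sum>\<^sub>\<infinity>y. M2 x y * v y)) = (\<Sum>\<^sub>\<infinity>x. \<Sum>\<^sub>\<infinity>y. M1 x * M2 x y * v y)"
    by (simp add: infsum_cmult_right'[symmetric] mult.assoc)
  also have "\<dots> = (\<Sum>\<^sub>\<infinity>y. \<Sum>\<^sub>\<infinity>x. M1 x * M2 x y * v y)"
  proof (rule infsum_swap_product_bound[where g = g and h = "\<lambda>x y. h x y * V" and S = "S * V"])
    show "cmod (M1 x * M2 x y * v y) \<le> g x * (h x y * V)" for x y
      unfolding norm_mult mult.assoc by (intro mult_mono g h v) (auto simp: nn)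
    show "(\<lambda>y. h x y * V) summable_on UNIV" for x
      by (intro summable_on_cmult_left h)
    show "(\<Sum>\<^sub>\<infinity>y. h x y * V) \<le> S * V" for x
      by (simp add: infsum_cmult_left' h nn mult_right_mono)
  qed (auto simp: nn g)
  also have "\<dots> = (\<Sum>\<^sub>\<infinity>y. (\<Sum>\<^sub>\<infinity>x. M1 x * M2 x y) * v y)"
    by (simp add: infsum_cmult_left')
  finally show ?thesis .
qed

text \<open>A lower quasi-isometry bound on the enumeration. The additive defect \<open>D\<close>
  lets it cover both increasing separated nodes and bounded perturbations of the integers in any
  order.\<close>

definition spread :: "(int \<Rightarrow> real) \<Rightarrow> bool" where
  "spread \<mu> \<longleftrightarrow> (\<exists>\<sigma>>0. \<exists>D. \<forall>i j. \<sigma> * real_of_int \<bar>i - j\<bar> - D \<le> \<bar>\<mu> i - \<mu> j\<bar>)"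

lemma spread_of_int: "spread real_of_int"
  unfolding spread_def by (intro exI[of _ 1] conjI exI[of _ 0]) auto

lemma summable_on_exp_abs_int:
  assumes "\<eta> > 0"
  shows "(\<lambda>i::int. exp (- \<eta> * \<bar>real_of_int i\<bar>)) summable_on UNIV"
proof -
  have nat: "(\<lambda>n::nat. exp (- \<eta> * real n)) summable_on UNIV"
  proof (subst summable_on_UNIV_nonneg_real_iff)
    have "summable (\<lambda>n. exp (- \<eta>) ^ n)"
      by (rule summable_geometric) (use assms in simp)
    then show "summable (\<lambda>n. exp (- \<eta> * real n))"
      by (simp add: exp_of_nat2_mult[symmetric])
  qed auto
  have "(\<lambda>i::int. exp (- \<eta> * \<bar>real_of_int i\<bar>)) summable_on range int"
    by (subst summable_on_reindex) (use nat in \<open>auto simp: o_def inj_on_def\<close>)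
  moreover have "(\<lambda>i::int. exp (- \<eta> * \<bar>real_of_int i\<bar>)) summable_on range (\<lambda>n. - int n)"
    by (subst summable_on_reindex) (use nat in \<open>auto simp: o_def inj_on_def\<close>)
  moreover have "range int \<union> range (\<lambda>n. - int n) = UNIV"
  proof (intro equalityI subsetI)
    show "i \<in> range int \<union> range (\<lambda>n. - int n)" for i
      by (cases i rule: int_cases2) auto
  qed simp
  ultimately show ?thesis
    using summable_on_union by metis
qed

text \<open>Comparison with a node nearly closest to \<open>u\<close> reduces the sum to a geometric
  series in the index difference, wherever \<open>u\<close> lies.\<close>

lemma spread_exp_sum:
  assumes "spread \<mu>" "\<eta> > 0"
  obtains S where "S > 0" "\<And>u. (\<lambda>i. exp (- \<eta> * \<bar>u - \<mu> i\<bar>)) summable_on UNIV"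
    "\<And>u. (\<Sum>\<^sub>\<infinity>i. exp (- \<eta> * \<bar>u - \<mu> i\<bar>)) \<le> S"
proof -
  obtain \<sigma> D where \<sigma>: "\<sigma> > 0" and D: "\<And>i j. \<sigma> * real_of_int \<bar>i - j\<bar> - D \<le> \<bar>\<mu> i - \<mu> j\<bar>"
    using assms(1) unfolding spread_def by blast
  define C where "C = exp (\<eta> * (D + 1) / 2)"
  define E where "E = (\<lambda>i::int. exp (- (\<eta> * \<sigma> / 2) * \<bar>real_of_int i\<bar>))"
  have E: "E summable_on UNIV"
    unfolding E_def by (rule summable_on_exp_abs_int) (use assms \<sigma> in simp)
  have main: "(\<lambda>i. exp (- \<eta> * \<bar>u - \<mu> i\<bar>)) summable_on UNIV \<and>
      (\<Sum>\<^sub>\<infinity>i. exp (- \<eta> * \<bar>u - \<mu> i\<bar>)) \<le> C * infsum E UNIV" for u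
  proof -
    \<comment> \<open>A node within 1 of the infimum of the distances, so that attainment need not
      be discussed. By the triangle inequality \<open>\<bar>\<mu> i - \<mu> i0\<bar>\<close> is then
      at most twice the distance from \<open>u\<close> to \<open>\<mu> i\<close>, plus 1.\<close>
    obtain i0 where i0: "\<And>j. \<bar>u - \<mu> i0\<bar> \<le> \<bar>u - \<mu> j\<bar> + 1"
    proof -
      let ?m = "INF j. \<bar>u - \<mu> j\<bar>"
      have "bdd_below (range (\<lambda>j. \<bar>u - \<mu> j\<bar>))"
        by (rule bdd_belowI[of _ 0]) auto
      then obtain i0 where i0: "\<bar>u - \<mu> i0\<bar> < ?m + 1"
        using cInf_lessD[of "range (\<lambda>j. \<bar>u - \<mu> j\<bar>)" "?m + 1"] by auto
      have m: "?m \<le> \<bar>u - \<mu> j\<bar>" for j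
        by (rule cINF_lower) (auto intro!: bdd_belowI[of _ 0])
      have "\<bar>u - \<mu> i0\<bar> \<le> \<bar>u - \<mu> j\<bar> + 1" for j
        using i0 m[of j] by linarith
      then show ?thesis by (rule that)
    qed
    have bij: "bij_betw (\<lambda>i. i - i0) UNIV UNIV"
      by (rule bij_betwI[of _ _ _ "\<lambda>i. i + i0"]) auto
    have Es: "(\<lambda>i. C * E (i - i0)) summable_on UNIV"
      by (intro summable_on_cmult_right) (use summable_on_reindex_bij_betw[OF bij, of E] E in simp)
    have le: "exp (- \<eta> * \<bar>u - \<mu> i\<bar>) \<le> C * E (i - i0)" for i
    proof -
      have "\<bar>\<mu> i - \<mu> i0\<bar> \<le> 2 * \<bar>u - \<mu> i\<bar> + 1"
        using i0[of i] by (smt (verit))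
      then have "\<sigma> * \<bar>real_of_int (i - i0)\<bar> - D - 1 \<le> 2 * \<bar>u - \<mu> i\<bar>"
        using D[of i i0] by simp
      then have "\<eta> / 2 * (\<sigma> * \<bar>real_of_int (i - i0)\<bar> - D - 1) \<le> \<eta> / 2 * (2 * \<bar>u - \<mu> i\<bar>)"
        using assms(2) by (intro mult_left_mono) auto
      then have "- \<eta> * \<bar>u - \<mu> i\<bar> \<le> \<eta> * (D + 1) / 2 + - (\<eta> * \<sigma> / 2) * \<bar>real_of_int (i - i0)\<bar>"
        by (simp add: algebra_simps add_divide_distrib)
      then show ?thesis
        unfolding C_def E_def exp_add[symmetric] by simp
    qed
    have s: "(\<lambda>i. exp (- \<eta> * \<bar>u - \<mu> i\<bar>)) summable_on UNIV"
      by (rule summable_on_comparison_test[OF Es le]) simp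
    have "(\<Sum>\<^sub>\<infinity>i. exp (- \<eta> * \<bar>u - \<mu> i\<bar>)) \<le> (\<Sum>\<^sub>\<infinity>i. C * E (i - i0))"
      by (rule infsum_mono[OF s Es le])
    also have "\<dots> = C * infsum E UNIV"
      using infsum_reindex_bij_betw[OF bij, of E] by (simp add: infsum_cmult_right')
    finally show ?thesis using s by simp
  qed
  have "0 \<le> C * infsum E UNIV"
    by (intro mult_nonneg_nonneg infsum_nonneg) (auto simp: C_def E_def)
  then show ?thesis
    using main by (intro that[of "C * infsum E UNIV + 1"]) (auto intro: add_increasing2)
qed

section \<open>The Gaussian kernel and its exponentially decaying inverses\<close>

definition gauss_kernel :: "complex \<Rightarrow> real \<Rightarrow> int \<Rightarrow> complex" where
  "gauss_kernel c x n = exp (- c * (of_real x - of_int n)\<^sup>2)"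

lemma gauss_series_kernel: "gauss_series c a x = (\<Sum>\<^sub>\<infinity>n. gauss_kernel c x n * a n)"
  unfolding gauss_series_def gauss_kernel_def by (simp add: mult.commute)

lemma norm_gauss_kernel: "cmod (gauss_kernel c x n) = exp (- Re c * (x - real_of_int n)\<^sup>2)"
proof -
  have "- c * (complex_of_real x - of_int n)\<^sup>2 = - c * complex_of_real ((x - real_of_int n)\<^sup>2)"
    by simp
  moreover have "Re (z * complex_of_real r) = Re z * r" for z r
    by simp
  ultimately show ?thesis
    unfolding gauss_kernel_def norm_exp_eq_Re by (metis uminus_complex.sel(1))
qed

text \<open>Completing the square. Every exponential rate \<open>\<eta>\<close> is available at the
  price of a constant, and later proofs choose the rate large enough to absorb competing
  exponentials.\<close>

lemma gauss_le_exp: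
  fixes \<alpha> \<eta> v :: real
  assumes "\<alpha> > 0"
  shows "exp (- \<alpha> * v\<^sup>2) \<le> exp (\<eta>\<^sup>2 / (4 * \<alpha>)) * exp (- \<eta> * \<bar>v\<bar>)"
proof -
  have "0 \<le> \<alpha> * (\<bar>v\<bar> - \<eta> / (2 * \<alpha>))\<^sup>2"
    using assms by simp
  also have "\<dots> = \<alpha> * v\<^sup>2 - \<eta> * \<bar>v\<bar> + \<eta>\<^sup>2 / (4 * \<alpha>)"
    unfolding power2_diff power2_abs using assms by (simp add: field_simps power2_eq_square)
  finally show ?thesis
    by (simp flip: exp_add)
qed

lemma norm_gauss_kernel_le:
  assumes "Re c > 0"
  shows "cmod (gauss_kernel c x n) \<le> exp (\<eta>\<^sup>2 / (4 * Re c)) * exp (- \<eta> * \<bar>x - real_of_int n\<bar>)"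
  unfolding norm_gauss_kernel by (rule gauss_le_exp[OF assms])

text \<open>Rows are indexed by integers and columns by nodes. Distance is measured between
  \<open>n\<close> and the position \<open>\<mu> k\<close>, since in the necessity part nothing
  relates \<open>k\<close> to \<open>\<mu> k\<close> before the nodes have been counted.\<close>

definition localized :: "(int \<Rightarrow> real) \<Rightarrow> (int \<Rightarrow> int \<Rightarrow> complex) \<Rightarrow> bool" where
  "localized \<mu> B \<longleftrightarrow> (\<exists>C. \<exists>\<rho>>0. \<forall>n k. cmod (B n k) \<le> C * exp (- \<rho> * \<bar>real_of_int n - \<mu> k\<bar>))"

text \<open>Both identities are demanded because for infinite matrices an inverse on one side need
  not be an inverse on the other.\<close>

definition localized_inverse :: "complex \<Rightarrow> (int \<Rightarrow> real) \<Rightarrow> (int \<Rightarrow> int \<Rightarrow> complex) \<Rightarrow> bool" where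
  "localized_inverse c \<mu> B \<longleftrightarrow> localized \<mu> B \<and>
     (\<forall>j k. (\<Sum>\<^sub>\<infinity>n. gauss_kernel c (\<mu> j) n * B n k) = of_bool (j = k)) \<and>
     (\<forall>n m. (\<Sum>\<^sub>\<infinity>k. B n k * gauss_kernel c (\<mu> k) m) = of_bool (n = m))"

lemma ell2_bounded:
  assumes "a \<in> ell2"
  shows "cmod (a n) \<le> ell2_norm a"
proof -
  have "(cmod (a n))\<^sup>2 \<le> (\<Sum>\<^sub>\<infinity>n. (cmod (a n))\<^sup>2)"
    using finite_sum_le_infsum[of "\<lambda>n. (cmod (a n))\<^sup>2" UNIV "{n}"] assms by (simp add: ell2_def)
  then show ?thesis
    unfolding ell2_norm_def by (rule real_le_rsqrt)
qed

lemma ell2_norm_sq: "(ell2_norm a)\<^sup>2 = (\<Sum>\<^sub>\<infinity>n. (cmod (a n))\<^sup>2)"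
  unfolding ell2_norm_def by (simp add: infsum_nonneg)

lemma infsum_of_bool_mult:
  fixes v :: "'a \<Rightarrow> complex"
  shows "(\<Sum>\<^sub>\<infinity>y. of_bool (x = y) * v y) = v x"
proof -
  have "(\<Sum>\<^sub>\<infinity>y. of_bool (x = y) * v y) = (\<Sum>\<^sub>\<infinity>y\<in>{x}. v y)"
    by (rule infsum_cong_neutral) auto
  then show ?thesis by simp
qed

text \<open>A single constant for nodes and integers bounds the row sums and the column sums of the
  kernels at once.\<close>

definition exp_kernel_bound :: "(int \<Rightarrow> real) \<Rightarrow> real \<Rightarrow> real \<Rightarrow> bool" where
  "exp_kernel_bound \<mu> \<eta> S \<longleftrightarrow> 0 < S \<and> (\<forall>\<theta>\<in>{\<mu>, real_of_int}. \<forall>u.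
     (\<lambda>k. exp (- \<eta> * \<bar>u - \<theta> k\<bar>)) summable_on UNIV \<and> (\<Sum>\<^sub>\<infinity>k. exp (- \<eta> * \<bar>u - \<theta> k\<bar>)) \<le> S)"

lemma ex_exp_kernel_bound:
  assumes "spread \<mu>" "\<eta> > 0"
  shows "\<exists>S. exp_kernel_bound \<mu> \<eta> S"
proof -
  obtain S1 where S1: "S1 > 0" "\<And>u. (\<lambda>k. exp (- \<eta> * \<bar>u - \<mu> k\<bar>)) summable_on UNIV"
    "\<And>u. (\<Sum>\<^sub>\<infinity>k. exp (- \<eta> * \<bar>u - \<mu> k\<bar>)) \<le> S1"
    using spread_exp_sum[OF assms] by blast
  obtain S2 where S2: "S2 > 0" "\<And>u. (\<lambda>k. exp (- \<eta> * \<bar>u - real_of_int k\<bar>)) summable_on UNIV"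
    "\<And>u. (\<Sum>\<^sub>\<infinity>k. exp (- \<eta> * \<bar>u - real_of_int k\<bar>)) \<le> S2"
    using spread_exp_sum[OF spread_of_int assms(2)] by blast
  have "exp_kernel_bound \<mu> \<eta> (max S1 S2)"
    unfolding exp_kernel_bound_def using S1 S2 by (auto intro: le_max_iff_disj[THEN iffD2])
  then show ?thesis ..
qed

lemma exp_kernel_boundD:
  assumes "exp_kernel_bound \<mu> \<eta> S"
  shows "S > 0"
    "(\<lambda>k. exp (- \<eta> * \<bar>u - \<mu> k\<bar>)) summable_on UNIV"
    "(\<Sum>\<^sub>\<infinity>k. exp (- \<eta> * \<bar>u - \<mu> k\<bar>)) \<le> S"
    "(\<lambda>n. exp (- \<eta> * \<bar>u - real_of_int n\<bar>)) summable_on UNIV"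
    "(\<Sum>\<^sub>\<infinity>n. exp (- \<eta> * \<bar>u - real_of_int n\<bar>)) \<le> S"
    "(\<lambda>n. exp (- \<eta> * \<bar>real_of_int n - u\<bar>)) summable_on UNIV"
    "(\<Sum>\<^sub>\<infinity>n. exp (- \<eta> * \<bar>real_of_int n - u\<bar>)) \<le> S"
    "(\<lambda>k. exp (- \<eta> * \<bar>\<mu> k - u\<bar>)) summable_on UNIV"
    "(\<Sum>\<^sub>\<infinity>k. exp (- \<eta> * \<bar>\<mu> k - u\<bar>)) \<le> S"
  using assms unfolding exp_kernel_bound_def by (simp_all add: abs_minus_commute[of _ u])

lemma localized_inverse_imp_localized: "localized_inverse c \<mu> B \<Longrightarrow> localized \<mu> B"
  by (simp add: localized_inverse_def)

lemma localizedE: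
  assumes "localized \<mu> B"
  obtains C \<rho> where "C > 0" "\<rho> > 0" "\<And>n k. cmod (B n k) \<le> C * exp (- \<rho> * \<bar>real_of_int n - \<mu> k\<bar>)"
    "\<And>n k. cmod (B n k) \<le> C"
proof -
  obtain C \<rho> where \<rho>: "\<rho> > 0" and C: "\<And>n k. cmod (B n k) \<le> C * exp (- \<rho> * \<bar>real_of_int n - \<mu> k\<bar>)"
    using assms unfolding localized_def by blast
  have le: "cmod (B n k) \<le> (\<bar>C\<bar> + 1) * exp (- \<rho> * \<bar>real_of_int n - \<mu> k\<bar>)" for n k
    by (rule order_trans[OF C mult_right_mono]) auto
  have "cmod (B n k) \<le> \<bar>C\<bar> + 1" for n k
    by (rule order_trans[OF le mult_left_le]) (use \<rho> in auto)
  with le \<rho> show ?thesis by (intro that[of "\<bar>C\<bar> + 1" \<rho>]) auto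
qed

lemma gauss_series_upper_bound:
  assumes "Re c > 0" "spread \<mu>"
  obtains R where "R > 0"
    "\<And>a. a \<in> ell2 \<Longrightarrow> (\<lambda>k. (cmod (gauss_series c a (\<mu> k)))\<^sup>2) summable_on UNIV"
    "\<And>a. a \<in> ell2 \<Longrightarrow> (\<Sum>\<^sub>\<infinity>k. (cmod (gauss_series c a (\<mu> k)))\<^sup>2) \<le> R * (ell2_norm a)\<^sup>2"
proof -
  obtain S where "exp_kernel_bound \<mu> 1 S"
    using ex_exp_kernel_bound[OF assms(2), of 1] by auto
  note S = exp_kernel_boundD[OF this]
  define C where "C = exp (1\<^sup>2 / (4 * Re c))"
  have C: "C > 0" by (simp add: C_def)
  have K: "cmod (gauss_kernel c (\<mu> k) n) \<le> C * exp (- 1 * \<bar>\<mu> k - real_of_int n\<bar>)" for k n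
    unfolding C_def by (rule norm_gauss_kernel_le[OF assms(1)])
  note schur = schur_test[where K = "\<lambda>k n. C * exp (- 1 * \<bar>\<mu> k - real_of_int n\<bar>)"
      and M = "\<lambda>k n. gauss_kernel c (\<mu> k) n" and R = "C * S" and R' = "C * S", OF K]
  have le: "(\<Sum>\<^sub>\<infinity>n. C * exp (- 1 * \<bar>\<mu> k - real_of_int n\<bar>)) \<le> C * S"
           "(\<Sum>\<^sub>\<infinity>k. C * exp (- 1 * \<bar>\<mu> k - real_of_int n\<bar>)) \<le> C * S" for k n
    unfolding infsum_cmult_right' using C S by (auto intro!: mult_left_mono)
  show ?thesis
  proof (rule that[of "(C * S) * (C * S)"])
    fix a :: "int \<Rightarrow> complex" assume a: "a \<in> ell2"
    then have a': "(\<lambda>n. (cmod (a n))\<^sup>2) summable_on UNIV" by (simp add: ell2_def)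
    show "(\<lambda>k. (cmod (gauss_series c a (\<mu> k)))\<^sup>2) summable_on UNIV"
      unfolding gauss_series_kernel
      by (rule schur(1)[OF _ _ _ _ a']) (intro summable_on_cmult_right S le)+
    show "(\<Sum>\<^sub>\<infinity>k. (cmod (gauss_series c a (\<mu> k)))\<^sup>2) \<le> (C * S) * (C * S) * (ell2_norm a)\<^sup>2"
      unfolding gauss_series_kernel ell2_norm_sq
      by (rule schur(2)[OF _ _ _ _ a']) (intro summable_on_cmult_right S le)+
  qed (use C S in simp)
qed

text \<open>Associativity turns \<open>B (A a)\<close> into \<open>(B A) a\<close>. It holds for
  bounded coefficients, hence also for those produced by polynomials.\<close>

lemma localized_inverse_left:
  assumes "Re c > 0" "spread \<mu>" and B: "localized_inverse c \<mu> B" and a: "\<And>n. cmod (a n) \<le> V"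
  shows "(\<Sum>\<^sub>\<infinity>k. B n k * gauss_series c a (\<mu> k)) = a n"
proof -
  obtain C \<rho> where \<rho>: "\<rho> > 0" and C: "\<And>n k. cmod (B n k) \<le> C * exp (- \<rho> * \<bar>real_of_int n - \<mu> k\<bar>)"
    using B unfolding localized_inverse_def localized_def by blast
  obtain S where "exp_kernel_bound \<mu> 1 S"
    using ex_exp_kernel_bound[OF assms(2), of 1] by auto
  note S = exp_kernel_boundD[OF this]
  obtain S' where "exp_kernel_bound \<mu> \<rho> S'"
    using ex_exp_kernel_bound[OF assms(2) \<rho>] by blast
  note S' = exp_kernel_boundD[OF this]
  have "(\<Sum>\<^sub>\<infinity>k. B n k * gauss_series c a (\<mu> k))
      = (\<Sum>\<^sub>\<infinity>m. (\<Sum>\<^sub>\<infinity>k. B n k * gauss_kernel c (\<mu> k) m) * a m)"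
    unfolding gauss_series_kernel
    by (rule infsum_matrix_assoc[where g = "\<lambda>k. C * exp (- \<rho> * \<bar>real_of_int n - \<mu> k\<bar>)" and V = V
          and h = "\<lambda>k m. exp (1\<^sup>2 / (4 * Re c)) * exp (- 1 * \<bar>\<mu> k - real_of_int m\<bar>)" and S = "exp (1\<^sup>2 / (4 * Re c)) * S"])
       (auto simp only: infsum_cmult_right' intro!: mult_left_mono C a norm_gauss_kernel_le[OF assms(1)] S S' summable_on_cmult_right exp_ge_zero)
  also have "\<dots> = a n"
    using B by (simp add: localized_inverse_def infsum_of_bool_mult)
  finally show ?thesis .
qed

text \<open>Associativity again. Only the right identity is assumed, because the lemma also helps to
  derive the left one from it.\<close>

lemma localized_inverse_right:
  assumes "Re c > 0" "spread \<mu>" and B: "localized \<mu> B"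
    and AB: "\<And>j k. (\<Sum>\<^sub>\<infinity>n. gauss_kernel c (\<mu> j) n * B n k) = of_bool (j = k)" and y: "\<And>n. cmod (y n) \<le> V"
  shows "gauss_series c (\<lambda>n. \<Sum>\<^sub>\<infinity>k. B n k * y k) (\<mu> j) = y j"
proof -
  obtain C \<rho> where \<rho>: "\<rho> > 0" and C: "\<And>n k. cmod (B n k) \<le> C * exp (- \<rho> * \<bar>real_of_int n - \<mu> k\<bar>)"
    and C0: "C > 0"
    by (rule localizedE[OF B]) (rule that)
  obtain S where "exp_kernel_bound \<mu> 1 S"
    using ex_exp_kernel_bound[OF assms(2), of 1] by auto
  note S = exp_kernel_boundD[OF this]
  obtain S' where "exp_kernel_bound \<mu> \<rho> S'"
    using ex_exp_kernel_bound[OF assms(2) \<rho>] by blast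
  note S' = exp_kernel_boundD[OF this]
  have "gauss_series c (\<lambda>n. \<Sum>\<^sub>\<infinity>k. B n k * y k) (\<mu> j)
      = (\<Sum>\<^sub>\<infinity>k. (\<Sum>\<^sub>\<infinity>n. gauss_kernel c (\<mu> j) n * B n k) * y k)"
    unfolding gauss_series_kernel
    by (rule infsum_matrix_assoc[where h = "\<lambda>n k. C * exp (- \<rho> * \<bar>real_of_int n - \<mu> k\<bar>)" and V = V
          and g = "\<lambda>n. exp (1\<^sup>2 / (4 * Re c)) * exp (- 1 * \<bar>\<mu> j - real_of_int n\<bar>)" and S = "C * S'"])
       (auto simp only: infsum_cmult_right' intro!: mult_left_mono C y norm_gauss_kernel_le[OF assms(1)] S S' summable_on_cmult_right less_imp_le[OF C0])
  also have "\<dots> = y j"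
    by (simp add: AB infsum_of_bool_mult)
  finally show ?thesis .
qed

lemma localized_ell2:
  assumes "spread \<mu>" and B: "localized \<mu> B"
  obtains R where "R > 0"
    "\<And>y. y \<in> ell2 \<Longrightarrow> (\<lambda>n. \<Sum>\<^sub>\<infinity>k. B n k * y k) \<in> ell2"
    "\<And>y. y \<in> ell2 \<Longrightarrow> (ell2_norm (\<lambda>n. \<Sum>\<^sub>\<infinity>k. B n k * y k))\<^sup>2 \<le> R * (ell2_norm y)\<^sup>2"
proof -
  obtain C \<rho> where \<rho>: "\<rho> > 0" and C: "\<And>n k. cmod (B n k) \<le> C * exp (- \<rho> * \<bar>real_of_int n - \<mu> k\<bar>)"
    and C0: "C > 0"
    by (rule localizedE[OF B]) (rule that)
  obtain S where "exp_kernel_bound \<mu> \<rho> S"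
    using ex_exp_kernel_bound[OF assms(1) \<rho>] by blast
  note S = exp_kernel_boundD[OF this]
  note schur = schur_test[where K = "\<lambda>n k. C * exp (- \<rho> * \<bar>real_of_int n - \<mu> k\<bar>)"
      and M = B and R = "C * S" and R' = "C * S", OF C]
  have le: "(\<Sum>\<^sub>\<infinity>n. C * exp (- \<rho> * \<bar>real_of_int n - \<mu> k\<bar>)) \<le> C * S"
           "(\<Sum>\<^sub>\<infinity>k. C * exp (- \<rho> * \<bar>real_of_int n - \<mu> k\<bar>)) \<le> C * S" for k n
    unfolding infsum_cmult_right' using C0 S by (auto intro!: mult_left_mono)
  show ?thesis
  proof (rule that[of "(C * S) * (C * S) + 1"])
    fix y :: "int \<Rightarrow> complex" assume y: "y \<in> ell2"
    then have y': "(\<lambda>n. (cmod (y n))\<^sup>2) summable_on UNIV" by (simp add: ell2_def)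
    show "(\<lambda>n. \<Sum>\<^sub>\<infinity>k. B n k * y k) \<in> ell2"
      unfolding ell2_def mem_Collect_eq
      by (rule schur(1)[OF _ _ _ _ y']) (intro summable_on_cmult_right S le)+
    have "(ell2_norm (\<lambda>n. \<Sum>\<^sub>\<infinity>k. B n k * y k))\<^sup>2 \<le> (C * S) * (C * S) * (ell2_norm y)\<^sup>2"
      unfolding ell2_norm_sq
      by (rule schur(2)[OF _ _ _ _ y']) (intro summable_on_cmult_right S le)+
    then show "(ell2_norm (\<lambda>n. \<Sum>\<^sub>\<infinity>k. B n k * y k))\<^sup>2 \<le> ((C * S) * (C * S) + 1) * (ell2_norm y)\<^sup>2"
      by (rule order_trans) (simp add: distrib_right)
  qed (use C0 S in \<open>simp add: add_nonneg_pos\<close>)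
qed

text \<open>Samples at the integers determine the coefficients through the left inverse there. This
  evaluates the definite description in \<open>gauss_coeffs\<close> without complex
  analysis.\<close>

lemma gauss_coeffs_unique:
  assumes "Re c > 0" "localized_inverse c real_of_int B" "a \<in> ell2"
  shows "gauss_coeffs c (gauss_series c a) = a"
  unfolding gauss_coeffs_def
proof (rule the_equality)
  show "a' = a" if "a' \<in> ell2 \<and> gauss_series c a = gauss_series c a'" for a'
  proof
    fix n
    have "(\<Sum>\<^sub>\<infinity>k. B n k * gauss_series c b (real_of_int k)) = b n" if "b \<in> ell2" for b
      by (rule localized_inverse_left[OF assms(1) spread_of_int assms(2) ell2_bounded[OF that]])
    from this[of a] this[of a'] show "a' n = a n"
      using that assms(3) by simp
  qed
qed (use assms in auto)

text \<open>\<open>B\<close> is bounded on ell2 and inverts sampling, which yields the lower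
  inequality and the interpolant together. The inverse \<open>B0\<close> at the integers serves to
  identify \<open>gauss_norm\<close> with the norm of the coefficients.\<close>

lemma complete_interpolating_of_localized_inverse:
  assumes c: "Re c > 0" and B0: "localized_inverse c real_of_int B0"
    and \<mu>: "spread \<mu>" and B: "localized_inverse c \<mu> B"
  shows "complete_interpolating c \<mu>"
proof -
  have loc: "localized \<mu> B" and AB: "\<And>j k. (\<Sum>\<^sub>\<infinity>n. gauss_kernel c (\<mu> j) n * B n k) = of_bool (j = k)"
    using B by (auto simp: localized_inverse_def)
  obtain R where R: "R > 0"
    "\<And>a. a \<in> ell2 \<Longrightarrow> (\<lambda>k. (cmod (gauss_series c a (\<mu> k)))\<^sup>2) summable_on UNIV"
    "\<And>a. a \<in> ell2 \<Longrightarrow> (\<Sum>\<^sub>\<infinity>k. (cmod (gauss_series c a (\<mu> k)))\<^sup>2) \<le> R * (ell2_norm a)\<^sup>2"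
    using gauss_series_upper_bound[OF c \<mu>] by blast
  obtain R' where R': "R' > 0"
    "\<And>y. y \<in> ell2 \<Longrightarrow> (\<lambda>n. \<Sum>\<^sub>\<infinity>k. B n k * y k) \<in> ell2"
    "\<And>y. y \<in> ell2 \<Longrightarrow> (ell2_norm (\<lambda>n. \<Sum>\<^sub>\<infinity>k. B n k * y k))\<^sup>2 \<le> R' * (ell2_norm y)\<^sup>2"
    using localized_ell2[OF \<mu> loc] by blast
  have "sampling c \<mu>"
    unfolding sampling_def
  proof (intro exI conjI ballI)
    fix f assume "f \<in> gauss_space c"
    then obtain a where a: "a \<in> ell2" and f: "f = gauss_series c a"
      unfolding gauss_space_def by blast
    have norm: "gauss_norm c f = ell2_norm a"
      unfolding f gauss_norm_def gauss_coeffs_unique[OF c B0 a] ..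
    show "(\<lambda>n. (cmod (f (\<mu> n)))\<^sup>2) summable_on UNIV"
      unfolding f by (rule R(2)[OF a])
    show "(\<Sum>\<^sub>\<infinity>n. (cmod (f (\<mu> n)))\<^sup>2) \<le> R * (gauss_norm c f)\<^sup>2"
      unfolding norm unfolding f by (rule R(3)[OF a])
    have "(ell2_norm (\<lambda>n. \<Sum>\<^sub>\<infinity>k. B n k * gauss_series c a (\<mu> k)))\<^sup>2
        \<le> R' * (ell2_norm (\<lambda>k. gauss_series c a (\<mu> k)))\<^sup>2"
      by (rule R'(3)) (simp add: ell2_def R(2)[OF a])
    then show "1 / R' * (gauss_norm c f)\<^sup>2 \<le> (\<Sum>\<^sub>\<infinity>n. (cmod (f (\<mu> n)))\<^sup>2)"
      unfolding localized_inverse_left[OF c \<mu> B ell2_bounded[OF a]] norm ell2_norm_sq unfolding f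
      using R'(1) by (simp add: field_simps)
  qed (use R R' in simp_all)
  moreover have "interpolating c \<mu>"
    unfolding interpolating_def
  proof
    fix y :: "int \<Rightarrow> complex" assume y: "y \<in> ell2"
    show "\<exists>f\<in>gauss_space c. \<forall>n. f (\<mu> n) = y n"
      unfolding gauss_space_def
      using R'(2)[OF y] localized_inverse_right[OF c \<mu> loc AB, of y, OF ell2_bounded[OF y]] by blast
  qed
  ultimately show ?thesis
    unfolding complete_interpolating_def by blast
qed

section \<open>Products over perturbed integers\<close>

text \<open>The moduli of the coefficients are at most the coefficients of the product of the
  factors \<open>z + cmod (x j)\<close>, and at \<open>z = r\<close> each of its nonnegative terms
  is at most the whole. The radius \<open>r\<close> stays free, to be matched to the index
  \<open>m\<close>.\<close>

lemma norm_coeff_prod_linear_le: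
  fixes x :: "'i \<Rightarrow> complex"
  assumes "finite A" "0 \<le> r"
  shows "cmod (coeff (\<Prod>j\<in>A. [:- x j, 1:]) m) * r ^ m \<le> (\<Prod>j\<in>A. r + cmod (x j))"
  using assms(1)
proof (induction A arbitrary: m rule: finite_induct)
  case empty
  then show ?case by (cases m) auto
next
  case (insert j A)
  let ?p = "\<Prod>j\<in>A. [:- x j, 1:]" and ?P = "\<Prod>j\<in>A. r + cmod (x j)"
  have P0: "0 \<le> ?P"
    using assms(2) by (simp add: prod_nonneg)
  have *: "cmod (x j * coeff ?p m) * r ^ m \<le> cmod (x j) * ?P"
    using mult_left_mono[OF insert.IH[of m], of "cmod (x j)"] by (simp add: norm_mult mult_ac)
  show ?case
  proof (cases m)
    case 0
    then have "cmod (coeff (\<Prod>j\<in>insert j A. [:- x j, 1:]) m) * r ^ m = cmod (x j * coeff ?p m) * r ^ m"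
      using insert.hyps by (simp add: norm_mult)
    also have "\<dots> \<le> (r + cmod (x j)) * ?P"
      using * mult_nonneg_nonneg[OF assms(2) P0] by (simp add: distrib_right)
    finally show ?thesis using insert.hyps by simp
  next
    case (Suc l)
    have "cmod (coeff ?p l - x j * coeff ?p m) * r ^ m
        \<le> (cmod (coeff ?p l) + cmod (x j * coeff ?p m)) * r ^ m"
      by (intro mult_right_mono norm_triangle_ineq4) (simp add: assms(2))
    also have "\<dots> = r * (cmod (coeff ?p l) * r ^ l) + cmod (x j * coeff ?p m) * r ^ m"
      by (simp add: Suc algebra_simps)
    also have "\<dots> \<le> r * ?P + cmod (x j) * ?P"
      by (intro add_mono mult_left_mono insert.IH * assms(2))
    finally show ?thesis using insert.hyps Suc by (simp add: distrib_right)
  qed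
qed

section \<open>Lagrange interpolation and divided differences\<close>

lemma degree_prod_linear:
  fixes x :: "'i \<Rightarrow> 'a::idom"
  shows "degree (\<Prod>j\<in>A. [:- x j, 1:]) = card A"
  by (subst degree_prod_sum_eq) auto

lemma monic_prod_linear:
  fixes x :: "'i \<Rightarrow> 'a::idom"
  shows "coeff (\<Prod>j\<in>A. [:- x j, 1:]) (card A) = 1"
  using lead_coeff_prod[of "\<lambda>j. [:- x j, 1:]" A] by (simp add: degree_prod_linear)

text \<open>Both sides have degree below \<open>card J\<close> and agree at the
  \<open>card J\<close> distinct points.\<close>

lemma lagrange_monom:
  fixes x :: "'i \<Rightarrow> 'a::field"
  assumes J: "finite J" "inj_on x J" and m: "m < card J"
  shows "(\<Sum>k\<in>J. smult (x k ^ m / (\<Prod>j\<in>J - {k}. x k - x j)) (\<Prod>j\<in>J - {k}. [:- x j, 1:])) = monom 1 m"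
    (is "?L = _")
proof (rule poly_eqI_degree[where A = "x ` J"])
  have card: "card (x ` J) = card J"
    by (rule card_image[OF J(2)])
  have "degree ?L \<le> card J - 1"
  proof (rule degree_sum_le[OF J(1)])
    fix k assume "k \<in> J"
    have "degree (smult (x k ^ m / (\<Prod>j\<in>J - {k}. x k - x j)) (\<Prod>j\<in>J - {k}. [:- x j, 1:]))
        \<le> card (J - {k})"
      using degree_smult_le degree_prod_linear by metis
    then show "degree (smult (x k ^ m / (\<Prod>j\<in>J - {k}. x k - x j)) (\<Prod>j\<in>J - {k}. [:- x j, 1:])) \<le> card J - 1"
      using \<open>k \<in> J\<close> J(1) by simp
  qed
  then show "degree ?L < card (x ` J)"
    using m card by linarith
  show "degree (monom (1::'a) m) < card (x ` J)"
    using m card degree_monom_le[of "1::'a" m] by linarith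
  fix y assume "y \<in> x ` J"
  then obtain i where i: "i \<in> J" "y = x i" by blast
  have "poly ?L y = (\<Sum>k\<in>J. x k ^ m / (\<Prod>j\<in>J - {k}. x k - x j) * (\<Prod>j\<in>J - {k}. x i - x j))"
    by (simp add: poly_sum poly_prod i)
  also have "\<dots> = (\<Sum>k\<in>J. if k = i then x i ^ m else 0)"
  proof (rule sum.cong[OF refl])
    fix k assume k: "k \<in> J"
    show "x k ^ m / (\<Prod>j\<in>J - {k}. x k - x j) * (\<Prod>j\<in>J - {k}. x i - x j) = (if k = i then x i ^ m else 0)"
    proof (cases "k = i")
      case True
      have "(\<Prod>j\<in>J - {i}. x i - x j) \<noteq> 0"
        using J i by (auto simp: inj_on_def)
      then show ?thesis using True by simp
    next
      case False
      then have "(\<Prod>j\<in>J - {k}. x i - x j) = 0"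
        using J(1) i by (intro prod_zero) auto
      then show ?thesis using False by simp
    qed
  qed
  also have "\<dots> = x i ^ m"
    using i J(1) by simp
  finally show "poly ?L y = poly (monom 1 m) y"
    by (simp add: poly_monom i)
qed

text \<open>Inverse times Vandermonde matrix. The product in the other order is the evaluation of
  the Lagrange basis at the nodes and needs no such lemma.\<close>

lemma lagrange_coeff:
  fixes x :: "'i \<Rightarrow> 'a::field"
  assumes "finite J" "inj_on x J" "m < card J"
  shows "(\<Sum>k\<in>J. x k ^ m / (\<Prod>j\<in>J - {k}. x k - x j) * coeff (\<Prod>j\<in>J - {k}. [:- x j, 1:]) i) = of_bool (i = m)"
proof -
  have "(\<Sum>k\<in>J. x k ^ m / (\<Prod>j\<in>J - {k}. x k - x j) * coeff (\<Prod>j\<in>J - {k}. [:- x j, 1:]) i)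
      = coeff (monom 1 m) i"
    by (subst lagrange_monom[OF assms, symmetric]) (simp add: coeff_sum)
  then show ?thesis by auto
qed

text \<open>The basis polynomials are monic of degree \<open>card J - 1\<close>, so the sum is the
  coefficient of that degree in the interpolated monomial, whose exponent is smaller.\<close>

lemma divided_difference_power:
  fixes x :: "'i \<Rightarrow> 'a::field"
  assumes "finite J" "inj_on x J" "Suc m < card J"
  shows "(\<Sum>k\<in>J. x k ^ m / (\<Prod>j\<in>J - {k}. x k - x j)) = 0"
proof -
  have "(\<Sum>k\<in>J. x k ^ m / (\<Prod>j\<in>J - {k}. x k - x j))
      = (\<Sum>k\<in>J. x k ^ m / (\<Prod>j\<in>J - {k}. x k - x j) * coeff (\<Prod>j\<in>J - {k}. [:- x j, 1:]) (card J - 1))"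
  proof (rule sum.cong[OF refl])
    fix k assume "k \<in> J"
    then have "coeff (\<Prod>j\<in>J - {k}. [:- x j, 1:]) (card J - 1) = 1"
      using monic_prod_linear[of x "J - {k}"] assms(1) by simp
    then show "x k ^ m / (\<Prod>j\<in>J - {k}. x k - x j)
        = x k ^ m / (\<Prod>j\<in>J - {k}. x k - x j) * coeff (\<Prod>j\<in>J - {k}. [:- x j, 1:]) (card J - 1)"
      by simp
  qed
  also have "\<dots> = of_bool (card J - 1 = m)"
    by (rule lagrange_coeff) (use assms in auto)
  finally show ?thesis using assms by simp
qed

section \<open>Signed partial sums over the integers\<close>

definition cumul :: "(int \<Rightarrow> real) \<Rightarrow> int \<Rightarrow> real" where
  "cumul f t = (if 0 \<le> t then \<Sum>i\<in>{0<..t}. f i else - (\<Sum>i\<in>{t<..0}. f i))"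

lemma cumul_step: "cumul f (t + 1) = cumul f t + f (t + 1)"
proof (cases "0 \<le> t")
  case True
  then have "{0<..t + 1} = insert (t + 1) {0<..t}" by auto
  then show ?thesis using True by (simp add: cumul_def)
next
  case False
  then have "{t<..0} = insert (t + 1) {t + 1<..0}" by auto
  then show ?thesis using False by (auto simp: cumul_def)
qed

text \<open>The sign convention of \<open>cumul\<close> at negative arguments makes every block sum
  a difference, wherever 0 lies relative to the block.\<close>

lemma sum_eq_cumul:
  assumes "a \<le> b"
  shows "(\<Sum>i\<in>{a<..b}. f i) = cumul f b - cumul f a"
  using assms
proof (induction b rule: int_ge_induct)
  case (step b)
  have "{a<..b + 1} = insert (b + 1) {a<..b}" using step(1) by auto
  then show ?case using step by (simp add: cumul_step)
qed simp

text \<open>Separates the unperturbed positions, with the formula for \<open>1 + ... + t\<close>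
  continued to negative \<open>t\<close>, from the displacements.\<close>

lemma cumul_diff_of_int:
  "cumul \<mu> t = cumul (\<lambda>i. \<mu> i - of_int i) t + of_int t * (of_int t + 1) / 2"
proof -
  have "cumul (\<lambda>i. \<mu> i - of_int i) t = cumul \<mu> t - of_int t * (of_int t + 1) / 2"
  proof (induction t rule: int_induct[where k = 0])
    case base
    show ?case by (simp add: cumul_def)
  next
    case (step1 i)
    then show ?case unfolding cumul_step by (simp add: field_simps)
  next
    case (step2 i)
    then show ?case
      using cumul_step[of "\<lambda>i. \<mu> i - of_int i" "i - 1"] cumul_step[of \<mu> "i - 1"] by (simp add: field_simps)
  qed
  then show ?thesis by simp
qed

text \<open>A lower bound of exponential form turns a product of such factors into the exponential
  of a sum, which will be a geometric series. The constant \<open>1 - exp (- s0)\<close> is the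
  least value of \<open>1 - exp s\<close> for \<open>s \<le> - s0\<close>.\<close>

lemma abs_one_minus_exp_ge:
  fixes s :: real
  assumes "s0 > 0" "s0 \<le> \<bar>s\<bar>"
  shows "exp (- exp s / (1 - exp (- s0))) \<le> \<bar>1 - exp s\<bar>"
proof -
  define q where "q = 1 - exp (- s0)"
  have q: "0 < q" "q < 1" using assms by (auto simp: q_def)
  show ?thesis
  proof (cases "s > 0")
    \<comment> \<open>Here \<open>exp s\<close> is at least 1, so the left side is at most
      \<open>exp (- (1 / q))\<close>; this is at most \<open>q\<close>, which in turn is at most
      \<open>exp s - 1\<close>.\<close>
    case True
    have "q * exp (- s0) \<le> q * 1" using q assms by (intro mult_left_mono) auto
    have "q \<le> exp s0 - 1"
    proof -
      have "exp s0 - 1 - q = exp (-s0) * (exp s0 - 1)\<^sup>2"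
        by (simp add: q_def power2_eq_square algebra_simps exp_minus field_simps)
      then show ?thesis using zero_le_power2[of "exp s0 - 1"] by (smt (verit) exp_gt_zero zero_le_mult_iff)
    qed
    also have "\<dots> \<le> exp s - 1" using True assms by simp
    finally have *: "q \<le> \<bar>1 - exp s\<bar>" by linarith
    have "1 / q \<le> exp s / q" using q True by (intro divide_right_mono) auto
    then have "exp (- exp s / q) \<le> exp (- (1 / q))" by simp
    also have "\<dots> \<le> q"
    proof -
      have "1 / q \<le> exp (1 / q)" using exp_ge_add_one_self[of "1 / q"] by linarith
      then show ?thesis using q by (simp add: exp_minus field_simps)
    qed
    finally show ?thesis using * unfolding q_def by linarith
  next
    case False
    then have s: "exp s \<le> exp (- s0)" using assms by simp
    define y where "y = exp s"
    have y: "0 < y" "y \<le> 1 - q" using s by (auto simp: y_def q_def)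
    have "1 / (1 - y) \<le> exp (y / (1 - y))"
    proof -
      have "1 / (1 - y) = 1 + y / (1 - y)" using y q by (simp add: field_simps)
      also have "\<dots> \<le> exp (y / (1 - y))" by (rule exp_ge_add_one_self)
      finally show ?thesis .
    qed
    also have "\<dots> \<le> exp (y / q)"
      using y q by (simp add: frac_le)
    finally have "exp (- (y / q)) \<le> 1 - y"
      using y q by (simp add: exp_minus field_simps)
    then show ?thesis using y q unfolding y_def q_def by simp
  qed
qed

text \<open>\<open>E\<close> is the product of the larger modulus of each pair, where larger is
  decided by the index \<open>i \<le> r\<close> and not by comparing \<open>u\<close> with
  \<open>\<mu> i\<close>; wrong decisions near \<open>r\<close> go into \<open>C\<close>. Deciding
  by index turns the exponent into a partial sum, and \<open>C\<close> is uniform in the finite set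
  \<open>J\<close>.\<close>

definition node_product_bound :: "real \<Rightarrow> (int \<Rightarrow> real) \<Rightarrow> real \<Rightarrow> real \<Rightarrow> real \<Rightarrow> bool" where
  "node_product_bound \<alpha> \<mu> \<sigma> D C \<longleftrightarrow> 0 < C \<and>
     (\<forall>J u r. finite J \<longrightarrow> \<bar>u - of_int r\<bar> \<le> D \<longrightarrow>
       (let E = exp (2 * \<alpha> * (\<Sum>i\<in>J. if i \<le> r then u else \<mu> i)) in
         (\<Prod>i\<in>J. exp (2 * \<alpha> * u) + exp (2 * \<alpha> * \<mu> i)) \<le> C * E \<and>
         ((\<forall>i\<in>J. \<sigma> \<le> \<bar>u - \<mu> i\<bar>) \<longrightarrow> E \<le> C * (\<Prod>i\<in>J. \<bar>exp (2 * \<alpha> * u) - exp (2 * \<alpha> * \<mu> i)\<bar>))))"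

lemma node_product_boundD:
  assumes "node_product_bound \<alpha> \<mu> \<sigma> D C"
  shows "C > 0"
    "finite J \<Longrightarrow> \<bar>u - of_int r\<bar> \<le> D \<Longrightarrow>
       (\<Prod>i\<in>J. exp (2 * \<alpha> * u) + exp (2 * \<alpha> * \<mu> i)) \<le> C * exp (2 * \<alpha> * (\<Sum>i\<in>J. if i \<le> r then u else \<mu> i))"
    "finite J \<Longrightarrow> \<bar>u - of_int r\<bar> \<le> D \<Longrightarrow> (\<And>i. i \<in> J \<Longrightarrow> \<sigma> \<le> \<bar>u - \<mu> i\<bar>) \<Longrightarrow>
       exp (2 * \<alpha> * (\<Sum>i\<in>J. if i \<le> r then u else \<mu> i)) \<le> C * (\<Prod>i\<in>J. \<bar>exp (2 * \<alpha> * u) - exp (2 * \<alpha> * \<mu> i)\<bar>)"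
  using assms unfolding node_product_bound_def Let_def by blast+

text \<open>After the nominally larger exponential is factored out, there remains
  \<open>1 + exp s\<close> or \<open>\<bar>1 - exp s\<bar>\<close>, with \<open>s\<close> at most a
  constant minus \<open>2 * \<alpha> * \<bar>r - i\<bar>\<close>. The sum of the
  \<open>exp s\<close> is thus bounded by a geometric series, uniformly in \<open>J\<close>,
  \<open>u\<close> and \<open>r\<close>, and it controls both products.\<close>

lemma ex_node_product_bound:
  fixes \<mu> :: "int \<Rightarrow> real"
  assumes \<alpha>: "\<alpha> > 0" and \<sigma>: "\<sigma> > 0" and D: "\<And>i. \<bar>\<mu> i - of_int i\<bar> \<le> D"
  shows "\<exists>C. node_product_bound \<alpha> \<mu> \<sigma> D' C"
proof -
  obtain S where "exp_kernel_bound of_int (2 * \<alpha>) S"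
    using ex_exp_kernel_bound[OF spread_of_int, of "2 * \<alpha>"] \<alpha> by auto
  note S = exp_kernel_boundD[OF this]
  define K where "K = exp (2 * \<alpha> * (D + D'))"
  define q where "q = 1 - exp (- (2 * \<alpha> * \<sigma>))"
  have q: "0 < q" "q < 1" using \<alpha> \<sigma> by (auto simp: q_def)
  define v where "v = (\<lambda>u r i. if i \<le> r then u else \<mu> i)"
  \<comment> \<open>\<open>s\<close> can be positive where the order of indices disagrees with the
    order of positions, which happens only for \<open>i\<close> near \<open>r\<close>; hence the
    need for a lower bound of \<open>\<bar>1 - exp s\<bar>\<close> that covers both signs.\<close>
  define s where "s = (\<lambda>u r i. if i \<le> r then 2 * \<alpha> * (\<mu> i - u) else 2 * \<alpha> * (u - \<mu> i))"
  have p: "exp x + exp y = exp x * (1 + exp (y - x))" and m: "\<bar>exp x - exp y\<bar> = exp x * \<bar>1 - exp (y - x)\<bar>"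
    for x y :: real
  proof -
    have "exp x - exp y = exp x * (1 - exp (y - x))"
      by (simp add: right_diff_distrib flip: exp_add)
    then show "\<bar>exp x - exp y\<bar> = exp x * \<bar>1 - exp (y - x)\<bar>"
      by (simp add: abs_mult)
  qed (simp add: distrib_left flip: exp_add)
  have plus: "exp (2 * \<alpha> * u) + exp (2 * \<alpha> * \<mu> i) = exp (2 * \<alpha> * v u r i) * (1 + exp (s u r i))"
    and minus: "\<bar>exp (2 * \<alpha> * u) - exp (2 * \<alpha> * \<mu> i)\<bar> = exp (2 * \<alpha> * v u r i) * \<bar>1 - exp (s u r i)\<bar>"
    for u r i
    using p[of "2 * \<alpha> * u" "2 * \<alpha> * \<mu> i"] p[of "2 * \<alpha> * \<mu> i" "2 * \<alpha> * u"]
      m[of "2 * \<alpha> * u" "2 * \<alpha> * \<mu> i"] m[of "2 * \<alpha> * \<mu> i" "2 * \<alpha> * u"]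
    by (auto simp: v_def s_def right_diff_distrib add.commute abs_minus_commute)
  have small: "(\<Sum>i\<in>J. exp (s u r i)) \<le> K * S" if J: "finite J" and u: "\<bar>u - of_int r\<bar> \<le> D'" for J u r
  proof -
    have "exp (s u r i) \<le> K * exp (- (2 * \<alpha>) * \<bar>of_int r - of_int i\<bar>)" for i
    proof -
      have "(if i \<le> r then \<mu> i - u else u - \<mu> i) \<le> D + D' - \<bar>of_int r - of_int i\<bar>"
        using D[of i] u by auto
      then have "2 * \<alpha> * (if i \<le> r then \<mu> i - u else u - \<mu> i) \<le> 2 * \<alpha> * (D + D' - \<bar>of_int r - of_int i\<bar>)"
        using \<alpha> by (intro mult_left_mono) auto
      then have "s u r i \<le> 2 * \<alpha> * (D + D') + - (2 * \<alpha>) * \<bar>of_int r - of_int i\<bar>"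
        by (simp add: s_def algebra_simps split: if_splits)
      then show ?thesis unfolding K_def exp_add[symmetric] by simp
    qed
    then have "(\<Sum>i\<in>J. exp (s u r i)) \<le> (\<Sum>i\<in>J. K * exp (- (2 * \<alpha>) * \<bar>of_int r - of_int i\<bar>))"
      by (rule sum_mono)
    also have "\<dots> \<le> K * S"
      unfolding sum_distrib_left[symmetric]
      using finite_sum_le_infsum[OF S(2) J, of "of_int r"] S(3)[of "of_int r"]
      by (intro mult_left_mono) (auto simp: K_def)
    finally show ?thesis .
  qed
  have K: "K > 0" by (simp add: K_def)
  have "node_product_bound \<alpha> \<mu> \<sigma> D' (exp (K * S / q))"
    unfolding node_product_bound_def Let_def
  proof (intro conjI allI impI)
    fix J :: "int set" and u r assume J: "finite J" and u: "\<bar>u - of_int r\<bar> \<le> D'"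
    have E: "exp (2 * \<alpha> * (\<Sum>i\<in>J. if i \<le> r then u else \<mu> i)) = (\<Prod>i\<in>J. exp (2 * \<alpha> * v u r i))"
      unfolding v_def sum_distrib_left exp_sum[OF J] ..
    have "(\<Prod>i\<in>J. 1 + exp (s u r i)) \<le> (\<Prod>i\<in>J. exp (exp (s u r i)))"
      by (intro prod_mono) (auto simp: add_nonneg_nonneg)
    also have "\<dots> = exp (\<Sum>i\<in>J. exp (s u r i))"
      by (rule exp_sum[OF J, symmetric])
    also have "\<dots> \<le> exp (K * S / q)"
    proof -
      have "K * S \<le> K * S / q" using K S q by (simp add: field_simps)
      then show ?thesis using small[OF J u] by simp
    qed
    finally show "(\<Prod>i\<in>J. exp (2 * \<alpha> * u) + exp (2 * \<alpha> * \<mu> i))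
        \<le> exp (K * S / q) * exp (2 * \<alpha> * (\<Sum>i\<in>J. if i \<le> r then u else \<mu> i))"
      unfolding E plus[of u _ r] prod.distrib by (simp add: mult.commute prod_nonneg mult_right_mono)
    assume far: "\<forall>i\<in>J. \<sigma> \<le> \<bar>u - \<mu> i\<bar>"
    have "exp (- (K * S / q)) \<le> exp (- ((\<Sum>i\<in>J. exp (s u r i)) / q))"
      using small[OF J u] q by (simp add: divide_right_mono)
    also have "\<dots> = (\<Prod>i\<in>J. exp (- exp (s u r i) / q))"
      by (simp add: exp_sum[OF J, symmetric] sum_negf sum_divide_distrib)
    also have "\<dots> \<le> (\<Prod>i\<in>J. \<bar>1 - exp (s u r i)\<bar>)"
    proof (intro prod_mono conjI)
      fix i assume "i \<in> J"
      have "2 * \<alpha> * \<sigma> \<le> 2 * \<alpha> * \<bar>u - \<mu> i\<bar>"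
        using bspec[OF far \<open>i \<in> J\<close>] \<alpha> by (intro mult_left_mono) auto
      also have "\<dots> = \<bar>s u r i\<bar>"
        using \<alpha> by (auto simp: s_def abs_mult abs_minus_commute)
      finally show "exp (- exp (s u r i) / q) \<le> \<bar>1 - exp (s u r i)\<bar>"
        unfolding q_def by (intro abs_one_minus_exp_ge) (use \<alpha> \<sigma> in auto)
    qed simp
    finally have "1 \<le> exp (K * S / q) * (\<Prod>i\<in>J. \<bar>1 - exp (s u r i)\<bar>)"
      by (simp add: exp_minus field_simps)
    from mult_left_mono[OF this, of "\<Prod>i\<in>J. exp (2 * \<alpha> * v u r i)"]
    show "exp (2 * \<alpha> * (\<Sum>i\<in>J. if i \<le> r then u else \<mu> i))
        \<le> exp (K * S / q) * (\<Prod>i\<in>J. \<bar>exp (2 * \<alpha> * u) - exp (2 * \<alpha> * \<mu> i)\<bar>)"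
      unfolding E minus[of u _ r] prod.distrib by (simp add: prod_nonneg mult_ac)
  qed simp
  then show ?thesis ..
qed

lemma sum_split_cumul:
  assumes "a \<le> r" "r \<le> b"
  shows "(\<Sum>i\<in>{a<..b}. if i \<le> r then u else f i) = of_int (r - a) * u + cumul f b - cumul f r"
proof -
  have "{a<..b} = {a<..r} \<union> {r<..b}" using assms by auto
  then have "(\<Sum>i\<in>{a<..b}. if i \<le> r then u else f i)
      = (\<Sum>i\<in>{a<..r}. if i \<le> r then u else f i) + (\<Sum>i\<in>{r<..b}. if i \<le> r then u else f i)"
    by (simp add: sum.union_disjoint)
  also have "(\<Sum>i\<in>{a<..r}. if i \<le> r then u else f i) = (\<Sum>i\<in>{a<..r}. u)"
    by (rule sum.cong) auto
  also have "(\<Sum>i\<in>{r<..b}. if i \<le> r then u else f i) = (\<Sum>i\<in>{r<..b}. f i)"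
    by (rule sum.cong) auto
  finally show ?thesis
    using assms by (simp add: sum_eq_cumul)
qed

section \<open>Sufficiency\<close>

text \<open>Up to a row factor and a column factor, the row of \<open>x\<close> is a geometric
  sequence. Frequencies are counted from \<open>a + 1\<close> so that the powers are natural
  numbers.\<close>

lemma gauss_kernel_node:
  assumes "a < n"
  shows "gauss_kernel c x n = exp (- c * (of_real x)\<^sup>2 + 2 * c * of_real x * of_int (a + 1))
     * exp (2 * c * of_real x) ^ nat (n - a - 1) * exp (- c * (of_int n)\<^sup>2)"
proof -
  have "exp (2 * c * of_real x) ^ nat (n - a - 1) = exp (of_nat (nat (n - a - 1)) * (2 * c * of_real x))"
    by (rule exp_of_nat_mult[symmetric])
  also have "(of_nat (nat (n - a - 1)) :: complex) = of_int n - of_int a - 1"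
  proof -
    have "(of_nat (nat (n - a - 1)) :: complex) = of_int (int (nat (n - a - 1)))"
      by (rule of_int_of_nat_eq[symmetric])
    also have "int (nat (n - a - 1)) = n - a - 1" using assms by simp
    finally show ?thesis by simp
  qed
  finally have "exp (- c * (of_real x)\<^sup>2 + 2 * c * of_real x * of_int (a + 1))
     * exp (2 * c * of_real x) ^ nat (n - a - 1) * exp (- c * (of_int n)\<^sup>2)
     = exp (- c * (of_real x)\<^sup>2 + 2 * c * of_real x * of_int (a + 1)
        + (of_int n - of_int a - 1) * (2 * c * of_real x) + - c * (of_int n)\<^sup>2)"
    by (simp only: exp_add)
  also have "- c * (of_real x)\<^sup>2 + 2 * c * of_real x * of_int (a + 1)
        + (of_int n - of_int a - 1) * (2 * c * of_real x) + - c * (of_int n)\<^sup>2 = - c * (of_real x - of_int n)\<^sup>2"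
    by (simp add: power2_eq_square algebra_simps)
  finally show ?thesis
    unfolding gauss_kernel_def by (rule sym)
qed

text \<open>The complex exponential is not injective, but the moduli already distinguish the
  nodes.\<close>

lemma inj_node:
  fixes \<mu> :: "'a \<Rightarrow> real"
  assumes "Re c > 0" "\<sigma> > 0" and sep: "\<And>i j. i \<noteq> j \<Longrightarrow> \<sigma> \<le> \<bar>\<mu> i - \<mu> j\<bar>"
  shows "inj (\<lambda>j. exp (2 * c * of_real (\<mu> j)))"
proof (rule injI, rule ccontr)
  fix i j assume "exp (2 * c * of_real (\<mu> i)) = exp (2 * c * of_real (\<mu> j))" "i \<noteq> j"
  from this(1) have "cmod (exp (2 * c * of_real (\<mu> i))) = cmod (exp (2 * c * of_real (\<mu> j)))" by simp
  then have "\<mu> i = \<mu> j" using assms(1) by (simp add: norm_exp_eq_Re)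
  then show False using sep[OF \<open>i \<noteq> j\<close>] assms(2) by simp
qed

text \<open>Vanishing outside \<open>J\<close> lets the finite identities be read as infinite sums
  when the sections grow.\<close>

definition section_inverse :: "complex \<Rightarrow> (int \<Rightarrow> real) \<Rightarrow> int set \<Rightarrow> (int \<Rightarrow> int \<Rightarrow> complex) \<Rightarrow> bool" where
  "section_inverse c \<mu> J B \<longleftrightarrow> (\<forall>n k. n \<notin> J \<or> k \<notin> J \<longrightarrow> B n k = 0) \<and>
     (\<forall>j\<in>J. \<forall>k\<in>J. (\<Sum>n\<in>J. gauss_kernel c (\<mu> j) n * B n k) = of_bool (j = k)) \<and>
     (\<forall>n\<in>J. \<forall>m\<in>J. (\<Sum>k\<in>J. B n k * gauss_kernel c (\<mu> k) m) = of_bool (n = m))"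

text \<open>In the bound for a single entry the endpoints \<open>a\<close> and \<open>b\<close>
  cancel, so one constant serves all windows. The squares cancel up to a bounded term as well, and
  the decay in \<open>\<bar>n - k\<bar>\<close> is what remains of half the sum of \<open>n\<close>
  and \<open>k\<close> minus their maximum.\<close>

lemma finite_section_inverse:
  assumes c: "Re c > 0" and \<sigma>: "\<sigma> > 0" and D: "\<And>i. \<bar>\<mu> i - of_int i\<bar> \<le> D"
    and sep: "\<And>i j. i \<noteq> j \<Longrightarrow> \<sigma> \<le> \<bar>\<mu> i - \<mu> j\<bar>"
  obtains C where "C > 0" "\<And>a b. \<exists>B. section_inverse c \<mu> {a<..b} B \<and>
      (\<forall>n k. cmod (B n k) \<le> C * exp (- Re c * (\<bar>of_int (n - k)\<bar>
         + 2 * (cumul (\<lambda>i. \<mu> i - of_int i) n - cumul (\<lambda>i. \<mu> i - of_int i) k))))"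
proof -
  define \<alpha> where "\<alpha> = Re c"
  have \<alpha>: "\<alpha> > 0" using c by (simp add: \<alpha>_def)
  have D0: "D \<ge> 0" using D[of 0] by simp
  define S where "S = cumul (\<lambda>i. \<mu> i - of_int i)"
  define R where "R = cumul \<mu>"
  have RS: "R t = S t + of_int t * (of_int t + 1) / 2" for t
    unfolding R_def S_def by (rule cumul_diff_of_int)
  obtain C1 where "node_product_bound \<alpha> \<mu> \<sigma> D C1"
    using ex_node_product_bound[OF \<alpha> \<sigma> D] by blast
  note C1 = node_product_boundD[OF this]
  define w where "w = (\<lambda>j. exp (2 * c * of_real (\<mu> j)))"
  have norm_w: "cmod (w j) = exp (2 * \<alpha> * \<mu> j)" for j
    by (simp add: w_def \<alpha>_def norm_exp_eq_Re)
  have inj_w: "inj w"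
    unfolding w_def by (rule inj_node[OF c \<sigma> sep])
  show ?thesis
  proof (rule that[of "C1 * C1 * exp (2 * \<alpha> * (D + D\<^sup>2 / 2))"])
    fix a b :: int
    let ?J = "{a<..b}"
    define P where "P = (\<lambda>k. \<Prod>j\<in>?J - {k}. [:- w j, 1:])"
    define Q where "Q = (\<lambda>k. \<Prod>j\<in>?J - {k}. w k - w j)"
    define e where "e = (\<lambda>x::real. - c * (of_real x)\<^sup>2 + 2 * c * of_real x * of_int (a + 1))"
    \<comment> \<open>Coefficients of the Lagrange basis polynomials, with the row and column
      factors of \<open>gauss_kernel_node\<close> undone.\<close>
    define B where "B = (\<lambda>n k. if n \<in> ?J \<and> k \<in> ?J
      then coeff (P k) (nat (n - a - 1)) / Q k * exp (c * (of_int n)\<^sup>2 - e (\<mu> k)) else 0)"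
    have kern: "gauss_kernel c (\<mu> j) n = exp (e (\<mu> j)) * w j ^ nat (n - a - 1) * exp (- c * (of_int n)\<^sup>2)"
      if "n \<in> ?J" for j n
      unfolding e_def w_def by (rule gauss_kernel_node) (use that in simp)
    have Q0: "Q k \<noteq> 0" for k
      using inj_w by (auto simp: Q_def inj_def)
    have "(\<Sum>n\<in>?J. gauss_kernel c (\<mu> j) n * B n k) = of_bool (j = k)" if j: "j \<in> ?J" and k: "k \<in> ?J" for j k
    proof -
      have "(\<Sum>n\<in>?J. gauss_kernel c (\<mu> j) n * B n k)
          = (\<Sum>n\<in>?J. exp (e (\<mu> j) - e (\<mu> k)) / Q k * (coeff (P k) (nat (n - a - 1)) * w j ^ nat (n - a - 1)))"
      proof (rule sum.cong[OF refl])
        fix n assume n: "n \<in> ?J"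
        have "exp (e (\<mu> j)) * exp (- c * (of_int n)\<^sup>2) * exp (c * (of_int n)\<^sup>2 - e (\<mu> k)) = exp (e (\<mu> j) - e (\<mu> k))"
          by (simp flip: exp_add)
        then show "gauss_kernel c (\<mu> j) n * B n k
          = exp (e (\<mu> j) - e (\<mu> k)) / Q k * (coeff (P k) (nat (n - a - 1)) * w j ^ nat (n - a - 1))"
          using n k by (simp add: kern[OF n] B_def field_simps)
      qed
      also have "\<dots> = exp (e (\<mu> j) - e (\<mu> k)) / Q k * (\<Sum>n\<in>?J. coeff (P k) (nat (n - a - 1)) * w j ^ nat (n - a - 1))"
        by (rule sum_distrib_left[symmetric])
      also have "(\<Sum>n\<in>?J. coeff (P k) (nat (n - a - 1)) * w j ^ nat (n - a - 1)) = (\<Sum>i\<le>degree (P k). coeff (P k) i * w j ^ i)"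
      proof (rule sum.reindex_bij_witness[where i = "\<lambda>i. int i + a + 1" and j = "\<lambda>n. nat (n - a - 1)"])
        have deg: "degree (P k) = nat (b - a) - 1"
          unfolding P_def degree_prod_linear using k by simp
        show "int i + a + 1 \<in> ?J" if "i \<in> {..degree (P k)}" for i
          using that k unfolding deg by auto
        show "nat (n - a - 1) \<in> {..degree (P k)}" if "n \<in> ?J" for n
          using that unfolding deg by auto
      qed auto
      also have "\<dots> = (\<Prod>i\<in>?J - {k}. w j - w i)"
        unfolding poly_altdef[symmetric] by (simp add: P_def poly_prod)
      also have "\<dots> = of_bool (j = k) * Q k"
      proof (cases "j = k")
        case False
        then have "(\<Prod>i\<in>?J - {k}. w j - w i) = 0" using j by (intro prod_zero) auto
        then show ?thesis using False by simp
      qed (simp add: Q_def)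
      finally show ?thesis using Q0[of k] by simp
    qed
    moreover have "(\<Sum>k\<in>?J. B n k * gauss_kernel c (\<mu> k) m) = of_bool (n = m)" if n: "n \<in> ?J" and m: "m \<in> ?J" for n m
    proof -
      have "(\<Sum>k\<in>?J. B n k * gauss_kernel c (\<mu> k) m)
          = (\<Sum>k\<in>?J. exp (c * (of_int n)\<^sup>2 - c * (of_int m)\<^sup>2)
               * (w k ^ nat (m - a - 1) / Q k * coeff (P k) (nat (n - a - 1))))"
      proof (rule sum.cong[OF refl])
        fix k assume k: "k \<in> ?J"
        have "exp (c * (of_int n)\<^sup>2 - e (\<mu> k)) * exp (e (\<mu> k)) * exp (- c * (of_int m)\<^sup>2)
            = exp (c * (of_int n)\<^sup>2 - c * (of_int m)\<^sup>2)"
          by (simp flip: exp_add)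
        then show "B n k * gauss_kernel c (\<mu> k) m = exp (c * (of_int n)\<^sup>2 - c * (of_int m)\<^sup>2)
               * (w k ^ nat (m - a - 1) / Q k * coeff (P k) (nat (n - a - 1)))"
          using n k by (simp add: kern[OF m] B_def field_simps)
      qed
      also have "\<dots> = exp (c * (of_int n)\<^sup>2 - c * (of_int m)\<^sup>2) * of_bool (nat (n - a - 1) = nat (m - a - 1))"
        unfolding sum_distrib_left[symmetric] P_def Q_def
        by (subst lagrange_coeff) (use m inj_w in \<open>auto intro: inj_on_subset\<close>)
      also have "\<dots> = of_bool (n = m)"
        using n m by auto
      finally show ?thesis .
    qed
    moreover have B_bound: "cmod (B n k) \<le> C1 * C1 * exp (2 * \<alpha> * (D + D\<^sup>2 / 2))
        * exp (- Re c * (\<bar>of_int (n - k)\<bar> + 2 * (S n - S k)))" if n: "n \<in> ?J" and k: "k \<in> ?J" for n k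
    proof -
      define i where "i = nat (n - a - 1)"
      \<comment> \<open>The coefficient belonging to frequency \<open>n\<close> is estimated at the
        radius that a node at position \<open>n\<close> would have as its modulus.\<close>
      define r where "r = exp (2 * \<alpha> * of_int n)"
      define X where "X = of_int (n - a) * of_int n + R b - R n"
      define Y where "Y = of_int (k - a) * \<mu> k + R b - R k - \<mu> k"
      \<comment> \<open>Multiplication by \<open>exp (2 * \<alpha> * M)\<close> restores the factor
        of index \<open>k\<close> that is missing from \<open>P k\<close>, so that the product runs
        over the whole window.\<close>
      define M where "M = max (of_int n) (\<mu> k)"
      have ri: "r ^ i = exp (2 * \<alpha> * (of_int n * (of_int n - a - 1)))"
      proof -
        have "r ^ i = exp (real i * (2 * \<alpha> * of_int n))"
          unfolding r_def by (rule exp_of_nat_mult[symmetric])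
        also have "real i = of_int n - a - 1" using n by (simp add: i_def)
        finally show ?thesis by (simp add: mult_ac)
      qed
      have "cmod (coeff (P k) i) * r ^ i * exp (2 * \<alpha> * M) \<le> C1 * exp (2 * \<alpha> * X)"
      proof -
        have "exp (2 * \<alpha> * M) \<le> r + cmod (w k)"
          unfolding M_def r_def norm_w by (simp add: max_def)
        then have "cmod (coeff (P k) i) * r ^ i * exp (2 * \<alpha> * M)
            \<le> (\<Prod>j\<in>?J - {k}. r + cmod (w j)) * (r + cmod (w k))"
          unfolding P_def by (intro mult_mono norm_coeff_prod_linear_le) (auto simp: r_def intro!: prod_nonneg add_nonneg_nonneg)
        also have "\<dots> = (\<Prod>j\<in>?J. r + cmod (w j))"
          using k by (subst prod.remove[of ?J k]) (simp_all add: mult.commute)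
        also have "\<dots> \<le> C1 * exp (2 * \<alpha> * (\<Sum>i\<in>?J. if i \<le> n then of_int n else \<mu> i))"
          unfolding r_def norm_w by (rule C1(2)) (use D0 in auto)
        also have "(\<Sum>i\<in>?J. if i \<le> n then of_int n else \<mu> i) = X"
          using n unfolding X_def R_def by (intro sum_split_cumul) auto
        finally show ?thesis .
      qed
      then have "cmod (coeff (P k) i) * (r ^ i * exp (2 * \<alpha> * M)) \<le> C1 * exp (2 * \<alpha> * X)"
        by (simp add: mult_ac)
      then have co: "cmod (coeff (P k) i) \<le> C1 * exp (2 * \<alpha> * X) / (r ^ i * exp (2 * \<alpha> * M))"
        by (subst pos_le_divide_eq) (simp_all add: ri)
      have "exp (2 * \<alpha> * Y) \<le> C1 * cmod (Q k)"
      proof -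
        have "(\<Sum>i\<in>?J. if i \<le> k then \<mu> k else \<mu> i) = \<mu> k + (\<Sum>i\<in>?J - {k}. if i \<le> k then \<mu> k else \<mu> i)"
          using k by (subst sum.remove[of ?J k]) auto
        moreover have "(\<Sum>i\<in>?J. if i \<le> k then \<mu> k else \<mu> i) = of_int (k - a) * \<mu> k + R b - R k"
          using k unfolding R_def by (intro sum_split_cumul) auto
        ultimately have "exp (2 * \<alpha> * Y) = exp (2 * \<alpha> * (\<Sum>i\<in>?J - {k}. if i \<le> k then \<mu> k else \<mu> i))"
          by (simp add: Y_def)
        also have "\<dots> \<le> C1 * (\<Prod>i\<in>?J - {k}. \<bar>exp (2 * \<alpha> * \<mu> k) - exp (2 * \<alpha> * \<mu> i)\<bar>)"
          by (rule C1(3)) (use D[of k] sep in auto)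
        also have "\<dots> \<le> C1 * (\<Prod>i\<in>?J - {k}. cmod (w k - w i))"
          using C1(1) by (intro mult_left_mono prod_mono) (auto simp: norm_w[symmetric] norm_triangle_ineq3)
        finally show ?thesis by (simp add: Q_def prod_norm)
      qed
      then have iq: "1 / cmod (Q k) \<le> C1 * exp (- (2 * \<alpha> * Y))"
        using Q0[of k] by (simp add: exp_minus field_simps)
      have ne: "cmod (exp (c * (of_int n)\<^sup>2 - e (\<mu> k)))
          = exp (2 * \<alpha> * ((of_int n)\<^sup>2 / 2 + (\<mu> k)\<^sup>2 / 2 - \<mu> k * (of_int a + 1)))"
      proof -
        have "c * (of_int n)\<^sup>2 - e (\<mu> k)
            = c * of_real ((of_int n)\<^sup>2 + (\<mu> k)\<^sup>2 - 2 * \<mu> k * (of_int a + 1))"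
          by (simp add: e_def algebra_simps)
        then show ?thesis
          by (simp add: norm_exp_eq_Re \<alpha>_def algebra_simps del: of_real_add of_real_diff)
      qed
      have "cmod (B n k) = cmod (coeff (P k) i) * (1 / cmod (Q k)) * cmod (exp (c * (of_int n)\<^sup>2 - e (\<mu> k)))"
        using n k by (simp add: B_def i_def norm_mult norm_divide)
      also have "\<dots> \<le> (C1 * exp (2 * \<alpha> * X) / (r ^ i * exp (2 * \<alpha> * M))) * (C1 * exp (- (2 * \<alpha> * Y)))
           * cmod (exp (c * (of_int n)\<^sup>2 - e (\<mu> k)))"
        using C1(1) by (intro mult_right_mono mult_mono co iq) (auto simp: r_def)
      also have "\<dots> = C1 * C1 * exp (2 * \<alpha> * (X - of_int n * (of_int n - a - 1) - M - Y
            + (of_int n)\<^sup>2 / 2 + (\<mu> k)\<^sup>2 / 2 - \<mu> k * (of_int a + 1)))"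
      proof -
        have *: "C1 * exp x / (exp y * exp z) * (C1 * exp (- v)) * exp t = C1 * C1 * exp (x - y - z - v + t)"
          for x y z v t :: real
          by (simp add: exp_add exp_diff exp_minus field_simps)
        show ?thesis
          unfolding ri ne * by (rule arg_cong[where f = "\<lambda>x. C1 * C1 * exp x"]) (simp add: algebra_simps)
      qed
      also have "\<dots> \<le> C1 * C1 * exp (2 * \<alpha> * ((D + D\<^sup>2 / 2) - \<bar>of_int (n - k)\<bar> / 2 - (S n - S k)))"
      proof -
        define \<theta> where "\<theta> = \<mu> k - of_int k"
        have g: "\<mu> k = of_int k + \<theta>" by (simp add: \<theta>_def)
        have \<theta>: "\<bar>\<theta>\<bar> \<le> D" using D[of k] by (simp add: \<theta>_def)
        then have \<theta>2: "\<theta>\<^sup>2 \<le> D\<^sup>2" by (rule abs_le_square_iff[THEN iffD1, OF order_trans]) (simp add: D0)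
        \<comment> \<open>All terms in \<open>a\<close> and \<open>b\<close> cancel, and the squares
          combine to \<open>\<theta>^2 / 2\<close>.\<close>
        have "X - of_int n * (of_int n - a - 1) - M - Y
            + (of_int n)\<^sup>2 / 2 + (\<mu> k)\<^sup>2 / 2 - \<mu> k * (of_int a + 1)
            = (of_int n + of_int k) / 2 - M + \<theta>\<^sup>2 / 2 - (S n - S k)"
          unfolding X_def Y_def RS g by (simp add: field_simps power2_eq_square)
        also have "\<dots> \<le> (D + D\<^sup>2 / 2) - \<bar>of_int (n - k)\<bar> / 2 - (S n - S k)"
        proof -
          have "(of_int n + of_int k) / 2 - M \<le> D - \<bar>of_int (n - k)\<bar> / 2"
          proof -
            have "of_int n \<le> M" "of_int k - D \<le> M"
              unfolding M_def g using \<theta> by auto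
            moreover have "\<bar>real_of_int (n - k)\<bar> = (if k \<le> n then of_int n - of_int k else of_int k - of_int n)"
              by simp
            ultimately show ?thesis using D0 by (cases "k \<le> n") (simp_all add: field_simps)
          qed
          then show ?thesis using \<theta>2 by simp
        qed
        finally show ?thesis
          using C1(1) \<alpha> by (intro mult_left_mono iffD2[OF exp_le_cancel_iff]) auto
      qed
      also have "\<dots> = C1 * C1 * exp (2 * \<alpha> * (D + D\<^sup>2 / 2))
        * exp (- Re c * (\<bar>of_int (n - k)\<bar> + 2 * (S n - S k)))"
        unfolding mult.assoc exp_add[symmetric] \<alpha>_def[symmetric] by (simp add: field_simps)
      finally show ?thesis .
    qed
    moreover have B0: "B n k = 0" if "n \<notin> ?J \<or> k \<notin> ?J" for n k
      using that by (auto simp: B_def)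
    moreover have "cmod (B n k) \<le> C1 * C1 * exp (2 * \<alpha> * (D + D\<^sup>2 / 2))
        * exp (- Re c * (\<bar>of_int (n - k)\<bar> + 2 * (S n - S k)))" for n k
      using B_bound[of n k] B0[of n k] by (cases "n \<in> ?J \<and> k \<in> ?J") (auto intro!: mult_nonneg_nonneg)
    ultimately show "\<exists>B. section_inverse c \<mu> {a<..b} B \<and>
      (\<forall>n k. cmod (B n k) \<le> C1 * C1 * exp (2 * \<alpha> * (D + D\<^sup>2 / 2)) * exp (- Re c * (\<bar>of_int (n - k)\<bar>
         + 2 * (cumul (\<lambda>i. \<mu> i - of_int i) n - cumul (\<lambda>i. \<mu> i - of_int i) k))))"
      unfolding S_def section_inverse_def by (intro exI[of _ B]) blast
  qed (use C1 in simp)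
qed

section \<open>Passage from finite sections to the infinite matrix\<close>

lemma infsum_eq_sum_support:
  fixes f :: "'a \<Rightarrow> 'b::{comm_monoid_add,t2_space}"
  assumes "finite A" "\<And>x. x \<notin> A \<Longrightarrow> f x = 0"
  shows "infsum f UNIV = sum f A"
proof -
  have "infsum f UNIV = infsum f A"
    by (rule infsum_cong_neutral) (use assms in auto)
  then show ?thesis using assms(1) by simp
qed

lemma spread_of_bounded:
  assumes "\<And>i. \<bar>\<mu> i - of_int i\<bar> \<le> D"
  shows "spread \<mu>"
  unfolding spread_def
proof (rule exI[of _ 1], intro conjI exI[of _ "2 * D"] allI)
  fix i j
  show "1 * real_of_int \<bar>i - j\<bar> - 2 * D \<le> \<bar>\<mu> i - \<mu> j\<bar>"
    using assms[of i] assms[of j] by simp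
qed simp

text \<open>By \<open>avg\<close>, the exponent in the bound for the section inverses is at least
  \<open>(1 - 2 * d) * \<bar>n - k\<bar>\<close> up to a constant factor and an additive constant;
  this is where 1/2 enters. The sections are then uniformly localized, a subsequence converges
  entrywise, and domination carries both identities to the limit.\<close>

lemma localized_inverse_of_average:
  assumes c: "Re c > 0" and \<sigma>: "\<sigma> > 0" and D: "\<And>i. \<bar>\<mu> i - of_int i\<bar> \<le> D"
    and sep: "\<And>i j. i \<noteq> j \<Longrightarrow> \<sigma> \<le> \<bar>\<mu> i - \<mu> j\<bar>"
    and d: "d < 1 / 2" and avg: "\<And>n m. \<bar>cumul (\<lambda>i. \<mu> i - of_int i) n - cumul (\<lambda>i. \<mu> i - of_int i) m\<bar>
        \<le> d * \<bar>of_int (n - m)\<bar> + E"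
  shows "\<exists>B. localized_inverse c \<mu> B"
proof -
  define \<alpha> where "\<alpha> = Re c"
  have \<alpha>: "\<alpha> > 0" using c by (simp add: \<alpha>_def)
  define \<rho> where "\<rho> = \<alpha> * (1 - 2 * d)"
  have \<rho>: "\<rho> > 0" using d \<alpha> by (simp add: \<rho>_def)
  let ?S = "cumul (\<lambda>i. \<mu> i - of_int i)"
  let ?J = "\<lambda>N::nat. {- int N<..int N}"
  obtain C where C: "C > 0" and ex: "\<And>a b. \<exists>B. section_inverse c \<mu> {a<..b} B \<and>
      (\<forall>n k. cmod (B n k) \<le> C * exp (- Re c * (\<bar>of_int (n - k)\<bar> + 2 * (?S n - ?S k))))"
    using finite_section_inverse[OF c \<sigma> D sep] by blast
  define B where "B = (\<lambda>N. SOME B. section_inverse c \<mu> (?J N) B \<and>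
      (\<forall>n k. cmod (B n k) \<le> C * exp (- Re c * (\<bar>of_int (n - k)\<bar> + 2 * (?S n - ?S k)))))"
  have B: "section_inverse c \<mu> (?J N) (B N)"
    and B1: "cmod (B N n k) \<le> C * exp (- Re c * (\<bar>of_int (n - k)\<bar> + 2 * (?S n - ?S k)))" for N n k
    using someI_ex[OF ex[of "- int N" "int N"]] unfolding B_def by blast+
  have B0: "n \<notin> ?J N \<or> k \<notin> ?J N \<Longrightarrow> B N n k = 0"
    and B2: "j \<in> ?J N \<Longrightarrow> k \<in> ?J N \<Longrightarrow> (\<Sum>n\<in>?J N. gauss_kernel c (\<mu> j) n * B N n k) = of_bool (j = k)"
    and B3: "n \<in> ?J N \<Longrightarrow> m \<in> ?J N \<Longrightarrow> (\<Sum>k\<in>?J N. B N n k * gauss_kernel c (\<mu> k) m) = of_bool (n = m)"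
    for N n k j m
    using B[of N] unfolding section_inverse_def by blast+
  define C' where "C' = C * exp (2 * \<alpha> * E + \<rho> * D)"
  have C': "C' > 0" using C by (simp add: C'_def)
  have bound: "cmod (B N n k) \<le> C' * exp (- \<rho> * \<bar>of_int n - \<mu> k\<bar>)" for N n k
  proof -
    have "- Re c * (\<bar>of_int (n - k)\<bar> + 2 * (?S n - ?S k))
        \<le> 2 * \<alpha> * E + \<rho> * D + - \<rho> * \<bar>of_int n - \<mu> k\<bar>"
    proof -
      have "\<alpha> * (- 2 * (?S n - ?S k)) \<le> \<alpha> * (2 * (d * \<bar>of_int (n - k)\<bar> + E))"
        using avg[of n k] \<alpha> by (intro mult_left_mono) auto
      moreover have "\<rho> * (\<bar>of_int n - \<mu> k\<bar> - D) \<le> \<rho> * \<bar>of_int (n - k)\<bar>"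
        using D[of k] \<rho> by (intro mult_left_mono) auto
      ultimately show ?thesis
        unfolding \<rho>_def \<alpha>_def by (simp add: algebra_simps)
    qed
    then have "exp (- Re c * (\<bar>of_int (n - k)\<bar> + 2 * (?S n - ?S k)))
        \<le> exp (2 * \<alpha> * E + \<rho> * D) * exp (- \<rho> * \<bar>of_int n - \<mu> k\<bar>)"
      unfolding exp_add[symmetric] by simp
    then have "C * exp (- Re c * (\<bar>of_int (n - k)\<bar> + 2 * (?S n - ?S k)))
        \<le> C' * exp (- \<rho> * \<bar>of_int n - \<mu> k\<bar>)"
      unfolding C'_def mult.assoc using C by (intro mult_left_mono) auto
    then show ?thesis using B1[of N n k] by linarith
  qed
  have "cmod (B N (fst p) (snd p)) \<le> C'" for N p
  proof -
    have "exp (- \<rho> * \<bar>of_int (fst p) - \<mu> (snd p)\<bar>) \<le> 1"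
      using \<rho> by simp
    then show ?thesis
      using bound[of N "fst p" "snd p"] C' by (meson mult_left_le less_imp_le order_trans)
  qed
  then obtain s :: "nat \<Rightarrow> nat" where s: "strict_mono s"
      and lim: "\<And>p. p \<in> UNIV \<Longrightarrow> \<exists>l. (\<lambda>N. B (s N) (fst p) (snd p)) \<longlonglongrightarrow> l"
    using function_convergent_subsequence[of "UNIV :: (int \<times> int) set" "\<lambda>N p. B N (fst p) (snd p)" C',
        OF countableI_type] by blast
  define L where "L = (\<lambda>n k. lim (\<lambda>N. B (s N) n k))"
  have L: "(\<lambda>N. B (s N) n k) \<longlonglongrightarrow> L n k" for n k
    using lim[of "(n, k)"] unfolding L_def convergent_LIMSEQ_iff[symmetric] convergent_def by simp
  \<comment> \<open>A fixed pair of indices eventually lies in all windows of the subsequence, so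
    its section identity is exact from then on.\<close>
  have ev: "\<forall>\<^sub>F N in sequentially. j \<in> ?J (s N) \<and> k \<in> ?J (s N)" for j k
  proof (rule eventually_sequentiallyI[of "nat \<bar>j\<bar> + nat \<bar>k\<bar> + 1"])
    fix N assume "nat \<bar>j\<bar> + nat \<bar>k\<bar> + 1 \<le> N"
    moreover have "N \<le> s N" by (rule strict_mono_imp_increasing[OF s])
    ultimately show "j \<in> ?J (s N) \<and> k \<in> ?J (s N)" by auto
  qed
  have spr: "spread \<mu>" by (rule spread_of_bounded[OF D])
  obtain S1 where "exp_kernel_bound \<mu> 1 S1"
    using ex_exp_kernel_bound[OF spr, of 1] by auto
  note S1 = exp_kernel_boundD[OF this]
  define G where "G = exp (1\<^sup>2 / (4 * Re c))"
  have K: "cmod (gauss_kernel c (\<mu> k) n) \<le> G * exp (- 1 * \<bar>\<mu> k - of_int n\<bar>)" for k n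
    unfolding G_def by (rule norm_gauss_kernel_le[OF c])
  have B': "cmod (B N n k) \<le> C'" for N n k
    using \<open>\<And>N p. cmod (B N (fst p) (snd p)) \<le> C'\<close>[of N "(n, k)"] by simp
  have "localized_inverse c \<mu> L"
    unfolding localized_inverse_def localized_def
  proof (intro conjI exI allI)
    show "cmod (L n k) \<le> C' * exp (- \<rho> * \<bar>of_int n - \<mu> k\<bar>)" for n k
      by (rule LIMSEQ_le_const2[OF tendsto_norm[OF L]]) (use bound in auto)
    show "(\<Sum>\<^sub>\<infinity>n. gauss_kernel c (\<mu> j) n * L n k) = of_bool (j = k)" for j k
    proof (rule LIMSEQ_unique)
      show "(\<lambda>N. \<Sum>\<^sub>\<infinity>n. gauss_kernel c (\<mu> j) n * B (s N) n k) \<longlonglongrightarrow> (\<Sum>\<^sub>\<infinity>n. gauss_kernel c (\<mu> j) n * L n k)"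
      proof (rule infsum_dominated_convergence[where g = "\<lambda>n. G * exp (- 1 * \<bar>\<mu> j - of_int n\<bar>) * C'"])
        show "(\<lambda>n. G * exp (- 1 * \<bar>\<mu> j - of_int n\<bar>) * C') summable_on UNIV"
          by (intro summable_on_cmult_left summable_on_cmult_right S1)
        show "cmod (gauss_kernel c (\<mu> j) n * B (s N) n k) \<le> G * exp (- 1 * \<bar>\<mu> j - of_int n\<bar>) * C'" for N n
          unfolding norm_mult by (intro mult_mono K B') (auto simp: G_def)
      qed (intro tendsto_intros L)
      show "(\<lambda>N. \<Sum>\<^sub>\<infinity>n. gauss_kernel c (\<mu> j) n * B (s N) n k) \<longlonglongrightarrow> of_bool (j = k)"
      proof (rule tendsto_eventually, rule eventually_mono[OF ev[of j k]])
        fix N assume *: "j \<in> ?J (s N) \<and> k \<in> ?J (s N)"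
        have "(\<Sum>\<^sub>\<infinity>n. gauss_kernel c (\<mu> j) n * B (s N) n k) = (\<Sum>n\<in>?J (s N). gauss_kernel c (\<mu> j) n * B (s N) n k)"
          by (rule infsum_eq_sum_support) (use B0 in auto)
        then show "(\<Sum>\<^sub>\<infinity>n. gauss_kernel c (\<mu> j) n * B (s N) n k) = of_bool (j = k)"
          using B2[of j "s N" k] * by simp
      qed
    qed
    show "(\<Sum>\<^sub>\<infinity>k. L n k * gauss_kernel c (\<mu> k) m) = of_bool (n = m)" for n m
    proof (rule LIMSEQ_unique)
      show "(\<lambda>N. \<Sum>\<^sub>\<infinity>k. B (s N) n k * gauss_kernel c (\<mu> k) m) \<longlonglongrightarrow> (\<Sum>\<^sub>\<infinity>k. L n k * gauss_kernel c (\<mu> k) m)"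
      proof (rule infsum_dominated_convergence[where g = "\<lambda>k. C' * (G * exp (- 1 * \<bar>\<mu> k - of_int m\<bar>))"])
        show "(\<lambda>k. C' * (G * exp (- 1 * \<bar>\<mu> k - of_int m\<bar>))) summable_on UNIV"
          by (intro summable_on_cmult_right S1)
        show "cmod (B (s N) n k * gauss_kernel c (\<mu> k) m) \<le> C' * (G * exp (- 1 * \<bar>\<mu> k - of_int m\<bar>))" for N k
          unfolding norm_mult by (intro mult_mono K B') (use C' in auto)
      qed (intro tendsto_intros L)
      show "(\<lambda>N. \<Sum>\<^sub>\<infinity>k. B (s N) n k * gauss_kernel c (\<mu> k) m) \<longlonglongrightarrow> of_bool (n = m)"
      proof (rule tendsto_eventually, rule eventually_mono[OF ev[of n m]])
        fix N assume *: "n \<in> ?J (s N) \<and> m \<in> ?J (s N)"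
        have "(\<Sum>\<^sub>\<infinity>k. B (s N) n k * gauss_kernel c (\<mu> k) m) = (\<Sum>k\<in>?J (s N). B (s N) n k * gauss_kernel c (\<mu> k) m)"
          by (rule infsum_eq_sum_support) (use B0 in auto)
        then show "(\<Sum>\<^sub>\<infinity>k. B (s N) n k * gauss_kernel c (\<mu> k) m) = of_bool (n = m)"
          using B3[of n "s N" m] * by simp
      qed
    qed
  qed (use \<rho> in simp)
  then show ?thesis by blast
qed

text \<open>The case of zero displacements. It is needed in both directions of the theorem, because
  the norm of a series is defined through coefficients that are recovered from samples at the
  integers.\<close>

lemma localized_inverse_of_int:
  assumes "Re c > 0"
  shows "\<exists>B. localized_inverse c real_of_int B"
proof (rule localized_inverse_of_average[where \<sigma> = 1 and D = 0 and d = 0 and E = 0])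
  show "(1::real) \<le> \<bar>of_int i - of_int j\<bar>" if "i \<noteq> j" for i j
    using that by linarith
qed (use assms in \<open>auto simp: cumul_def\<close>)

section \<open>Necessity: separation, decay and counting\<close>

lemma spread_of_separated:
  fixes \<mu> :: "int \<Rightarrow> real"
  assumes mono: "strict_mono \<mu>" and \<sigma>: "\<sigma> > 0" "\<And>i j. i \<noteq> j \<Longrightarrow> \<sigma> \<le> \<bar>\<mu> i - \<mu> j\<bar>"
  shows "spread \<mu>"
proof -
  have step: "\<mu> i + \<sigma> \<le> \<mu> (i + 1)" for i
    using \<sigma>(2)[of "i + 1" i] strict_monoD[OF mono, of i "i + 1"] by simp
  have le: "\<sigma> * of_int (j - i) \<le> \<mu> j - \<mu> i" if "i \<le> j" for i j
    using that
  proof (induction j rule: int_ge_induct)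
    case (step j)
    then show ?case using \<open>\<And>i. \<mu> i + \<sigma> \<le> \<mu> (i + 1)\<close>[of j] by (simp add: algebra_simps)
  qed simp
  show ?thesis
    unfolding spread_def
  proof (rule exI[of _ \<sigma>], intro conjI exI[of _ 0] allI)
    fix i j
    show "\<sigma> * real_of_int \<bar>i - j\<bar> - 0 \<le> \<bar>\<mu> i - \<mu> j\<bar>"
      using le[of i j] le[of j i] by (cases "i \<le> j") (auto simp: algebra_simps)
  qed (rule \<sigma>)
qed

section \<open>Perturbation estimates, decay of the inverse and separation\<close>

lemma norm_one_minus_exp_le:
  fixes t :: real
  shows "\<bar>1 - exp t\<bar> \<le> \<bar>t\<bar> * exp \<bar>t\<bar>"
proof (cases "t \<ge> 0")
  case True
  have "1 - t \<le> exp (- t)" using exp_ge_add_one_self[of "- t"] by simp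
  then have "exp t * (1 - t) \<le> exp t * exp (- t)" by (intro mult_left_mono) auto
  then show ?thesis using True by (simp add: exp_minus_inverse algebra_simps)
next
  case False
  have "1 - exp t \<le> - t" using exp_ge_add_one_self[of t] by linarith
  also have "\<dots> \<le> - t * exp (- t)" using False mult_left_mono[of 1 "exp (- t)" "- t"] by simp
  finally show ?thesis using False by simp
qed

text \<open>Used for separation: a series that is 1 at one node and 0 at another forces a minimal
  distance between them.\<close>

lemma gauss_kernel_lipschitz:
  assumes c: "Re c > 0"
  obtains G where "G > 0" "\<And>x y n. \<bar>x - y\<bar> \<le> 1 \<Longrightarrow>
     cmod (gauss_kernel c x n - gauss_kernel c y n) \<le> \<bar>x - y\<bar> * (G * exp (- 1 * \<bar>x - of_int n\<bar>))"
proof -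
  \<comment> \<open>Rate 2: one unit of decay absorbs the factor
    \<open>\<bar>t - of_int n\<bar>\<close> of the derivative and one unit is kept. The factor
    \<open>exp 1\<close> in \<open>G\<close> pays for moving from \<open>t\<close> to
    \<open>x\<close>.\<close>
  define G0 where "G0 = exp (2\<^sup>2 / (4 * Re c))"
  define G where "G = 2 * cmod c * G0 * exp 1"
  have c0: "cmod c > 0" using c by auto
  show ?thesis
  proof (rule that[of G])
    show "G > 0" using c0 by (simp add: G_def G0_def)
    fix x y :: real and n :: int assume xy: "\<bar>x - y\<bar> \<le> 1"
    define g where "g = (\<lambda>z. exp (- c * (z - of_int n)\<^sup>2))"
    have gk: "gauss_kernel c t n = g (of_real t)" for t
      by (simp add: gauss_kernel_def g_def)
    have "cmod (g (of_real x) - g (of_real y))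
        \<le> (G * exp (- 1 * \<bar>x - of_int n\<bar>)) * cmod (of_real x - of_real y)"
    proof (rule field_differentiable_bound[where S = "closed_segment (of_real x) (of_real y)"
          and f' = "\<lambda>z. - 2 * c * (z - of_int n) * g z"])
      fix z :: complex assume z: "z \<in> closed_segment (of_real x) (of_real y)"
      show "(g has_field_derivative - 2 * c * (z - of_int n) * g z) (at z within closed_segment (of_real x) (of_real y))"
        unfolding g_def by (auto intro!: derivative_eq_intros simp: power2_eq_square)
      obtain t where t: "z = of_real t" "t \<in> closed_segment x y"
        using z by (auto simp: closed_segment_of_real)
      have tx: "\<bar>t - x\<bar> \<le> 1"
        using t(2) xy by (auto simp: closed_segment_eq_real_ivl split: if_splits)
      let ?v = "\<bar>t - of_int n\<bar>"
      have "cmod (- 2 * c * (z - of_int n) * g z) = 2 * cmod c * (?v * cmod (gauss_kernel c t n))"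
      proof -
        have "cmod (of_real t - of_int n) = ?v"
          by (metis norm_of_real of_real_diff of_real_of_int_eq)
        then show ?thesis
          unfolding t gk norm_mult by simp
      qed
      also have "?v * cmod (gauss_kernel c t n) \<le> exp ?v * (G0 * exp (- 2 * ?v))"
      proof (rule mult_mono)
        show "?v \<le> exp ?v" using exp_ge_add_one_self[of ?v] by linarith
        show "cmod (gauss_kernel c t n) \<le> G0 * exp (- 2 * ?v)"
          unfolding G0_def by (rule norm_gauss_kernel_le[OF c])
      qed auto
      also have "\<dots> = G0 * exp (- ?v)"
        by (simp add: mult.left_commute flip: exp_add)
      also have "\<dots> \<le> G0 * (exp 1 * exp (- 1 * \<bar>x - of_int n\<bar>))"
        unfolding exp_add[symmetric] using tx by (intro mult_left_mono) (auto simp: G0_def)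
      finally show "cmod (- 2 * c * (z - of_int n) * g z) \<le> G * exp (- 1 * \<bar>x - of_int n\<bar>)"
        using c0 by (simp add: G_def mult_ac)
    qed auto
    also have "cmod (of_real x - of_real y) = \<bar>x - y\<bar>"
      by (metis norm_of_real of_real_diff)
    finally show "cmod (gauss_kernel c x n - gauss_kernel c y n) \<le> \<bar>x - y\<bar> * (G * exp (- 1 * \<bar>x - of_int n\<bar>))"
      unfolding gk by (simp add: mult_ac)
  qed
qed

lemma
  assumes c: "Re c > 0" and a: "\<And>n. cmod (a n) \<le> V"
  shows gauss_summable: "(\<lambda>n. gauss_kernel c x n * a n) summable_on UNIV"
    and gauss_series_bounded: "\<exists>M. \<forall>x. cmod (gauss_series c a x) \<le> M"
proof -
  obtain S where "exp_kernel_bound real_of_int 1 S"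
    using ex_exp_kernel_bound[OF spread_of_int, of 1] by auto
  note S = exp_kernel_boundD[OF this]
  define G where "G = exp (1\<^sup>2 / (4 * Re c))"
  have V: "V \<ge> 0" using order_trans[OF norm_ge_zero a] .
  let ?g = "\<lambda>x n. G * exp (- 1 * \<bar>x - real_of_int n\<bar>) * V"
  have sg: "?g x summable_on UNIV" for x
    by (intro summable_on_cmult_left summable_on_cmult_right S)
  have le: "cmod (gauss_kernel c x n * a n) \<le> ?g x n" for x n
    unfolding norm_mult G_def by (intro mult_mono norm_gauss_kernel_le c a) auto
  show "(\<lambda>n. gauss_kernel c x n * a n) summable_on UNIV"
    by (rule summable_on_norm_comparison(1)[OF sg le])
  have "cmod (gauss_series c a x) \<le> G * S * V" for x
  proof -
    have "cmod (gauss_series c a x) \<le> infsum (?g x) UNIV"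
      unfolding gauss_series_kernel by (rule summable_on_norm_comparison(3)[OF sg le])
    also have "\<dots> = G * (\<Sum>\<^sub>\<infinity>n. exp (- 1 * \<bar>x - real_of_int n\<bar>)) * V"
      by (simp only: infsum_cmult_left' infsum_cmult_right')
    also have "\<dots> \<le> G * S * V"
      using V by (intro mult_right_mono mult_left_mono S) (auto simp: G_def)
    finally show ?thesis .
  qed
  then show "\<exists>M. \<forall>x. cmod (gauss_series c a x) \<le> M" by blast
qed

lemma gauss_series_diff:
  assumes "Re c > 0" "a \<in> ell2" "b \<in> ell2"
  shows "gauss_series c (\<lambda>n. a n - b n) x = gauss_series c a x - gauss_series c b x"
proof -
  have s: "(\<lambda>n. gauss_kernel c x n * a n) summable_on UNIV" "(\<lambda>n. - (gauss_kernel c x n * b n)) summable_on UNIV"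
    using gauss_summable[OF assms(1) ell2_bounded] assms(2,3) by (auto simp: summable_on_uminus)
  show ?thesis
    using infsum_add[OF s] unfolding gauss_series_kernel by (simp add: right_diff_distrib infsum_uminus)
qed

lemma ell2_add:
  assumes "a \<in> ell2" "b \<in> ell2"
  shows "(\<lambda>n. a n + b n) \<in> ell2"
    and "(ell2_norm (\<lambda>n. a n + b n))\<^sup>2 \<le> 2 * (ell2_norm a)\<^sup>2 + 2 * (ell2_norm b)\<^sup>2"
proof -
  have s: "(\<lambda>n. (cmod (a n))\<^sup>2) summable_on UNIV" "(\<lambda>n. (cmod (b n))\<^sup>2) summable_on UNIV"
    using assms by (auto simp: ell2_def)
  have sum: "(\<lambda>n. 2 * (cmod (a n))\<^sup>2 + 2 * (cmod (b n))\<^sup>2) summable_on UNIV"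
    by (intro summable_on_add summable_on_cmult_right s)
  have le: "(cmod (a n + b n))\<^sup>2 \<le> 2 * (cmod (a n))\<^sup>2 + 2 * (cmod (b n))\<^sup>2" for n
  proof -
    have "(cmod (a n + b n))\<^sup>2 \<le> (cmod (a n) + cmod (b n))\<^sup>2"
      by (intro power_mono norm_triangle_ineq) simp
    also have "\<dots> \<le> 2 * (cmod (a n))\<^sup>2 + 2 * (cmod (b n))\<^sup>2"
      using zero_le_power2[of "cmod (a n) - cmod (b n)"] by (simp add: power2_eq_square algebra_simps)
    finally show ?thesis .
  qed
  have s': "(\<lambda>n. (cmod (a n + b n))\<^sup>2) summable_on UNIV"
    by (rule summable_on_comparison_test[OF sum le]) simp
  then show "(\<lambda>n. a n + b n) \<in> ell2" by (simp add: ell2_def)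
  have "(\<Sum>\<^sub>\<infinity>n. (cmod (a n + b n))\<^sup>2) \<le> (\<Sum>\<^sub>\<infinity>n. 2 * (cmod (a n))\<^sup>2 + 2 * (cmod (b n))\<^sup>2)"
    by (rule infsum_mono[OF s' sum le])
  then show "(ell2_norm (\<lambda>n. a n + b n))\<^sup>2 \<le> 2 * (ell2_norm a)\<^sup>2 + 2 * (ell2_norm b)\<^sup>2"
    unfolding ell2_norm_sq by (simp add: infsum_add summable_on_cmult_right s infsum_cmult_right')
qed

lemma ell2_uminus: "a \<in> ell2 \<Longrightarrow> (\<lambda>n. - a n) \<in> ell2"
  by (simp add: ell2_def)

lemma ell2_unit: "(\<lambda>n. of_bool (n = k)) \<in> ell2" "ell2_norm (\<lambda>n. of_bool (n = k)) = 1"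
proof -
  have *: "(\<lambda>n. (cmod (of_bool (n = k)))\<^sup>2) = (\<lambda>n. of_bool (n = k))" by auto
  have "(\<lambda>n. of_bool (n = k) :: real) summable_on UNIV"
    by (rule finite_nonzero_values_imp_summable_on) auto
  then show "(\<lambda>n. of_bool (n = k)) \<in> ell2" unfolding ell2_def mem_Collect_eq * .
  have "(\<Sum>\<^sub>\<infinity>n. of_bool (n = k) :: real) = 1"
    by (subst infsum_eq_sum_support[of "{k}"]) auto
  then show "ell2_norm (\<lambda>n. of_bool (n = k)) = 1" unfolding ell2_norm_def * by simp
qed

text \<open>Conjugating the Gaussian matrix by the weights \<open>exp (\<rho> \<omega>)\<close>, \<open>\<omega>\<close> a truncated distance to a
  node, perturbs it by \<open>O(\<rho>)\<close>, so the lower sampling bound survives and the biorthogonal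
  sequence decays exponentially away from its node.\<close>

lemma biorthogonal_decay:
  assumes c: "Re c > 0" and sp: "spread \<mu>" and A: "A > 0"
    and lower: "\<And>a. a \<in> ell2 \<Longrightarrow> A * (ell2_norm a)\<^sup>2 \<le> (\<Sum>\<^sub>\<infinity>k. (cmod (gauss_series c a (\<mu> k)))\<^sup>2)"
    and b: "\<And>k. b k \<in> ell2" "\<And>j k. gauss_series c (b k) (\<mu> j) = of_bool (j = k)"
  shows "localized \<mu> (\<lambda>n k. b k n)"
proof -
  obtain S where "exp_kernel_bound \<mu> 1 S"
    using ex_exp_kernel_bound[OF sp, of 1] by auto
  note S = exp_kernel_boundD[OF this]
  \<comment> \<open>Rate 3: two units of decay absorb the factor
    \<open>\<bar>v\<bar> * exp \<bar>v\<bar>\<close> coming from the weights, one unit is left for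
    the Schur test.\<close>
  define G where "G = exp (3\<^sup>2 / (4 * Re c))"
  have G: "G > 0" by (simp add: G_def)
  \<comment> \<open>Small enough that twice the squared Schur bound of the perturbation is at most
    \<open>A / 2\<close>, so that its contribution can be absorbed into the lower sampling
    bound.\<close>
  define \<rho> where "\<rho> = min 1 (sqrt A / (2 * G * S))"
  have \<rho>: "0 < \<rho>" "\<rho> \<le> 1" using A G S by (auto simp: \<rho>_def)
  have \<rho>A: "2 * ((\<rho> * G * S) * (\<rho> * G * S)) \<le> A / 2"
  proof -
    have "\<rho> \<le> sqrt A / (2 * G * S)" by (simp add: \<rho>_def)
    then have "\<rho> * G * S \<le> sqrt A / 2" using G S by (simp add: field_simps)
    then have "(\<rho> * G * S) * (\<rho> * G * S) \<le> (sqrt A / 2) * (sqrt A / 2)"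
      using \<rho> G S A by (intro mult_mono) auto
    then show ?thesis using A by simp
  qed
  have main: "cmod (b k n) \<le> 2 / sqrt A * exp (- \<rho> * \<bar>of_int n - \<mu> k\<bar>)" for n k
  proof -
    \<comment> \<open>Truncating the weight at the distance to the target \<open>n\<close> keeps the
      weighted sequence in ell2 without weakening it at \<open>n\<close>, and the resulting
      constants do not depend on \<open>n\<close>.\<close>
    define M where "M = \<bar>of_int n - \<mu> k\<bar>"
    define \<omega> where "\<omega> = (\<lambda>u. min \<bar>u - \<mu> k\<bar> M)"
    have \<omega>: "0 \<le> \<omega> u" "\<omega> u \<le> M" "\<bar>\<omega> u - \<omega> v\<bar> \<le> \<bar>u - v\<bar>" for u v
      by (auto simp: \<omega>_def M_def min_def)
    define x where "x = (\<lambda>m. of_real (exp (\<rho> * \<omega> (of_int m))) * b k m)"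
    have nx: "cmod (x m) = exp (\<rho> * \<omega> (of_int m)) * cmod (b k m)" for m
      by (simp add: x_def norm_mult)
    have x: "x \<in> ell2"
    proof -
      have "(\<lambda>m. (exp (\<rho> * M))\<^sup>2 * (cmod (b k m))\<^sup>2) summable_on UNIV"
        using b(1)[of k] by (intro summable_on_cmult_right) (simp add: ell2_def)
      then have "(\<lambda>m. (cmod (x m))\<^sup>2) summable_on UNIV"
        by (rule summable_on_comparison_test)
           (auto simp: nx power_mult_distrib \<omega> \<rho> less_imp_le intro!: mult_right_mono power_mono)
      then show ?thesis by (simp add: ell2_def)
    qed
    \<comment> \<open>The Gaussian matrix minus its conjugate by the weights. The weight is 1 at
      node \<open>k\<close>, so the conjugate sends \<open>x\<close> to the unit vector of
      \<open>k\<close>.\<close>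
    define T where "T = (\<lambda>j m. gauss_kernel c (\<mu> j) m * of_real (1 - exp (\<rho> * (\<omega> (\<mu> j) - \<omega> (of_int m)))))"
    have T: "cmod (T j m) \<le> \<rho> * G * exp (- 1 * \<bar>\<mu> j - of_int m\<bar>)" for j m
    proof -
      let ?v = "\<bar>\<mu> j - of_int m\<bar>"
      let ?t = "\<rho> * (\<omega> (\<mu> j) - \<omega> (of_int m))"
      have t: "\<bar>?t\<bar> \<le> \<rho> * ?v" using \<omega>(3) \<rho> by (simp add: abs_mult)
      have "\<bar>1 - exp ?t\<bar> \<le> \<bar>?t\<bar> * exp \<bar>?t\<bar>" by (rule norm_one_minus_exp_le)
      also have "\<dots> \<le> (\<rho> * ?v) * exp ?v"
      proof (rule mult_mono[OF t])
        have "\<rho> * ?v \<le> 1 * ?v" using \<rho> by (intro mult_right_mono) auto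
        then show "exp \<bar>?t\<bar> \<le> exp ?v" using t by simp
      qed (use \<rho> in auto)
      also have "\<dots> \<le> (\<rho> * exp ?v) * exp ?v"
      proof (intro mult_right_mono mult_left_mono)
        show "?v \<le> exp ?v" using exp_ge_add_one_self[of ?v] by linarith
      qed (use \<rho> in auto)
      finally have "\<bar>1 - exp ?t\<bar> \<le> \<rho> * exp ?v * exp ?v" .
      then have "cmod (T j m) \<le> (G * exp (- 3 * ?v)) * (\<rho> * exp ?v * exp ?v)"
        unfolding T_def norm_mult norm_of_real G_def by (intro mult_mono norm_gauss_kernel_le[OF c]) auto
      also have "\<dots> = \<rho> * G * (exp (- 3 * ?v) * exp ?v * exp ?v)" by simp
      also have "exp (- 3 * ?v) * exp ?v * exp ?v = exp (- 1 * ?v)"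
        unfolding exp_add[symmetric] by simp
      finally show ?thesis .
    qed
    have split: "gauss_series c x (\<mu> j) = of_bool (j = k) + (\<Sum>\<^sub>\<infinity>m. T j m * x m)" for j
    proof -
      have "(\<Sum>\<^sub>\<infinity>m. of_real (exp (\<rho> * \<omega> (\<mu> j))) * (gauss_kernel c (\<mu> j) m * b k m))
          = of_real (exp (\<rho> * \<omega> (\<mu> j))) * of_bool (j = k)"
        unfolding infsum_cmult_right' using b(2)[of k j] unfolding gauss_series_kernel by simp
      also have "\<dots> = of_bool (j = k)" using \<rho> by (auto simp: \<omega>_def M_def min_def)
      finally have 1: "(\<Sum>\<^sub>\<infinity>m. of_real (exp (\<rho> * \<omega> (\<mu> j))) * (gauss_kernel c (\<mu> j) m * b k m)) = of_bool (j = k)" .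
      have Tx: "T j m * x m = gauss_kernel c (\<mu> j) m * x m
          - of_real (exp (\<rho> * \<omega> (\<mu> j))) * (gauss_kernel c (\<mu> j) m * b k m)" for m
      proof -
        have "exp (\<rho> * (\<omega> (\<mu> j) - \<omega> (of_int m))) * exp (\<rho> * \<omega> (of_int m)) = exp (\<rho> * \<omega> (\<mu> j))"
          unfolding exp_add[symmetric] by (simp add: algebra_simps)
        then have "of_real (exp (\<rho> * (\<omega> (\<mu> j) - \<omega> (of_int m)))) * x m = of_real (exp (\<rho> * \<omega> (\<mu> j))) * b k m"
          unfolding x_def by (simp add: mult.assoc[symmetric] del: of_real_exp flip: of_real_mult)
        then show ?thesis
          unfolding T_def by (simp add: algebra_simps del: of_real_exp)
      qed
      have s1: "(\<lambda>m. gauss_kernel c (\<mu> j) m * x m) summable_on UNIV"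
        by (rule gauss_summable[OF c ell2_bounded[OF x]])
      have s2: "(\<lambda>m. - (of_real (exp (\<rho> * \<omega> (\<mu> j))) * (gauss_kernel c (\<mu> j) m * b k m))) summable_on UNIV"
        unfolding summable_on_uminus by (intro summable_on_uminus[THEN iffD2] summable_on_cmult_right gauss_summable[OF c ell2_bounded[OF b(1)]])
      show ?thesis
        unfolding Tx using infsum_add[OF s1 s2] 1 by (simp add: gauss_series_kernel infsum_uminus)
    qed
    have Tl2: "(\<lambda>j. \<Sum>\<^sub>\<infinity>m. T j m * x m) \<in> ell2"
      and Tn: "(ell2_norm (\<lambda>j. \<Sum>\<^sub>\<infinity>m. T j m * x m))\<^sup>2 \<le> (\<rho> * G * S) * (\<rho> * G * S) * (ell2_norm x)\<^sup>2"
    proof -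
      have x': "(\<lambda>n. (cmod (x n))\<^sup>2) summable_on UNIV" using x by (simp add: ell2_def)
      note schur = schur_test[where K = "\<lambda>j m. \<rho> * G * exp (- 1 * \<bar>\<mu> j - of_int m\<bar>)"
          and M = T and R = "\<rho> * G * S" and R' = "\<rho> * G * S", OF T]
      have le: "(\<Sum>\<^sub>\<infinity>m. \<rho> * G * exp (- 1 * \<bar>\<mu> j - of_int m\<bar>)) \<le> \<rho> * G * S"
               "(\<Sum>\<^sub>\<infinity>j. \<rho> * G * exp (- 1 * \<bar>\<mu> j - of_int m\<bar>)) \<le> \<rho> * G * S" for j m
        unfolding infsum_cmult_right' using \<rho> G S by (auto intro!: mult_left_mono)
      show "(\<lambda>j. \<Sum>\<^sub>\<infinity>m. T j m * x m) \<in> ell2"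
        unfolding ell2_def mem_Collect_eq
        by (rule schur(1)[OF _ _ _ _ x']) (intro summable_on_cmult_right S le)+
      show "(ell2_norm (\<lambda>j. \<Sum>\<^sub>\<infinity>m. T j m * x m))\<^sup>2 \<le> (\<rho> * G * S) * (\<rho> * G * S) * (ell2_norm x)\<^sup>2"
        unfolding ell2_norm_sq
        by (rule schur(2)[OF _ _ _ _ x']) (intro summable_on_cmult_right S le)+
    qed
    have "A * (ell2_norm x)\<^sup>2 \<le> (ell2_norm (\<lambda>j. of_bool (j = k) + (\<Sum>\<^sub>\<infinity>m. T j m * x m)))\<^sup>2"
      using lower[OF x] unfolding split ell2_norm_sq .
    also have "\<dots> \<le> 2 * 1\<^sup>2 + 2 * ((\<rho> * G * S) * (\<rho> * G * S) * (ell2_norm x)\<^sup>2)"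
      using ell2_add(2)[OF ell2_unit(1)[of k] Tl2] Tn unfolding ell2_unit(2) by linarith
    also have "\<dots> \<le> 2 + A / 2 * (ell2_norm x)\<^sup>2"
      using mult_right_mono[OF \<rho>A, of "(ell2_norm x)\<^sup>2"] by simp
    finally have "(ell2_norm x)\<^sup>2 \<le> 4 / A"
      using A by (simp add: field_simps)
    then have "ell2_norm x \<le> sqrt (4 / A)"
      by (rule real_le_rsqrt)
    then have "cmod (x n) \<le> 2 / sqrt A"
      using ell2_bounded[OF x, of n] by (simp add: real_sqrt_divide)
    then have "exp (\<rho> * M) * cmod (b k n) \<le> 2 / sqrt A"
      unfolding nx by (simp add: \<omega>_def M_def)
    then have "cmod (b k n) \<le> (2 / sqrt A) / exp (\<rho> * M)"
      by (subst pos_le_divide_eq) (simp_all add: mult.commute)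
    then show ?thesis
      unfolding M_def by (simp add: exp_minus divide_inverse)
  qed
  show ?thesis
    unfolding localized_def using main \<rho> by blast
qed

text \<open>Interpolants of the unit vectors supply the columns of \<open>B\<close>, and the lower
  sampling inequality bounds them uniformly. Two nodes cannot be close, because the series of a
  column drops from 1 to 0 between them at a bounded rate.\<close>

lemma complete_interpolating_necessary:
  assumes c: "Re c > 0" and mono: "strict_mono \<mu>" and cis: "complete_interpolating c \<mu>"
  obtains \<sigma> B where "\<sigma> > 0" "\<And>i j. i \<noteq> j \<Longrightarrow> \<sigma> \<le> \<bar>\<mu> i - \<mu> j\<bar>" "localized_inverse c \<mu> B"
proof -
  obtain B0 where B0: "localized_inverse c real_of_int B0"
    using localized_inverse_of_int[OF c] by blast
  have coeffs: "gauss_norm c (gauss_series c a) = ell2_norm a" if "a \<in> ell2" for a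
    unfolding gauss_norm_def gauss_coeffs_unique[OF c B0 that] ..
  obtain A where A: "A > 0"
    and lower: "\<And>a. a \<in> ell2 \<Longrightarrow> A * (ell2_norm a)\<^sup>2 \<le> (\<Sum>\<^sub>\<infinity>k. (cmod (gauss_series c a (\<mu> k)))\<^sup>2)"
  proof -
    obtain A where "A > 0" "\<forall>f\<in>gauss_space c. A * (gauss_norm c f)\<^sup>2 \<le> (\<Sum>\<^sub>\<infinity>n. (cmod (f (\<mu> n)))\<^sup>2)"
      using cis unfolding complete_interpolating_def sampling_def by blast
    then show ?thesis
      using that[of A] coeffs unfolding gauss_space_def by force
  qed
  have interp: "\<exists>a\<in>ell2. \<forall>j. gauss_series c a (\<mu> j) = y j" if "y \<in> ell2" for y
    using cis that unfolding complete_interpolating_def interpolating_def gauss_space_def by blast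
  have "\<exists>b. \<forall>k. b k \<in> ell2 \<and> (\<forall>j. gauss_series c (b k) (\<mu> j) = of_bool (j = k))"
    using interp[OF ell2_unit(1)] by (intro choice) blast
  then obtain b where b: "\<And>k. b k \<in> ell2" "\<And>j k. gauss_series c (b k) (\<mu> j) = of_bool (j = k)"
    by blast
  have inj: "a = a'" if a: "a \<in> ell2" "a' \<in> ell2" and eq: "\<And>j. gauss_series c a (\<mu> j) = gauss_series c a' (\<mu> j)" for a a'
  proof -
    let ?d = "\<lambda>n. a n - a' n"
    have d: "?d \<in> ell2" using ell2_add(1)[OF a(1) ell2_uminus[OF a(2)]] by simp
    have "A * (ell2_norm ?d)\<^sup>2 \<le> 0"
      using lower[OF d] by (simp add: gauss_series_diff[OF c a] eq)
    then have "ell2_norm ?d = 0" using A by (simp add: mult_le_0_iff)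
    then show ?thesis using ell2_bounded[OF d] by (auto intro!: ext)
  qed
  have nb: "ell2_norm (b k) \<le> 1 / sqrt A" for k
  proof -
    have "A * (ell2_norm (b k))\<^sup>2 \<le> (ell2_norm (\<lambda>j. of_bool (j = k)))\<^sup>2"
      using lower[OF b(1)[of k]] unfolding b(2) ell2_norm_sq .
    then have "(ell2_norm (b k))\<^sup>2 \<le> 1 / A"
      unfolding ell2_unit(2) using A by (simp add: field_simps)
    then have "ell2_norm (b k) \<le> sqrt (1 / A)" by (rule real_le_rsqrt)
    then show ?thesis by (simp add: real_sqrt_divide)
  qed
  obtain S where "exp_kernel_bound of_int 1 S"
    using ex_exp_kernel_bound[OF spread_of_int, of 1] by auto
  note S = exp_kernel_boundD[OF this]
  obtain G where G: "G > 0" "\<And>x y n. \<bar>x - y\<bar> \<le> 1 \<Longrightarrow>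
     cmod (gauss_kernel c x n - gauss_kernel c y n) \<le> \<bar>x - y\<bar> * (G * exp (- 1 * \<bar>x - of_int n\<bar>))"
    using gauss_kernel_lipschitz[OF c] by blast
  \<comment> \<open>Solves \<open>1 \<le> distance * (G * S) / sqrt A\<close> for the distance; the
    cap at 1 is the range of the Lipschitz estimate.\<close>
  define \<sigma> where "\<sigma> = min 1 (sqrt A / (G * S))"
  have \<sigma>: "\<sigma> > 0" using A G S by (simp add: \<sigma>_def)
  have sep: "\<sigma> \<le> \<bar>\<mu> i - \<mu> j\<bar>" if "i \<noteq> j" for i j
  proof (cases "\<bar>\<mu> i - \<mu> j\<bar> \<le> 1")
    case True
    let ?x = "\<mu> i" and ?y = "\<mu> j"
    have s: "(\<lambda>n. gauss_kernel c ?x n * b i n) summable_on UNIV" "(\<lambda>n. - (gauss_kernel c ?y n * b i n)) summable_on UNIV"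
      using gauss_summable[OF c ell2_bounded[OF b(1)]] by (auto simp: summable_on_uminus)
    have "1 = cmod (gauss_series c (b i) ?x - gauss_series c (b i) ?y)"
      using that by (simp add: b(2))
    also have "gauss_series c (b i) ?x - gauss_series c (b i) ?y
        = (\<Sum>\<^sub>\<infinity>n. (gauss_kernel c ?x n - gauss_kernel c ?y n) * b i n)"
      using infsum_add[OF s] by (simp add: gauss_series_kernel infsum_uminus left_diff_distrib)
    also have "cmod \<dots> \<le> (\<Sum>\<^sub>\<infinity>n. \<bar>?x - ?y\<bar> * (G * exp (- 1 * \<bar>?x - of_int n\<bar>)) * (1 / sqrt A))"
    proof (rule summable_on_norm_comparison(3))
      show "(\<lambda>n. \<bar>?x - ?y\<bar> * (G * exp (- 1 * \<bar>?x - of_int n\<bar>)) * (1 / sqrt A)) summable_on UNIV"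
        by (intro summable_on_cmult_left summable_on_cmult_right S)
      show "cmod ((gauss_kernel c ?x n - gauss_kernel c ?y n) * b i n)
          \<le> \<bar>?x - ?y\<bar> * (G * exp (- 1 * \<bar>?x - of_int n\<bar>)) * (1 / sqrt A)" for n
        unfolding norm_mult
        by (intro mult_mono G True order_trans[OF ell2_bounded[OF b(1)] nb]) (use G in auto)
    qed
    also have "\<dots> = \<bar>?x - ?y\<bar> * (G * (\<Sum>\<^sub>\<infinity>n. exp (- 1 * \<bar>?x - of_int n\<bar>))) * (1 / sqrt A)"
      by (simp only: infsum_cmult_left' infsum_cmult_right')
    also have "\<dots> \<le> \<bar>?x - ?y\<bar> * (G * S) * (1 / sqrt A)"
      using G S A by (intro mult_right_mono mult_left_mono) auto
    finally have "sqrt A / (G * S) \<le> \<bar>?x - ?y\<bar>"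
      using G S A by (simp add: field_simps)
    then show ?thesis by (simp add: \<sigma>_def)
  qed (simp add: \<sigma>_def)
  have sp: "spread \<mu>" by (rule spread_of_separated[OF mono \<sigma> sep])
  define B where "B = (\<lambda>n k. b k n)"
  have loc: "localized \<mu> B"
    unfolding B_def by (rule biorthogonal_decay[OF c sp A lower b])
  have AB: "(\<Sum>\<^sub>\<infinity>n. gauss_kernel c (\<mu> j) n * B n k) = of_bool (j = k)" for j k
    using b(2)[of k j] unfolding B_def gauss_series_kernel .
  have "(\<Sum>\<^sub>\<infinity>k. B n k * gauss_kernel c (\<mu> k) m) = of_bool (n = m)" for n m
  proof -
    \<comment> \<open>Column \<open>m\<close> of the matrix is the sample sequence of a unit vector.
      Applying \<open>B\<close> to it gives coefficients with the same samples by the right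
      identity, and injectivity of sampling turns this into the left identity.\<close>
    have col: "gauss_series c (\<lambda>n. of_bool (n = m)) (\<mu> j) = gauss_kernel c (\<mu> j) m" for j
      using infsum_of_bool_mult[of m "gauss_kernel c (\<mu> j)"]
      unfolding gauss_series_kernel by (simp add: mult.commute eq_commute[of _ m])
    obtain R where R: "\<And>a. a \<in> ell2 \<Longrightarrow> (\<lambda>k. (cmod (gauss_series c a (\<mu> k)))\<^sup>2) summable_on UNIV"
      using gauss_series_upper_bound[OF c sp] by blast
    have y: "(\<lambda>k. gauss_kernel c (\<mu> k) m) \<in> ell2"
      using R[OF ell2_unit(1)[of m]] unfolding col by (simp add: ell2_def)
    obtain R' where R': "\<And>y. y \<in> ell2 \<Longrightarrow> (\<lambda>n. \<Sum>\<^sub>\<infinity>k. B n k * y k) \<in> ell2"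
      using localized_ell2[OF sp loc] by blast
    have "(\<lambda>n. \<Sum>\<^sub>\<infinity>k. B n k * gauss_kernel c (\<mu> k) m) = (\<lambda>n. of_bool (n = m))"
    proof (rule inj[OF R'[OF y] ell2_unit(1)])
      show "gauss_series c (\<lambda>n. \<Sum>\<^sub>\<infinity>k. B n k * gauss_kernel c (\<mu> k) m) (\<mu> j)
          = gauss_series c (\<lambda>n. of_bool (n = m)) (\<mu> j)" for j
        unfolding col by (rule localized_inverse_right[OF c sp loc AB ell2_bounded[OF y]])
    qed
    then show ?thesis by (rule fun_cong)
  qed
  then have "localized_inverse c \<mu> B"
    unfolding localized_inverse_def using loc AB by blast
  then show ?thesis using that \<sigma> sep by blast
qed

section \<open>Counting nodes by traces of corners\<close>

lemma infsum_split:
  fixes f :: "'a \<Rightarrow> complex"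
  assumes "finite F" and g: "g summable_on UNIV" "\<And>x. cmod (f x) \<le> g x"
    and h: "h summable_on UNIV" "\<And>x. x \<notin> F \<Longrightarrow> cmod (f x) \<le> h x" "\<And>x. 0 \<le> h x"
  shows "cmod (infsum f UNIV - sum f F) \<le> infsum h UNIV"
proof -
  have fs: "f summable_on A" for A
    using summable_on_norm_comparison(1)[OF g] summable_on_subset_banach by blast
  have hs: "h summable_on A" for A
    using h(1) summable_on_subset_banach by blast
  have "infsum f UNIV - sum f F = infsum f (- F)"
    using infsum_Un_disjoint[OF fs fs, of F "- F"] assms(1) by simp
  moreover have "cmod (infsum f (- F)) \<le> infsum h (- F)"
    by (rule summable_on_norm_comparison(3)[OF hs]) (use h in auto)
  moreover have "infsum h (- F) \<le> infsum h UNIV"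
    by (rule infsum_mono_neutral[OF hs hs]) (use h in auto)
  ultimately show ?thesis by simp
qed

text \<open>\<open>T\<close> will be the entrywise product of the matrix with the transpose of its
  inverse, so full rows sum to 1. By \<open>far\<close>, an entry cut off from the corner reaches
  across one of the endpoints \<open>x\<close>, \<open>y\<close>, and its decay splits into two
  factors, each summable. The total cut off is therefore bounded independently of the sizes of
  \<open>F\<close> and \<open>F'\<close>.\<close>

lemma corner_trace:
  fixes T :: "'a \<Rightarrow> 'b \<Rightarrow> complex" and p :: "'a \<Rightarrow> real" and r :: "'b \<Rightarrow> real"
  assumes fin: "finite F" "finite F'" and row: "\<And>k. (\<Sum>\<^sub>\<infinity>n. T k n) = 1"
    and C: "C \<ge> 0" and T: "\<And>k n. cmod (T k n) \<le> C * exp (- 1 * \<bar>p k - r n\<bar>)"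
    and far: "\<And>k n. k \<in> F \<Longrightarrow> n \<notin> F' \<Longrightarrow> \<exists>u\<in>{x, y}. \<bar>p k - r n\<bar> = \<bar>u - p k\<bar> + \<bar>u - r n\<bar>"
    and p: "\<And>u. (\<lambda>k. exp (- 1 * \<bar>u - p k\<bar>)) summable_on UNIV" "\<And>u. (\<Sum>\<^sub>\<infinity>k. exp (- 1 * \<bar>u - p k\<bar>)) \<le> S"
    and r: "\<And>u. (\<lambda>n. exp (- 1 * \<bar>u - r n\<bar>)) summable_on UNIV" "\<And>u. (\<Sum>\<^sub>\<infinity>n. exp (- 1 * \<bar>u - r n\<bar>)) \<le> S"
  shows "cmod (of_nat (card F) - (\<Sum>k\<in>F. \<Sum>n\<in>F'. T k n)) \<le> C * S * (S + S)"
proof -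
  define W where "W = (\<lambda>u k n. C * (exp (- 1 * \<bar>u - p k\<bar>) * exp (- 1 * \<bar>u - r n\<bar>)))"
  have W0: "0 \<le> W u k n" for u k n using C by (simp add: W_def)
  have S0: "S \<ge> 0" using order_trans[OF infsum_nonneg p(2)] by simp
  have sW: "W u k summable_on UNIV" for u k
    unfolding W_def by (intro summable_on_cmult_right r)
  have iW: "infsum (W u k) UNIV \<le> C * S * exp (- 1 * \<bar>u - p k\<bar>)" for u k
    unfolding W_def infsum_cmult_right' using mult_left_mono[OF r(2), of "C * exp (- 1 * \<bar>u - p k\<bar>)" u] C
    by (simp add: mult_ac)
  define e where "e = (\<lambda>t. exp (- 1 * \<bar>x - t\<bar>) + exp (- 1 * \<bar>y - t\<bar>))"
  have tail: "cmod (1 - (\<Sum>n\<in>F'. T k n)) \<le> C * S * e (p k)" if k: "k \<in> F" for k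
  proof -
    have "cmod (infsum (T k) UNIV - (\<Sum>n\<in>F'. T k n)) \<le> (\<Sum>\<^sub>\<infinity>n. W x k n + W y k n)"
    proof (rule infsum_split[OF fin(2) _ T summable_on_add[OF sW sW]])
      show "(\<lambda>n. C * exp (- 1 * \<bar>p k - r n\<bar>)) summable_on UNIV"
        by (intro summable_on_cmult_right r)
      show "0 \<le> W x k n + W y k n" for n using W0 by simp
      fix n assume "n \<notin> F'"
      then obtain u where u: "u \<in> {x, y}" "\<bar>p k - r n\<bar> = \<bar>u - p k\<bar> + \<bar>u - r n\<bar>"
        using far[OF k] by blast
      have "cmod (T k n) \<le> W u k n"
        using T[of k n] unfolding W_def exp_add[symmetric] u(2) by (simp add: algebra_simps)
      then show "cmod (T k n) \<le> W x k n + W y k n"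
        using u(1) W0[of x k n] W0[of y k n] by auto
    qed
    also have "\<dots> = infsum (W x k) UNIV + infsum (W y k) UNIV"
      by (rule infsum_add[OF sW sW])
    also have "\<dots> \<le> C * S * e (p k)"
      using iW[of x k] iW[of y k] by (simp add: e_def distrib_left)
    finally show ?thesis by (simp add: row)
  qed
  have "of_nat (card F) - (\<Sum>k\<in>F. \<Sum>n\<in>F'. T k n) = (\<Sum>k\<in>F. 1 - (\<Sum>n\<in>F'. T k n))"
    by (simp add: sum_subtractf)
  also have "cmod \<dots> \<le> (\<Sum>k\<in>F. C * S * e (p k))"
    by (rule sum_norm_le) (rule tail)
  also have "\<dots> = C * S * ((\<Sum>k\<in>F. exp (- 1 * \<bar>x - p k\<bar>)) + (\<Sum>k\<in>F. exp (- 1 * \<bar>y - p k\<bar>)))"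
    unfolding e_def by (simp only: sum_distrib_left[symmetric] sum.distrib)
  also have "\<dots> \<le> C * S * (S + S)"
    using C S0 fin(1) by (intro mult_left_mono add_mono order_trans[OF finite_sum_le_infsum[OF p(1)] p(2)]) auto
  finally show ?thesis .
qed

text \<open>The number of nodes and the number of integers in an interval both equal the trace of the
  corresponding corner of \<open>A B = 1 = B A\<close>, up to entries that concentrate at the two endpoints.\<close>

lemma localized_inverse_counting:
  assumes c: "Re c > 0" and mono: "strict_mono \<mu>" and sp: "spread \<mu>" and B: "localized_inverse c \<mu> B"
  obtains D where "\<And>i. \<bar>\<mu> i - of_int i\<bar> \<le> D"
proof -
  obtain S where "exp_kernel_bound \<mu> 1 S"
    using ex_exp_kernel_bound[OF sp, of 1] by auto
  note S = exp_kernel_boundD[OF this]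
  obtain C0 where C00: "C0 > 0" and C0': "\<And>n k. cmod (B n k) \<le> C0"
    by (rule localizedE[OF localized_inverse_imp_localized[OF B]]) (rule that)
  define C where "C = exp (1\<^sup>2 / (4 * Re c)) * C0"
  have C: "C \<ge> 0" using C00 by (simp add: C_def)
  \<comment> \<open>One matrix serves both counts: its rows sum to 1 by one inverse identity and its
    columns by the other.\<close>
  define T where "T = (\<lambda>k n. gauss_kernel c (\<mu> k) n * B n k)"
  have T: "cmod (T k n) \<le> C * exp (- 1 * \<bar>\<mu> k - of_int n\<bar>)" for k n
  proof -
    have "cmod (T k n) \<le> (exp (1\<^sup>2 / (4 * Re c)) * exp (- 1 * \<bar>\<mu> k - of_int n\<bar>)) * C0"
      unfolding T_def norm_mult by (intro mult_mono norm_gauss_kernel_le[OF c] C0') auto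
    then show ?thesis by (simp add: C_def mult_ac)
  qed
  have rows: "(\<Sum>\<^sub>\<infinity>n. T k n) = 1" for k
    using B unfolding T_def localized_inverse_def by simp
  have cols: "(\<Sum>\<^sub>\<infinity>k. T k n) = 1" for n
    using B unfolding T_def localized_inverse_def by (simp add: mult.commute)
  define K where "K = 4 * C * S * S"
  have key: "\<bar>of_int (b - a) - of_int (\<lfloor>\<mu> b\<rfloor> - \<lfloor>\<mu> a\<rfloor>)\<bar> \<le> K" if ab: "a < b" for a b
  proof -
    \<comment> \<open>The integers in \<open>?I\<close> are those in the half-open interval from
      \<open>\<mu> a\<close> to \<open>\<mu> b\<close>, which matches the nodes with index in
      \<open>?J\<close>.\<close>
    let ?J = "{a<..b}" and ?I = "{\<lfloor>\<mu> a\<rfloor><..\<lfloor>\<mu> b\<rfloor>}"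
    have lt: "\<mu> i < \<mu> j \<longleftrightarrow> i < j" "\<mu> i \<le> \<mu> j \<longleftrightarrow> i \<le> j" for i j
      using mono by (auto simp: strict_mono_less strict_mono_less_eq)
    have far: "\<exists>u\<in>{\<mu> a, \<mu> b}. \<bar>\<mu> k - of_int n\<bar> = \<bar>u - \<mu> k\<bar> + \<bar>u - of_int n\<bar>"
      if "k \<in> ?J \<and> n \<notin> ?I \<or> k \<notin> ?J \<and> n \<in> ?I" for k n
    proof -
      have n: "n \<in> ?I \<longleftrightarrow> \<mu> a < of_int n \<and> of_int n \<le> \<mu> b"
        by (auto simp: floor_less_iff le_floor_iff)
      have k: "k \<in> ?J \<longleftrightarrow> \<mu> a < \<mu> k \<and> \<mu> k \<le> \<mu> b"
        by (simp add: lt)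
      have "\<mu> a < \<mu> b" using ab lt by simp
      then show ?thesis using that unfolding n k by auto
    qed
    have "cmod (of_nat (card ?J) - (\<Sum>k\<in>?J. \<Sum>n\<in>?I. T k n)) \<le> C * S * (S + S)"
      by (rule corner_trace[where p = \<mu> and r = of_int and x = "\<mu> a" and y = "\<mu> b", OF _ _ rows C T far S(2,3,4,5)]) auto
    moreover have "cmod (of_nat (card ?I) - (\<Sum>n\<in>?I. \<Sum>k\<in>?J. T k n)) \<le> C * S * (S + S)"
    proof (rule corner_trace[where p = of_int and r = \<mu> and x = "\<mu> a" and y = "\<mu> b", OF _ _ cols C _ _ S(4,5,2,3)])
      show "cmod (T k n) \<le> C * exp (- 1 * \<bar>of_int n - \<mu> k\<bar>)" for n k
        using T[of k n] by (simp only: abs_minus_commute)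
      show "\<exists>u\<in>{\<mu> a, \<mu> b}. \<bar>of_int n - \<mu> k\<bar> = \<bar>u - of_int n\<bar> + \<bar>u - \<mu> k\<bar>"
        if "n \<in> ?I" "k \<notin> ?J" for n k
        using far[of k n] that by (simp add: abs_minus_commute add.commute)
    qed auto
    moreover have "(\<Sum>n\<in>?I. \<Sum>k\<in>?J. T k n) = (\<Sum>k\<in>?J. \<Sum>n\<in>?I. T k n)"
      by (rule sum.swap)
    ultimately have "cmod (of_nat (card ?J) - of_nat (card ?I)) \<le> C * S * (S + S) + C * S * (S + S)"
      by (metis (no_types, lifting) norm_triangle_sub norm_minus_commute add_mono norm_diff_triangle_le)
    also have "\<dots> = K" by (simp add: K_def algebra_simps)
    also have "cmod (of_nat (card ?J) - of_nat (card ?I)) = \<bar>real (card ?J) - real (card ?I)\<bar>"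
      by (metis norm_of_real of_real_diff of_real_of_nat_eq)
    finally have *: "\<bar>real (card ?J) - real (card ?I)\<bar> \<le> K" .
    have "\<lfloor>\<mu> a\<rfloor> \<le> \<lfloor>\<mu> b\<rfloor>" using lt ab by (intro floor_mono) simp
    then have "real (card ?I) = of_int (\<lfloor>\<mu> b\<rfloor> - \<lfloor>\<mu> a\<rfloor>)" "real (card ?J) = of_int (b - a)"
      using ab by simp_all
    then show ?thesis using * by simp
  qed
  \<comment> \<open>Replacing the floors by the positions costs at most 1.\<close>
  have diff: "\<bar>(\<mu> b - of_int b) - (\<mu> a - of_int a)\<bar> \<le> K + 1" if "a < b" for a b
    using key[OF that] floor_correct[of "\<mu> a"] floor_correct[of "\<mu> b"] by (simp only: of_int_diff) linarith
  have K: "K \<ge> 0" using C S by (simp add: K_def)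
  show ?thesis
  proof (rule that[of "K + 1 + \<bar>\<mu> 0\<bar>"])
    fix i :: int
    consider "i < 0" | "i = 0" | "0 < i" by linarith
    then show "\<bar>\<mu> i - of_int i\<bar> \<le> K + 1 + \<bar>\<mu> 0\<bar>"
    proof cases
      case 1
      then show ?thesis using diff[of i 0] by simp
    next
      case 2
      then show ?thesis using K by simp
    next
      case 3
      then show ?thesis using diff[of 0 i] by simp
    qed
  qed
qed

section \<open>Necessity: averages\<close>

text \<open>Composing the kernel row at \<open>x\<close> with \<open>B\<close> writes the value at
  \<open>x\<close> as a sum over node values with weights decaying like
  \<open>exp (- \<rho> * \<bar>x - \<mu> j\<bar>)\<close>. The majorant \<open>g\<close> is left
  free because the nodes to the left and to the right of a window will be estimated
  differently.\<close>

lemma gauss_series_reconstruct: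
  assumes c: "Re c > 0" and sp: "spread \<mu>" and B: "localized_inverse c \<mu> B"
  obtains C \<rho> where "C > 0" "\<rho> > 0"
    "\<And>a V x g. (\<And>n. cmod (a n) \<le> V) \<Longrightarrow> g summable_on UNIV \<Longrightarrow>
        (\<And>j. exp (- \<rho> * \<bar>x - \<mu> j\<bar>) * cmod (gauss_series c a (\<mu> j)) \<le> g j) \<Longrightarrow>
        cmod (gauss_series c a x) \<le> C * infsum g UNIV"
proof -
  obtain C0 \<rho> where \<rho>: "\<rho> > 0" and C0: "\<And>n k. cmod (B n k) \<le> C0 * exp (- \<rho> * \<bar>of_int n - \<mu> k\<bar>)"
    and C00: "C0 > 0"
    by (rule localizedE[OF localized_inverse_imp_localized[OF B]]) (rule that)
  obtain S where "exp_kernel_bound \<mu> 1 S"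
    using ex_exp_kernel_bound[OF sp, of 1] by auto
  note S = exp_kernel_boundD[OF this]
  obtain S' where "exp_kernel_bound \<mu> \<rho> S'"
    using ex_exp_kernel_bound[OF sp \<rho>] by blast
  note S' = exp_kernel_boundD[OF this]
  \<comment> \<open>Rate \<open>\<rho> + 1\<close>: the part \<open>\<rho>\<close> combines with the
    decay of \<open>B\<close> by the triangle inequality, the extra 1 keeps the sum over
    \<open>n\<close> finite.\<close>
  define G where "G = exp ((\<rho> + 1)\<^sup>2 / (4 * Re c))"
  define G1 where "G1 = exp (1\<^sup>2 / (4 * Re c))"
  have K: "cmod (gauss_kernel c x n) \<le> G * exp (- (\<rho> + 1) * \<bar>x - of_int n\<bar>)" for x n
    unfolding G_def by (rule norm_gauss_kernel_le[OF c])
  have K1: "cmod (gauss_kernel c x n) \<le> G1 * exp (- 1 * \<bar>x - of_int n\<bar>)" for x n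
    unfolding G1_def by (rule norm_gauss_kernel_le[OF c])
  have G: "G > 0" "G1 > 0" by (simp_all add: G_def G1_def)
  show ?thesis
  proof (rule that[of "G * C0 * S + 1" \<rho>])
    fix a :: "int \<Rightarrow> complex" and V x :: real and g :: "int \<Rightarrow> real"
    assume a: "\<And>n. cmod (a n) \<le> V" and g: "g summable_on UNIV"
      and gb: "\<And>j. exp (- \<rho> * \<bar>x - \<mu> j\<bar>) * cmod (gauss_series c a (\<mu> j)) \<le> g j"
    obtain M where fb: "\<And>y. cmod (gauss_series c a y) \<le> M"
      using gauss_series_bounded[where a = a, OF c a] by blast
    define F where "F = (\<lambda>j. \<Sum>\<^sub>\<infinity>n. gauss_kernel c x n * B n j)"
    have F: "cmod (F j) \<le> (G * C0 * S) * exp (- \<rho> * \<bar>x - \<mu> j\<bar>)" for j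
    proof -
      have le: "cmod (gauss_kernel c x n * B n j) \<le> G * C0 * exp (- \<rho> * \<bar>x - \<mu> j\<bar>) * exp (- 1 * \<bar>x - of_int n\<bar>)" for n
      proof -
        have "cmod (gauss_kernel c x n * B n j)
            \<le> (G * exp (- (\<rho> + 1) * \<bar>x - of_int n\<bar>)) * (C0 * exp (- \<rho> * \<bar>of_int n - \<mu> j\<bar>))"
          unfolding norm_mult using G by (intro mult_mono K C0) auto
        also have "\<dots> = G * C0 * exp (- (\<rho> + 1) * \<bar>x - of_int n\<bar> + - \<rho> * \<bar>of_int n - \<mu> j\<bar>)"
          unfolding exp_add by simp
        also have "\<dots> \<le> G * C0 * exp (- \<rho> * \<bar>x - \<mu> j\<bar> + - 1 * \<bar>x - of_int n\<bar>)"
        proof -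
          have "\<rho> * \<bar>x - \<mu> j\<bar> \<le> \<rho> * (\<bar>x - of_int n\<bar> + \<bar>of_int n - \<mu> j\<bar>)"
            using \<rho> by (intro mult_left_mono) auto
          then have "- (\<rho> + 1) * \<bar>x - of_int n\<bar> + - \<rho> * \<bar>of_int n - \<mu> j\<bar>
              \<le> - \<rho> * \<bar>x - \<mu> j\<bar> + - 1 * \<bar>x - of_int n\<bar>"
            by (simp add: algebra_simps)
          then show ?thesis using G C00 by (intro mult_left_mono) auto
        qed
        finally show ?thesis unfolding exp_add by (simp add: mult.assoc)
      qed
      have "cmod (F j) \<le> (\<Sum>\<^sub>\<infinity>n. G * C0 * exp (- \<rho> * \<bar>x - \<mu> j\<bar>) * exp (- 1 * \<bar>x - of_int n\<bar>))"
        unfolding F_def by (rule summable_on_norm_comparison(3)[OF _ le]) (intro summable_on_cmult_right S)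
      also have "\<dots> \<le> G * C0 * exp (- \<rho> * \<bar>x - \<mu> j\<bar>) * S"
        unfolding infsum_cmult_right' using G C00 by (intro mult_left_mono S) auto
      finally show ?thesis by (simp add: mult_ac)
    qed
    have "gauss_series c a x = (\<Sum>\<^sub>\<infinity>n. gauss_kernel c x n * a n)"
      by (rule gauss_series_kernel)
    also have "\<dots> = (\<Sum>\<^sub>\<infinity>n. gauss_kernel c x n * (\<Sum>\<^sub>\<infinity>j. B n j * gauss_series c a (\<mu> j)))"
      by (simp only: localized_inverse_left[OF c sp B a])
    also have "\<dots> = (\<Sum>\<^sub>\<infinity>j. F j * gauss_series c a (\<mu> j))"
      unfolding F_def
    proof (rule infsum_matrix_assoc[where V = M and S = "C0 * S'"
          and g = "\<lambda>n. G1 * exp (- 1 * \<bar>x - of_int n\<bar>)"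
          and h = "\<lambda>n k. C0 * exp (- \<rho> * \<bar>of_int n - \<mu> k\<bar>)"])
      show "(\<lambda>n. G1 * exp (- 1 * \<bar>x - of_int n\<bar>)) summable_on UNIV"
        by (intro summable_on_cmult_right S)
      show "(\<lambda>k. C0 * exp (- \<rho> * \<bar>of_int n - \<mu> k\<bar>)) summable_on UNIV" for n
        by (intro summable_on_cmult_right S')
      show "(\<Sum>\<^sub>\<infinity>k. C0 * exp (- \<rho> * \<bar>of_int n - \<mu> k\<bar>)) \<le> C0 * S'" for n
        unfolding infsum_cmult_right' by (intro mult_left_mono S' less_imp_le[OF C00])
    qed (rule K1 C0 fb)+
    also have "cmod \<dots> \<le> (\<Sum>\<^sub>\<infinity>j. (G * C0 * S + 1) * g j)"
    proof (rule summable_on_norm_comparison(3))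
      show "(\<lambda>j. (G * C0 * S + 1) * g j) summable_on UNIV"
        by (intro summable_on_cmult_right g)
      fix j
      have "0 \<le> exp (- \<rho> * \<bar>x - \<mu> j\<bar>) * cmod (gauss_series c a (\<mu> j))" by simp
      then have g0: "0 \<le> g j" using gb by (rule order_trans)
      have "cmod (F j * gauss_series c a (\<mu> j)) \<le> (G * C0 * S) * exp (- \<rho> * \<bar>x - \<mu> j\<bar>) * cmod (gauss_series c a (\<mu> j))"
        unfolding norm_mult by (intro mult_right_mono F) auto
      also have "\<dots> \<le> (G * C0 * S) * g j"
        unfolding mult.assoc[of "G * C0 * S"] using gb G C00 S by (intro mult_left_mono) auto
      also have "\<dots> \<le> (G * C0 * S + 1) * g j" using g0 by (simp add: distrib_right)
      finally show "cmod (F j * gauss_series c a (\<mu> j)) \<le> (G * C0 * S + 1) * g j" .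
    qed
    finally show "cmod (gauss_series c a x) \<le> (G * C0 * S + 1) * infsum g UNIV"
      by (simp add: infsum_cmult_right')
  qed (use G C00 S \<rho> in \<open>auto intro: add_nonneg_pos\<close>)
qed

text \<open>Series with finitely many consecutive frequencies are polynomials in
  \<open>exp (2 * c * x)\<close>, so their zeros can be prescribed. The first frequency
  \<open>m\<close> is free and later carries the shift \<open>h\<close>.\<close>

lemma gauss_series_of_poly:
  fixes P :: "complex poly"
  obtains a V where "\<And>n. cmod (a n) \<le> V"
    "\<And>x. gauss_series c a x
       = exp (- c * (of_real x)\<^sup>2 + 2 * c * of_real x * of_int m) * poly P (exp (2 * c * of_real x))"
proof -
  let ?I = "{m..m + int (degree P)}"
  define a where "a = (\<lambda>n. if n \<in> ?I then exp (c * (of_int n)\<^sup>2) * coeff P (nat (n - m)) else 0)"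
  show ?thesis
  proof (rule that[of a "\<Sum>n\<in>?I. cmod (a n)"])
    show "cmod (a n) \<le> (\<Sum>n\<in>?I. cmod (a n))" for n
    proof (cases "n \<in> ?I")
      case True
      then show ?thesis by (intro member_le_sum) auto
    next
      case False
      then have "cmod (a n) = 0" unfolding a_def by (simp only: if_False norm_zero)
      then show ?thesis by (simp add: sum_nonneg)
    qed
    fix x
    let ?e = "exp (- c * (of_real x)\<^sup>2 + 2 * c * of_real x * of_int m)" and ?w = "exp (2 * c * of_real x)"
    have "gauss_series c a x = (\<Sum>n\<in>?I. gauss_kernel c x n * a n)"
      unfolding gauss_series_kernel by (rule infsum_eq_sum_support) (auto simp: a_def)
    also have "\<dots> = (\<Sum>n\<in>?I. ?e * (coeff P (nat (n - m)) * ?w ^ nat (n - m)))"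
    proof (rule sum.cong[OF refl])
      fix n assume n: "n \<in> ?I"
      have k: "gauss_kernel c x n = ?e * ?w ^ nat (n - m) * exp (- c * (of_int n)\<^sup>2)"
        using gauss_kernel_node[of "m - 1" n c x] n by simp
      have "exp (- c * (of_int n)\<^sup>2) * exp (c * (of_int n)\<^sup>2) = 1"
        by (simp flip: exp_add)
      then show "gauss_kernel c x n * a n = ?e * (coeff P (nat (n - m)) * ?w ^ nat (n - m))"
        unfolding k using n by (simp add: a_def)
    qed
    also have "\<dots> = ?e * (\<Sum>n\<in>?I. coeff P (nat (n - m)) * ?w ^ nat (n - m))"
      by (rule sum_distrib_left[symmetric])
    also have "(\<Sum>n\<in>?I. coeff P (nat (n - m)) * ?w ^ nat (n - m)) = (\<Sum>i\<le>degree P. coeff P i * ?w ^ i)"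
      by (rule sum.reindex_bij_witness[where i = "\<lambda>i. int i + m" and j = "\<lambda>n. nat (n - m)"]) auto
    finally show "gauss_series c a x = ?e * poly P ?w"
      by (simp add: poly_altdef)
  qed
qed

section \<open>Exponential inequalities for the profile\<close>

lemma norm_gauss_factor:
  "cmod (exp (- c * (of_real x)\<^sup>2 + 2 * c * of_real x * of_int m))
     = exp (2 * Re c * (of_int m * x - x\<^sup>2 / 2))"
proof -
  have "- c * (of_real x)\<^sup>2 + 2 * c * of_real x * of_int m = c * of_real (2 * (of_int m * x - x\<^sup>2 / 2))"
    by (simp add: algebra_simps)
  then show ?thesis
    by (simp add: norm_exp_eq_Re algebra_simps del: of_real_mult of_real_diff)
qed

text \<open>The profile \<open>\<psi> t = cumul \<delta> t - (h - 1 / 2) t\<close> is the logarithmic size, up to the factor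
  \<open>- 2 Re c\<close>, of the Gaussian series whose zeros are the nodes in a window and whose
  frequencies are the window shifted by \<open>h\<close>.\<close>

definition profile :: "(int \<Rightarrow> real) \<Rightarrow> int \<Rightarrow> int \<Rightarrow> real" where
  "profile \<mu> h t = cumul (\<lambda>i. \<mu> i - of_int i) t - (of_int h - 1 / 2) * of_int t"

text \<open>The Gaussian contributes \<open>t^2 / 2\<close> but the unperturbed positions contribute
  \<open>t * (t + 1) / 2\<close>; the surplus \<open>t / 2\<close> makes the slope in the profile a
  half-integer.\<close>

lemma profile_alt:
  "(of_int t + of_int h)\<^sup>2 / 2 - cumul \<mu> t = (of_int h)\<^sup>2 / 2 - profile \<mu> h t"
  unfolding cumul_diff_of_int[of \<mu>] profile_def by (simp add: power2_eq_square field_simps)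

text \<open>Take the series that vanishes at the nodes with index above \<open>k\<close> and up to
  \<open>n\<close>. Between nodes \<open>t\<close> and \<open>t + 1\<close> its size is governed by
  the profile at \<open>t\<close>, while at nodes left or right of the window it is at most what the
  profile at \<open>k\<close> or at \<open>n\<close> dictates. Recovering the former value from
  those outer nodes alone brings in the decay over the distance to the ends.\<close>

lemma profile_lower:
  assumes c: "Re c > 0" and mono: "strict_mono \<mu>" and \<sigma>: "\<sigma> > 0" and D: "\<And>i. \<bar>\<mu> i - of_int i\<bar> \<le> D"
    and sep: "\<And>i j. i \<noteq> j \<Longrightarrow> \<sigma> \<le> \<bar>\<mu> i - \<mu> j\<bar>" and B: "localized_inverse c \<mu> B"
  obtains K \<rho> where "K > 0" "\<rho> > 0" "\<And>k t n. k \<le> t \<Longrightarrow> t \<le> n \<Longrightarrow>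
     exp (- (2 * Re c * profile \<mu> h t)) \<le> K * (exp (- (2 * Re c * profile \<mu> h k) - \<rho> * of_int (t - k))
        + exp (- (2 * Re c * profile \<mu> h n) - \<rho> * of_int (n - t)))"
proof -
  define \<alpha> where "\<alpha> = Re c"
  have \<alpha>: "\<alpha> > 0" using c by (simp add: \<alpha>_def)
  have D0: "D \<ge> 0" using D[of 0] by simp
  define R where "R = cumul \<mu>"
  have lt: "\<mu> i < \<mu> j \<longleftrightarrow> i < j" "\<mu> i \<le> \<mu> j \<longleftrightarrow> i \<le> j" for i j
    using mono by (auto simp: strict_mono_less strict_mono_less_eq)
  have sp: "spread \<mu>" by (rule spread_of_bounded[OF D])
  obtain C \<rho> where C: "C > 0" and \<rho>: "\<rho> > 0" and recon:
    "\<And>a V x g. (\<And>n. cmod (a n) \<le> V) \<Longrightarrow> g summable_on UNIV \<Longrightarrow>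
        (\<And>j. exp (- \<rho> * \<bar>x - \<mu> j\<bar>) * cmod (gauss_series c a (\<mu> j)) \<le> g j) \<Longrightarrow>
        cmod (gauss_series c a x) \<le> C * infsum g UNIV"
    using gauss_series_reconstruct[OF c sp B] by blast
  obtain S where "exp_kernel_bound \<mu> \<rho> S"
    using ex_exp_kernel_bound[OF sp \<rho>] by blast
  note S = exp_kernel_boundD[OF this]
  have \<sigma>2: "\<sigma> / 2 > 0" using \<sigma> by simp
  obtain C1 where "node_product_bound \<alpha> \<mu> (\<sigma> / 2) (D + 1) C1"
    using ex_node_product_bound[OF \<alpha> \<sigma>2 D] by blast
  note C1 = node_product_boundD[OF this]
  define w where "w = (\<lambda>x. exp (2 * c * of_real x))"
  have norm_w: "cmod (w x) = exp (2 * \<alpha> * x)" for x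
    by (simp add: w_def \<alpha>_def norm_exp_eq_Re)
  \<comment> \<open>Bounds the loss from evaluating at \<open>x\<close> instead of at the optimal
    position \<open>t + h\<close>.\<close>
  define H where "H = (D + 1 + \<bar>of_int h\<bar>)\<^sup>2 / 2"
  define K where "K = C1 * exp (2 * \<alpha> * H) * (C * (C1 * exp (\<rho> * (2 * D + 1)) * S))"
  show ?thesis
  proof (rule that[of K \<rho>])
    show "K > 0" using C C1 S by (simp add: K_def)
    fix k t n :: int assume kt: "k \<le> t" and tn: "t \<le> n"
    let ?J = "{k<..n}"
    \<comment> \<open>The midpoint stays at least \<open>\<sigma> / 2\<close> away from all nodes,
      as the lower product bound requires.\<close>
    define x where "x = (\<mu> t + \<mu> (t + 1)) / 2"
    have x1: "\<mu> t + \<sigma> / 2 \<le> x" "x + \<sigma> / 2 \<le> \<mu> (t + 1)"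
      using sep[of "t + 1" t] lt(1)[of t "t + 1"] unfolding x_def by (auto simp: field_simps)
    have xt: "\<bar>x - of_int t\<bar> \<le> D + 1"
      using D[of t] D[of "t + 1"] unfolding x_def by (simp add: abs_le_iff field_simps)
    have xs: "\<sigma> / 2 \<le> \<bar>x - \<mu> i\<bar>" for i
    proof (cases "i \<le> t")
      case True
      then have "\<mu> i \<le> \<mu> t" by (simp add: lt)
      then show ?thesis using x1(1) by linarith
    next
      case False
      then have "\<mu> (t + 1) \<le> \<mu> i" by (simp add: lt)
      then show ?thesis using x1(2) by linarith
    qed
    define m where "m = k + h"
    define P where "P = (\<Prod>i\<in>?J. [:- w (\<mu> i), 1:])"
    obtain a V where a: "\<And>n. cmod (a n) \<le> V"
      and fa: "\<And>x. gauss_series c a x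
         = exp (- c * (of_real x)\<^sup>2 + 2 * c * of_real x * of_int m) * poly P (w x)"
      unfolding w_def by (rule gauss_series_of_poly[where c = c and m = m and P = P]) blast
    have nf: "cmod (gauss_series c a y) = exp (2 * \<alpha> * (of_int m * y - y\<^sup>2 / 2)) * (\<Prod>i\<in>?J. cmod (w y - w (\<mu> i)))" for y
      unfolding fa norm_mult norm_gauss_factor \<alpha>_def[symmetric] by (simp add: P_def poly_prod prod_norm)
    \<comment> \<open>The maximum over \<open>y\<close> of
      \<open>(m + e - k) * y - y^2 / 2 + R n - R e\<close>, attained at \<open>y = e + h\<close>
      because \<open>m = k + h\<close>. With \<open>e = k\<close> or \<open>e = n\<close> it bounds
      the logarithmic size at all nodes beyond that end of the window.\<close>
    define q where "q = (\<lambda>e. (of_int e + of_int h)\<^sup>2 / 2 + R n - R e)"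
    define g where "g = (\<lambda>e j. (C1 * exp (2 * \<alpha> * q e) * exp (\<rho> * (2 * D + 1) - \<rho> * \<bar>of_int (e - t)\<bar>))
        * exp (- \<rho> * \<bar>\<mu> e - \<mu> j\<bar>))"
    have g0: "0 \<le> g e j" for e j using C1 by (simp add: g_def)
    have point: "exp (- \<rho> * \<bar>x - \<mu> j\<bar>) * cmod (gauss_series c a (\<mu> j)) \<le> g e j"
      if val: "(\<Sum>i\<in>?J. if i \<le> j then \<mu> j else \<mu> i) = of_int (e - k) * \<mu> j + R n - R e"
        and dist: "\<bar>x - \<mu> j\<bar> \<ge> \<bar>\<mu> e - \<mu> j\<bar> + \<bar>of_int (e - t)\<bar> - (2 * D + 1)" for e j
    proof -
      have "(\<Prod>i\<in>?J. cmod (w (\<mu> j) - w (\<mu> i))) \<le> (\<Prod>i\<in>?J. exp (2 * \<alpha> * \<mu> j) + exp (2 * \<alpha> * \<mu> i))"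
        unfolding norm_w[symmetric] by (intro prod_mono conjI norm_triangle_ineq4) auto
      also have "\<dots> \<le> C1 * exp (2 * \<alpha> * (\<Sum>i\<in>?J. if i \<le> j then \<mu> j else \<mu> i))"
        by (rule C1(2)) (use D[of j] in auto)
      finally have "cmod (gauss_series c a (\<mu> j))
          \<le> exp (2 * \<alpha> * (of_int m * \<mu> j - (\<mu> j)\<^sup>2 / 2)) * (C1 * exp (2 * \<alpha> * (of_int (e - k) * \<mu> j + R n - R e)))"
        unfolding nf val by (intro mult_left_mono) auto
      also have "\<dots> = C1 * exp (2 * \<alpha> * (of_int m * \<mu> j - (\<mu> j)\<^sup>2 / 2 + (of_int (e - k) * \<mu> j + R n - R e)))"
        unfolding distrib_left[of "2 * \<alpha>" "of_int m * \<mu> j - (\<mu> j)\<^sup>2 / 2"] exp_add by simp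
      also have "\<dots> \<le> C1 * exp (2 * \<alpha> * q e)"
      proof -
        have "q e - (of_int m * \<mu> j - (\<mu> j)\<^sup>2 / 2 + (of_int (e - k) * \<mu> j + R n - R e))
            = (\<mu> j - (of_int e + of_int h))\<^sup>2 / 2"
          by (simp add: q_def m_def power2_eq_square field_simps)
        then have "of_int m * \<mu> j - (\<mu> j)\<^sup>2 / 2 + (of_int (e - k) * \<mu> j + R n - R e) \<le> q e"
          using zero_le_power2[of "\<mu> j - (of_int e + of_int h)"] by linarith
        then show ?thesis using C1 \<alpha> by (intro mult_left_mono iffD2[OF exp_le_cancel_iff]) auto
      qed
      finally have 1: "cmod (gauss_series c a (\<mu> j)) \<le> C1 * exp (2 * \<alpha> * q e)" .
      have "\<rho> * (\<bar>\<mu> e - \<mu> j\<bar> + \<bar>of_int (e - t)\<bar> - (2 * D + 1)) \<le> \<rho> * \<bar>x - \<mu> j\<bar>"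
        using dist \<rho> by (intro mult_left_mono) auto
      then have "exp (- \<rho> * \<bar>x - \<mu> j\<bar>) \<le> exp ((\<rho> * (2 * D + 1) - \<rho> * \<bar>of_int (e - t)\<bar>) + - \<rho> * \<bar>\<mu> e - \<mu> j\<bar>)"
        by (simp add: algebra_simps)
      then have "exp (- \<rho> * \<bar>x - \<mu> j\<bar>) * cmod (gauss_series c a (\<mu> j))
          \<le> exp ((\<rho> * (2 * D + 1) - \<rho> * \<bar>of_int (e - t)\<bar>) + - \<rho> * \<bar>\<mu> e - \<mu> j\<bar>) * (C1 * exp (2 * \<alpha> * q e))"
        using 1 by (intro mult_mono) auto
      then show ?thesis unfolding g_def exp_add by (simp add: mult_ac)
    qed
    have bound: "exp (- \<rho> * \<bar>x - \<mu> j\<bar>) * cmod (gauss_series c a (\<mu> j)) \<le> g k j + g n j" for j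
    proof -
      consider "j \<in> ?J" | "n < j" | "j \<le> k" by force
      then show ?thesis
      proof cases
        case 1
        then have "(\<Prod>i\<in>?J. cmod (w (\<mu> j) - w (\<mu> i))) = 0" by (intro prod_zero) auto
        then have "cmod (gauss_series c a (\<mu> j)) = 0" unfolding nf by simp
        then show ?thesis using g0[of k j] g0[of n j] by simp
      next
        case 2
        have "(\<Sum>i\<in>?J. if i \<le> j then \<mu> j else \<mu> i) = (\<Sum>i\<in>?J. \<mu> j)"
          by (rule sum.cong) (use 2 in auto)
        then have "(\<Sum>i\<in>?J. if i \<le> j then \<mu> j else \<mu> i) = of_int (n - k) * \<mu> j + R n - R n"
          using kt tn by simp
        moreover have "\<bar>x - \<mu> j\<bar> \<ge> \<bar>\<mu> n - \<mu> j\<bar> + \<bar>of_int (n - t)\<bar> - (2 * D + 1)"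
          using xt D[of n] lt(1)[of n j] 2 tn by simp
        ultimately show ?thesis using point[of j n] g0[of k j] by linarith
      next
        case 3
        have "(\<Sum>i\<in>?J. if i \<le> j then \<mu> j else \<mu> i) = (\<Sum>i\<in>?J. \<mu> i)"
          by (rule sum.cong) (use 3 in auto)
        also have "\<dots> = R n - R k" using kt tn unfolding R_def by (intro sum_eq_cumul) simp
        finally have "(\<Sum>i\<in>?J. if i \<le> j then \<mu> j else \<mu> i) = of_int (k - k) * \<mu> j + R n - R k" by simp
        moreover have "\<bar>x - \<mu> j\<bar> \<ge> \<bar>\<mu> k - \<mu> j\<bar> + \<bar>of_int (k - t)\<bar> - (2 * D + 1)"
          using xt D[of k] lt(2)[of j k] 3 kt by simp
        ultimately show ?thesis using point[of j k] g0[of n j] by linarith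
      qed
    qed
    define E where "E = (\<lambda>e. exp (2 * \<alpha> * q e - \<rho> * \<bar>of_int (e - t)\<bar>))"
    have gs: "g e summable_on UNIV" for e
      unfolding g_def by (intro summable_on_cmult_right S)
    have gi: "infsum (g e) UNIV \<le> (C1 * exp (\<rho> * (2 * D + 1)) * S) * E e" for e
    proof -
      have "infsum (g e) UNIV \<le> (C1 * exp (2 * \<alpha> * q e) * exp (\<rho> * (2 * D + 1) - \<rho> * \<bar>of_int (e - t)\<bar>)) * S"
        unfolding g_def infsum_cmult_right' using C1 by (intro mult_left_mono S) auto
      also have "\<dots> = (C1 * exp (\<rho> * (2 * D + 1)) * S) * E e"
        unfolding E_def exp_diff by simp
      finally show ?thesis .
    qed
    have "cmod (gauss_series c a x) \<le> C * (\<Sum>\<^sub>\<infinity>j. g k j + g n j)"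
      by (rule recon[OF a summable_on_add[OF gs gs] bound])
    also have "\<dots> = C * (infsum (g k) UNIV + infsum (g n) UNIV)"
      using infsum_add[OF gs gs, of k n] by simp
    also have "\<dots> \<le> C * ((C1 * exp (\<rho> * (2 * D + 1)) * S) * E k + (C1 * exp (\<rho> * (2 * D + 1)) * S) * E n)"
      using C by (intro mult_left_mono add_mono gi) auto
    finally have upper: "cmod (gauss_series c a x) \<le> C * (C1 * exp (\<rho> * (2 * D + 1)) * S) * (E k + E n)"
      by (simp add: algebra_simps)
    have "exp (2 * \<alpha> * (q t - H)) \<le> C1 * cmod (gauss_series c a x)"
    proof -
      have "exp (2 * \<alpha> * (of_int (t - k) * x + R n - R t)) \<le> C1 * (\<Prod>i\<in>?J. \<bar>exp (2 * \<alpha> * x) - exp (2 * \<alpha> * \<mu> i)\<bar>)"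
      proof -
        have "(\<Sum>i\<in>?J. if i \<le> t then x else \<mu> i) = of_int (t - k) * x + R n - R t"
          unfolding R_def by (rule sum_split_cumul[OF kt tn])
        then show ?thesis using C1(3)[of ?J x t] xt xs by simp
      qed
      also have "\<dots> \<le> C1 * (\<Prod>i\<in>?J. cmod (w x - w (\<mu> i)))"
        using C1(1) by (intro mult_left_mono prod_mono) (auto simp: norm_w[symmetric] norm_triangle_ineq3)
      finally have "exp (2 * \<alpha> * (of_int m * x - x\<^sup>2 / 2)) * exp (2 * \<alpha> * (of_int (t - k) * x + R n - R t))
          \<le> exp (2 * \<alpha> * (of_int m * x - x\<^sup>2 / 2)) * (C1 * (\<Prod>i\<in>?J. cmod (w x - w (\<mu> i))))"
        by (intro mult_left_mono) auto
      also have "\<dots> = C1 * cmod (gauss_series c a x)"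
        unfolding nf by simp
      finally have 1: "exp (2 * \<alpha> * (of_int m * x - x\<^sup>2 / 2 + (of_int (t - k) * x + R n - R t))) \<le> C1 * cmod (gauss_series c a x)"
        unfolding distrib_left[of "2 * \<alpha>" "of_int m * x - x\<^sup>2 / 2"] exp_add .
      have "q t - (of_int m * x - x\<^sup>2 / 2 + (of_int (t - k) * x + R n - R t))
          = (x - (of_int t + of_int h))\<^sup>2 / 2"
        by (simp add: q_def m_def power2_eq_square field_simps)
      also have "\<dots> \<le> H"
      proof -
        have "\<bar>x - (of_int t + of_int h)\<bar> \<le> \<bar>D + 1 + \<bar>of_int h\<bar>\<bar>" using xt by linarith
        then show ?thesis unfolding H_def abs_le_square_iff by simp
      qed
      finally have "2 * \<alpha> * (q t - H) \<le> 2 * \<alpha> * (of_int m * x - x\<^sup>2 / 2 + (of_int (t - k) * x + R n - R t))"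
        using \<alpha> by (intro mult_left_mono) auto
      then show ?thesis using 1 by (meson exp_le_cancel_iff order_trans)
    qed
    also have "\<dots> \<le> C1 * (C * (C1 * exp (\<rho> * (2 * D + 1)) * S) * (E k + E n))"
      using C1(1) upper by (intro mult_left_mono) auto
    finally have "exp (2 * \<alpha> * H) * exp (2 * \<alpha> * (q t - H)) \<le> exp (2 * \<alpha> * H) * (C1 * (C * (C1 * exp (\<rho> * (2 * D + 1)) * S) * (E k + E n)))"
      by (intro mult_left_mono) auto
    then have main: "exp (2 * \<alpha> * q t) \<le> K * (E k + E n)"
      unfolding K_def by (simp add: right_diff_distrib mult_ac flip: exp_add)
    define z where "z = (of_int h)\<^sup>2 / 2 + R n"
    have qe: "2 * \<alpha> * q e = 2 * \<alpha> * z + - (2 * \<alpha> * profile \<mu> h e)" for e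
    proof -
      have "q e = z - profile \<mu> h e"
        using profile_alt[of e h \<mu>] unfolding q_def z_def R_def by linarith
      then show ?thesis by (simp add: right_diff_distrib)
    qed
    have "exp (2 * \<alpha> * z) * exp (- (2 * \<alpha> * profile \<mu> h t))
        \<le> exp (2 * \<alpha> * z) * (K * (exp (- (2 * \<alpha> * profile \<mu> h k) - \<rho> * of_int (t - k))
          + exp (- (2 * \<alpha> * profile \<mu> h n) - \<rho> * of_int (n - t))))"
      using main kt tn unfolding E_def qe exp_add exp_diff by (simp add: algebra_simps)
    then show "exp (- (2 * Re c * profile \<mu> h t)) \<le> K * (exp (- (2 * Re c * profile \<mu> h k) - \<rho> * of_int (t - k))
        + exp (- (2 * Re c * profile \<mu> h n) - \<rho> * of_int (n - t)))"
      unfolding \<alpha>_def by (subst (asm) mult_le_cancel_left_pos) auto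
  qed (rule \<rho>)
qed

lemma profile_step:
  "profile \<mu> h (t + 1) = profile \<mu> h t + ((\<mu> (t + 1) - of_int (t + 1)) - (of_int h - 1 / 2))"
  unfolding profile_def cumul_step by (simp add: algebra_simps)

lemma profile_lipschitz:
  assumes D: "\<And>i. \<bar>\<mu> i - of_int i\<bar> \<le> D"
  shows "\<bar>profile \<mu> h i - profile \<mu> h j\<bar> \<le> (D + \<bar>of_int h\<bar> + 1) * \<bar>of_int (i - j)\<bar>"
proof -
  let ?H = "D + \<bar>of_int h\<bar> + 1"
  have step: "\<bar>profile \<mu> h (t + 1) - profile \<mu> h t\<bar> \<le> ?H" for t
    unfolding profile_step using D[of "t + 1"] by linarith
  have le: "\<bar>profile \<mu> h j - profile \<mu> h i\<bar> \<le> ?H * of_int (j - i)" if "i \<le> j" for i j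
    using that
  proof (induction j rule: int_ge_induct)
    case (step j)
    have "?H * of_int (j + 1 - i) = ?H * of_int (j - i) + ?H" by (simp add: algebra_simps)
    then show ?case
      using step.IH \<open>\<And>t. \<bar>profile \<mu> h (t + 1) - profile \<mu> h t\<bar> \<le> ?H\<close>[of j] by linarith
  qed simp
  show ?thesis
    using le[of i j] le[of j i] by (cases "i \<le> j") (simp_all add: abs_minus_commute)
qed

text \<open>The dual of \<open>profile_lower\<close>. Divided-difference weights \<open>y\<close> on
  a window of nodes annihilate the columns of the shifted frequency window. Recovering
  \<open>y t\<close> through \<open>B\<close> therefore involves only frequencies beyond the ends,
  at a distance from node \<open>t\<close> at which \<open>B\<close> has decayed. The modulus of
  \<open>y j\<close> is governed by the profile with the sign opposite to that in
  \<open>profile_lower\<close>.\<close>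

lemma profile_upper:
  assumes c: "Re c > 0" and \<sigma>: "\<sigma> > 0" and D: "\<And>i. \<bar>\<mu> i - of_int i\<bar> \<le> D"
    and sep: "\<And>i j. i \<noteq> j \<Longrightarrow> \<sigma> \<le> \<bar>\<mu> i - \<mu> j\<bar>" and B: "localized_inverse c \<mu> B"
  obtains K \<rho> where "K > 0" "\<rho> > 0" "\<And>k t n. k \<le> t \<Longrightarrow> t \<le> n \<Longrightarrow>
     exp (2 * Re c * profile \<mu> h t) \<le> K * (exp (2 * Re c * profile \<mu> h k - \<rho> * of_int (t - k))
        + exp (2 * Re c * profile \<mu> h n - \<rho> * of_int (n - t)))"
proof -
  define \<alpha> where "\<alpha> = Re c"
  have \<alpha>: "\<alpha> > 0" using c by (simp add: \<alpha>_def)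
  have D0: "D \<ge> 0" using D[of 0] by simp
  define R where "R = cumul \<mu>"
  obtain C0 \<rho> where \<rho>: "\<rho> > 0" and Bb: "\<And>n k. cmod (B n k) \<le> C0 * exp (- \<rho> * \<bar>of_int n - \<mu> k\<bar>)"
    and C0: "C0 > 0" and Bb': "\<And>n k. cmod (B n k) \<le> C0"
    by (rule localizedE[OF localized_inverse_imp_localized[OF B]]) (rule that)
  obtain S where "exp_kernel_bound real_of_int 1 S"
    using ex_exp_kernel_bound[OF spread_of_int, of 1] by auto
  note S = exp_kernel_boundD[OF this]
  obtain C1 where "node_product_bound \<alpha> \<mu> \<sigma> D C1"
    using ex_node_product_bound[OF \<alpha> \<sigma> D] by blast
  note C1 = node_product_boundD[OF this]
  define w where "w = (\<lambda>j. exp (2 * c * of_real (\<mu> j)))"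
  have norm_w: "cmod (w j) = exp (2 * \<alpha> * \<mu> j)" for j
    by (simp add: w_def \<alpha>_def norm_exp_eq_Re)
  have inj_w: "inj w"
    unfolding w_def by (rule inj_node[OF c \<sigma> sep])
  \<comment> \<open>Bounds the distance from \<open>\<mu> j\<close> to \<open>j + h\<close>.\<close>
  define d where "d = D + \<bar>of_int h\<bar>"
  have d0: "d \<ge> 0" using D0 by (simp add: d_def)
  \<comment> \<open>The exponent \<open>2 * \<alpha> * q\<close> changes by at most
    \<open>2 * \<alpha> * (d + 1)\<close> per step. A Gaussian rate larger by 1 lets every
    \<open>y j\<close> be compared with the end of the window while leaving a summable factor in
    \<open>j\<close>.\<close>
  define \<eta> where "\<eta> = 2 * \<alpha> * (d + 1) + 1"
  have \<eta>: "\<eta> \<ge> 1" using \<alpha> d0 by (simp add: \<eta>_def)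
  define G where "G = exp (\<eta>\<^sup>2 / (4 * Re c))"
  define M1 where "M1 = C1 * G * exp (2 * \<alpha> * (d\<^sup>2 / 2) + \<eta> * d)"
  define M where "M = M1 * S * (C0 * exp (\<rho> * d))"
  have M1: "M1 > 0" using C1 by (simp add: M1_def G_def)
  then have M: "M > 0" using S C0 by (simp add: M_def)
  show ?thesis
  proof (rule that[of "C1 * (M * S)" \<rho>])
    show "C1 * (M * S) > 0" using C1 M S by simp
    fix k t n :: int assume kt: "k \<le> t" and tn: "t \<le> n"
    \<comment> \<open>One node more than the \<open>n - k\<close> frequencies from
      \<open>k + h\<close> to \<open>n + h - 1\<close>, which is exactly what a divided difference
      needs to annihilate them.\<close>
    let ?J = "{k - 1<..n}"
    define p where "p = k + h"
    define fac where "fac = (\<lambda>x. exp (- c * (of_real x)\<^sup>2 + 2 * c * of_real x * of_int p))"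
    define Q where "Q = (\<lambda>j. \<Prod>i\<in>?J - {j}. w j - w i)"
    \<comment> \<open>Divided-difference weights, with the Gaussian row factor of each node
      removed.\<close>
    define y where "y = (\<lambda>j. 1 / (fac (\<mu> j) * Q j))"
    define q where "q = (\<lambda>e. profile \<mu> h e - R n - (of_int h)\<^sup>2 / 2)"
    have Q0: "Q j \<noteq> 0" for j
      using inj_w by (auto simp: Q_def inj_def)
    have fac0: "fac x \<noteq> 0" for x by (simp add: fac_def)
    have ybound: "cmod (y j) \<le> C1 * exp (2 * \<alpha> * (q j + d\<^sup>2 / 2))" "exp (2 * \<alpha> * q j) \<le> C1 * cmod (y j)"
      if j: "j \<in> ?J" for j
    proof -
      define Y where "Y = of_int (j - k) * \<mu> j + R n - R j"
      have "(\<Sum>i\<in>?J. if i \<le> j then \<mu> j else \<mu> i) = \<mu> j + (\<Sum>i\<in>?J - {j}. if i \<le> j then \<mu> j else \<mu> i)"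
        using j by (subst sum.remove[of ?J j]) auto
      moreover have "(\<Sum>i\<in>?J. if i \<le> j then \<mu> j else \<mu> i) = of_int (j - (k - 1)) * \<mu> j + R n - R j"
        using j unfolding R_def by (intro sum_split_cumul) auto
      ultimately have sY: "(\<Sum>i\<in>?J - {j}. if i \<le> j then \<mu> j else \<mu> i) = Y"
        by (simp add: Y_def algebra_simps)
      have nQ: "cmod (Q j) = (\<Prod>i\<in>?J - {j}. cmod (w j - w i))"
        by (simp add: Q_def prod_norm)
      have "cmod (Q j) \<le> (\<Prod>i\<in>?J - {j}. exp (2 * \<alpha> * \<mu> j) + exp (2 * \<alpha> * \<mu> i))"
        unfolding nQ norm_w[symmetric] by (intro prod_mono conjI norm_triangle_ineq4) auto
      also have "\<dots> \<le> C1 * exp (2 * \<alpha> * Y)"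
        unfolding sY[symmetric] by (rule C1(2)) (use D[of j] in auto)
      finally have Qu: "cmod (Q j) \<le> C1 * exp (2 * \<alpha> * Y)" .
      have "exp (2 * \<alpha> * Y) \<le> C1 * (\<Prod>i\<in>?J - {j}. \<bar>exp (2 * \<alpha> * \<mu> j) - exp (2 * \<alpha> * \<mu> i)\<bar>)"
        unfolding sY[symmetric] by (rule C1(3)) (use D[of j] sep in auto)
      also have "\<dots> \<le> C1 * cmod (Q j)"
        unfolding nQ using C1(1) by (intro mult_left_mono prod_mono) (auto simp: norm_w[symmetric] norm_triangle_ineq3)
      finally have Ql: "exp (2 * \<alpha> * Y) \<le> C1 * cmod (Q j)" .
      define X where "X = of_int p * \<mu> j - (\<mu> j)\<^sup>2 / 2"
      have ny: "cmod (y j) = exp (- (2 * \<alpha> * X)) / cmod (Q j)"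
        unfolding y_def norm_divide norm_mult fac_def norm_gauss_factor \<alpha>_def[symmetric] X_def
        by (simp add: exp_minus field_simps)
      define \<theta> where "\<theta> = \<mu> j - (of_int j + of_int h)"
      have "- X - Y = \<theta>\<^sup>2 / 2 - ((of_int j + of_int h)\<^sup>2 / 2 - R j) - R n"
        unfolding X_def Y_def p_def \<theta>_def by (simp add: power2_eq_square field_simps)
      also have "\<dots> = \<theta>\<^sup>2 / 2 + q j"
        unfolding q_def R_def profile_alt by simp
      finally have XY: "- X - Y = \<theta>\<^sup>2 / 2 + q j" .
      have "\<bar>\<theta>\<bar> \<le> \<bar>d\<bar>" using D[of j] unfolding \<theta>_def d_def by linarith
      then have \<theta>: "\<theta>\<^sup>2 \<le> d\<^sup>2" by (simp add: abs_le_square_iff)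
      have pos: "cmod (Q j) > 0" using Q0 by simp
      have "exp (- (2 * \<alpha> * X)) \<le> C1 * exp (2 * \<alpha> * (- X - Y)) * cmod (Q j)"
      proof -
        have "exp (2 * \<alpha> * (- X - Y)) * exp (2 * \<alpha> * Y) \<le> exp (2 * \<alpha> * (- X - Y)) * (C1 * cmod (Q j))"
          using Ql by (intro mult_left_mono) auto
        then show ?thesis by (simp add: mult_ac algebra_simps flip: exp_add)
      qed
      then have "cmod (y j) \<le> C1 * exp (2 * \<alpha> * (- X - Y))"
        unfolding ny by (subst pos_divide_le_eq[OF pos])
      also have "\<dots> \<le> C1 * exp (2 * \<alpha> * (q j + d\<^sup>2 / 2))"
        unfolding XY using C1(1) \<alpha> \<theta> by (intro mult_left_mono iffD2[OF exp_le_cancel_iff]) auto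
      finally show "cmod (y j) \<le> C1 * exp (2 * \<alpha> * (q j + d\<^sup>2 / 2))" .
      have "exp (2 * \<alpha> * q j) \<le> exp (2 * \<alpha> * (- X - Y))"
        unfolding XY using \<alpha> by simp
      also have "\<dots> \<le> C1 * cmod (y j)"
      proof -
        have "exp (2 * \<alpha> * (- X - Y)) * cmod (Q j) \<le> exp (2 * \<alpha> * (- X - Y)) * (C1 * exp (2 * \<alpha> * Y))"
          using Qu by (intro mult_left_mono) auto
        also have "\<dots> = C1 * exp (- (2 * \<alpha> * X))"
          by (simp add: mult_ac algebra_simps flip: exp_add)
        finally show ?thesis
          unfolding ny times_divide_eq_right by (subst pos_le_divide_eq[OF pos])
      qed
      finally show "exp (2 * \<alpha> * q j) \<le> C1 * cmod (y j)" .
    qed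
    define z where "z = (\<lambda>\<nu>. \<Sum>j\<in>?J. y j * gauss_kernel c (\<mu> j) \<nu>)"
    have z0: "z \<nu> = 0" if "p \<le> \<nu>" "\<nu> < n + h" for \<nu>
    proof -
      have "z \<nu> = (\<Sum>j\<in>?J. w j ^ nat (\<nu> - p) / Q j * exp (- c * (of_int \<nu>)\<^sup>2))"
        unfolding z_def
      proof (rule sum.cong[OF refl])
        fix j
        have "gauss_kernel c (\<mu> j) \<nu> = fac (\<mu> j) * w j ^ nat (\<nu> - p) * exp (- c * (of_int \<nu>)\<^sup>2)"
          using gauss_kernel_node[of "p - 1" \<nu> c "\<mu> j"] that(1) by (simp add: fac_def w_def)
        then show "y j * gauss_kernel c (\<mu> j) \<nu> = w j ^ nat (\<nu> - p) / Q j * exp (- c * (of_int \<nu>)\<^sup>2)"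
          using fac0 by (simp add: y_def)
      qed
      also have "\<dots> = (\<Sum>j\<in>?J. w j ^ nat (\<nu> - p) / Q j) * exp (- c * (of_int \<nu>)\<^sup>2)"
        by (rule sum_distrib_right[symmetric])
      also have "(\<Sum>j\<in>?J. w j ^ nat (\<nu> - p) / Q j) = 0"
        unfolding Q_def
        by (rule divided_difference_power) (use inj_w that in \<open>auto intro: inj_on_subset simp: p_def\<close>)
      finally show ?thesis by simp
    qed
    define g where "g = (\<lambda>e \<nu>. (M * exp (2 * \<alpha> * q e - \<rho> * \<bar>of_int (e - t)\<bar>)) * exp (- 1 * \<bar>of_int (e + h) - of_int \<nu>\<bar>))"
    have g0: "0 \<le> g e \<nu>" for e \<nu> using M by (simp add: g_def)
    have point: "cmod (z \<nu> * B \<nu> t) \<le> g e \<nu>"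
      if far: "\<And>j. j \<in> ?J \<Longrightarrow> \<bar>of_int (e + h) - of_int \<nu>\<bar> + \<bar>of_int (e - j)\<bar> - d \<le> \<bar>\<mu> j - of_int \<nu>\<bar>"
        and far': "\<bar>of_int (e - t)\<bar> - d \<le> \<bar>of_int \<nu> - \<mu> t\<bar>" for e \<nu>
    proof -
      let ?a = "\<bar>of_int (e + h) - of_int \<nu>\<bar>"
      have "cmod (y j * gauss_kernel c (\<mu> j) \<nu>)
          \<le> M1 * exp (2 * \<alpha> * q e) * exp (- 1 * ?a) * exp (- 1 * \<bar>of_int e - of_int j\<bar>)" if j: "j \<in> ?J" for j
      proof -
        let ?b = "\<bar>of_int (e - j)\<bar>"
        have "cmod (y j * gauss_kernel c (\<mu> j) \<nu>)
            \<le> (C1 * exp (2 * \<alpha> * (q j + d\<^sup>2 / 2))) * (G * exp (- \<eta> * \<bar>\<mu> j - of_int \<nu>\<bar>))"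
          unfolding norm_mult G_def using C1 by (intro mult_mono ybound(1)[OF j] norm_gauss_kernel_le[OF c]) auto
        also have "\<dots> = C1 * G * exp (2 * \<alpha> * (q j + d\<^sup>2 / 2) + - \<eta> * \<bar>\<mu> j - of_int \<nu>\<bar>)"
          unfolding exp_add by simp
        also have "\<dots> \<le> C1 * G * exp ((2 * \<alpha> * (d\<^sup>2 / 2) + \<eta> * d) + (2 * \<alpha> * q e + (- 1 * ?a + - 1 * ?b)))"
        proof -
          have "q j - q e \<le> (d + 1) * ?b"
            using profile_lipschitz[where \<mu> = \<mu> and h = h and D = D and i = e and j = j, OF D] unfolding q_def d_def by linarith
          then have "2 * \<alpha> * (q j - q e) \<le> 2 * \<alpha> * ((d + 1) * ?b)" using \<alpha> by (intro mult_left_mono) auto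
          also have "\<dots> = (\<eta> - 1) * ?b" by (simp add: \<eta>_def algebra_simps)
          finally have 1: "2 * \<alpha> * (q j - q e) \<le> (\<eta> - 1) * ?b" .
          have "\<eta> * (?a + ?b - d) \<le> \<eta> * \<bar>\<mu> j - of_int \<nu>\<bar>" using far[OF j] \<eta> by (intro mult_left_mono) auto
          moreover have "1 * ?a \<le> \<eta> * ?a" using \<eta> by (intro mult_right_mono) auto
          ultimately have "2 * \<alpha> * (q j + d\<^sup>2 / 2) + - \<eta> * \<bar>\<mu> j - of_int \<nu>\<bar>
              \<le> (2 * \<alpha> * (d\<^sup>2 / 2) + \<eta> * d) + (2 * \<alpha> * q e + (- 1 * ?a + - 1 * ?b))"
            using 1 by (simp only: right_diff_distrib distrib_left left_diff_distrib)
          then show ?thesis using C1 by (intro mult_left_mono iffD2[OF exp_le_cancel_iff]) (auto simp: G_def)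
        qed
        finally show ?thesis unfolding M1_def exp_add by (simp add: mult_ac)
      qed
      then have "cmod (z \<nu>) \<le> (\<Sum>j\<in>?J. M1 * exp (2 * \<alpha> * q e) * exp (- 1 * ?a) * exp (- 1 * \<bar>of_int e - of_int j\<bar>))"
        unfolding z_def by (rule sum_norm_le)
      also have "\<dots> \<le> M1 * exp (2 * \<alpha> * q e) * exp (- 1 * ?a) * S"
        unfolding sum_distrib_left[symmetric] using M1
        by (intro mult_left_mono order_trans[OF finite_sum_le_infsum[OF S(2)] S(3)]) auto
      finally have zb: "cmod (z \<nu>) \<le> M1 * exp (2 * \<alpha> * q e) * exp (- 1 * ?a) * S" .
      have "\<rho> * (\<bar>of_int (e - t)\<bar> - d) \<le> \<rho> * \<bar>of_int \<nu> - \<mu> t\<bar>"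
        using far' \<rho> by (intro mult_left_mono) auto
      then have "exp (- \<rho> * \<bar>of_int \<nu> - \<mu> t\<bar>) \<le> exp (\<rho> * d) * exp (- (\<rho> * \<bar>of_int (e - t)\<bar>))"
        unfolding exp_add[symmetric] by (simp add: algebra_simps)
      then have "C0 * exp (- \<rho> * \<bar>of_int \<nu> - \<mu> t\<bar>) \<le> C0 * (exp (\<rho> * d) * exp (- (\<rho> * \<bar>of_int (e - t)\<bar>)))"
        using C0 by (intro mult_left_mono) auto
      with Bb[of \<nu> t] have "cmod (B \<nu> t) \<le> C0 * (exp (\<rho> * d) * exp (- (\<rho> * \<bar>of_int (e - t)\<bar>)))"
        by linarith
      then have "cmod (z \<nu> * B \<nu> t) \<le> (M1 * exp (2 * \<alpha> * q e) * exp (- 1 * ?a) * S) * (C0 * (exp (\<rho> * d) * exp (- (\<rho> * \<bar>of_int (e - t)\<bar>))))"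
        unfolding norm_mult using zb M1 S by (intro mult_mono) auto
      also have "\<dots> = g e \<nu>"
        unfolding g_def M_def diff_conv_add_uminus[of "2 * \<alpha> * q e"] exp_add by simp
      finally show ?thesis .
    qed
    have bound: "cmod (z \<nu> * B \<nu> t) \<le> g k \<nu> + g n \<nu>" for \<nu>
    proof -
      consider "p \<le> \<nu> \<and> \<nu> < n + h" | "n + h \<le> \<nu>" | "\<nu> < k + h" by (force simp: p_def)
      then show ?thesis
      proof cases
        case 1
        then show ?thesis using z0 g0[of k \<nu>] g0[of n \<nu>] by simp
      next
        case 2
        have "cmod (z \<nu> * B \<nu> t) \<le> g n \<nu>"
        proof (rule point)
          fix j assume "j \<in> ?J"
          then show "\<bar>of_int (n + h) - of_int \<nu>\<bar> + \<bar>of_int (n - j)\<bar> - d \<le> \<bar>\<mu> j - of_int \<nu>\<bar>"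
            using D[of j] 2 by (simp add: d_def)
        next
          show "\<bar>of_int (n - t)\<bar> - d \<le> \<bar>of_int \<nu> - \<mu> t\<bar>"
            using D[of t] 2 tn by (simp add: d_def)
        qed
        then show ?thesis using g0[of k \<nu>] by linarith
      next
        case 3
        have "cmod (z \<nu> * B \<nu> t) \<le> g k \<nu>"
        proof (rule point)
          fix j assume "j \<in> ?J"
          then show "\<bar>of_int (k + h) - of_int \<nu>\<bar> + \<bar>of_int (k - j)\<bar> - d \<le> \<bar>\<mu> j - of_int \<nu>\<bar>"
            using D[of j] 3 by (simp add: d_def)
        next
          show "\<bar>of_int (k - t)\<bar> - d \<le> \<bar>of_int \<nu> - \<mu> t\<bar>"
            using D[of t] 3 kt by (simp add: d_def)
        qed
        then show ?thesis using g0[of n \<nu>] by linarith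
      qed
    qed
    have gs: "g e summable_on UNIV" for e
      unfolding g_def by (intro summable_on_cmult_right S)
    have gi: "infsum (g e) UNIV \<le> (M * S) * exp (2 * \<alpha> * q e - \<rho> * \<bar>of_int (e - t)\<bar>)" for e
    proof -
      have "infsum (g e) UNIV \<le> (M * exp (2 * \<alpha> * q e - \<rho> * \<bar>of_int (e - t)\<bar>)) * S"
        unfolding g_def infsum_cmult_right' using M by (intro mult_left_mono S) auto
      then show ?thesis by (simp add: mult_ac)
    qed
    have tJ: "t \<in> ?J" using kt tn by simp
    \<comment> \<open>Pairing \<open>y\<close> with column \<open>t\<close> of the identity
      \<open>A B = 1\<close> leaves \<open>y t\<close>; since \<open>y\<close> has finite support,
      the sum over nodes may be taken inside.\<close>
    have "((\<lambda>\<nu>. gauss_kernel c (\<mu> j) \<nu> * B \<nu> t) has_sum of_bool (j = t)) UNIV" for j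
      using gauss_summable[OF c, of "\<lambda>\<nu>. B \<nu> t", OF Bb'] B unfolding localized_inverse_def has_sum_iff by blast
    then have "((\<lambda>\<nu>. \<Sum>j\<in>?J. y j * (gauss_kernel c (\<mu> j) \<nu> * B \<nu> t)) has_sum (\<Sum>j\<in>?J. y j * of_bool (j = t))) UNIV"
      by (intro has_sum_sum has_sum_cmult_right)
    then have "((\<lambda>\<nu>. z \<nu> * B \<nu> t) has_sum y t) UNIV"
      using tJ by (simp add: z_def sum_distrib_right mult.assoc of_bool_def if_distrib cong: if_cong)
    then have "cmod (y t) \<le> infsum (\<lambda>\<nu>. g k \<nu> + g n \<nu>) UNIV"
      by (rule norm_infsum_le[OF _ has_sum_infsum[OF summable_on_add[OF gs gs]] bound])
    also have "\<dots> = infsum (g k) UNIV + infsum (g n) UNIV"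
      by (rule infsum_add[OF gs gs])
    also have "\<dots> \<le> (M * S) * exp (2 * \<alpha> * q k - \<rho> * \<bar>of_int (k - t)\<bar>) + (M * S) * exp (2 * \<alpha> * q n - \<rho> * \<bar>of_int (n - t)\<bar>)"
      by (intro add_mono gi)
    finally have "cmod (y t) \<le> (M * S) * (exp (2 * \<alpha> * q k - \<rho> * of_int (t - k)) + exp (2 * \<alpha> * q n - \<rho> * of_int (n - t)))"
      using kt tn by (simp add: distrib_left)
    then have "C1 * cmod (y t) \<le> C1 * ((M * S) * (exp (2 * \<alpha> * q k - \<rho> * of_int (t - k)) + exp (2 * \<alpha> * q n - \<rho> * of_int (n - t))))"
      using C1(1) by (intro mult_left_mono) auto
    with ybound(2)[OF tJ] have main: "exp (2 * \<alpha> * q t) \<le> C1 * (M * S) * (exp (2 * \<alpha> * q k - \<rho> * of_int (t - k)) + exp (2 * \<alpha> * q n - \<rho> * of_int (n - t)))"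
      by (simp add: mult.assoc)
    define r where "r = R n + (of_int h)\<^sup>2 / 2"
    have "2 * \<alpha> * profile \<mu> h e = 2 * \<alpha> * r + 2 * \<alpha> * q e" for e
      unfolding distrib_left[symmetric] by (simp add: q_def r_def)
    then have pe: "exp (2 * \<alpha> * profile \<mu> h e) = exp (2 * \<alpha> * r) * exp (2 * \<alpha> * q e)"
      and pe': "exp (2 * \<alpha> * profile \<mu> h e - u) = exp (2 * \<alpha> * r) * exp (2 * \<alpha> * q e - u)" for e u
      by (simp_all add: add_diff_eq flip: exp_add)
    show "exp (2 * Re c * profile \<mu> h t) \<le> C1 * (M * S) * (exp (2 * Re c * profile \<mu> h k - \<rho> * of_int (t - k))
        + exp (2 * Re c * profile \<mu> h n - \<rho> * of_int (n - t)))"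
      using mult_left_mono[OF main, of "exp (2 * \<alpha> * r)"]
      unfolding \<alpha>_def[symmetric] pe pe' by (simp add: algebra_simps)
  qed (rule \<rho>)
qed

text \<open>In the middle of a double block the hypotheses put \<open>\<phi>\<close> above the
  smaller and below the larger end value by a margin \<open>\<eta>\<close>, so each block increment
  is at least \<open>\<eta>\<close> in modulus. Its sign cannot depend on \<open>k\<close>, because
  one step in \<open>k\<close> changes the increment by at most \<open>2 * H\<close>.\<close>

lemma block_dichotomy:
  fixes \<phi> :: "int \<Rightarrow> real"
  assumes K: "K > 0" "K' > 0" and \<rho>: "\<rho> > 0" "\<rho>' > 0" and lip: "\<And>t. \<bar>\<phi> (t + 1) - \<phi> t\<bar> \<le> H"
    and lower: "\<And>k t n. k \<le> t \<Longrightarrow> t \<le> n \<Longrightarrow> exp (- \<phi> t)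
        \<le> K * (exp (- \<phi> k - \<rho> * of_int (t - k)) + exp (- \<phi> n - \<rho> * of_int (n - t)))"
    and upper: "\<And>k t n. k \<le> t \<Longrightarrow> t \<le> n \<Longrightarrow> exp (\<phi> t)
        \<le> K' * (exp (\<phi> k - \<rho>' * of_int (t - k)) + exp (\<phi> n - \<rho>' * of_int (n - t)))"
  obtains L :: nat and \<eta> where "L \<ge> 1" "\<eta> > 0"
    "(\<forall>k. \<phi> k + \<eta> \<le> \<phi> (k + int L)) \<or> (\<forall>k. \<phi> (k + int L) \<le> \<phi> k - \<eta>)"
proof -
  have H: "H \<ge> 0" using order_trans[OF abs_ge_zero lip] .
  \<comment> \<open>Larger than \<open>H\<close>, so that passing from an increment
    \<open>\<eta>\<close> to \<open>- \<eta>\<close> would need a change exceeding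
    \<open>2 * H\<close>.\<close>
  define \<eta> where "\<eta> = H + 1"
  have \<eta>: "\<eta> > 0" using H by (simp add: \<eta>_def)
  \<comment> \<open>The absolute values make the left side an upper bound for each of the two
    thresholds separately.\<close>
  obtain L0 :: nat where L0: "(ln (2 * K) + \<eta>) / \<rho> + (ln (2 * K') + \<eta>) / \<rho>' + \<bar>(ln (2 * K) + \<eta>) / \<rho>\<bar> + \<bar>(ln (2 * K') + \<eta>) / \<rho>'\<bar> \<le> real L0"
    using real_arch_simple by blast
  define L where "L = L0 + 1"
  have L: "(ln (2 * K) + \<eta>) / \<rho> \<le> real L" "(ln (2 * K') + \<eta>) / \<rho>' \<le> real L"
    using L0 unfolding L_def by linarith+
  have max_bound: "u \<le> max v w - \<eta>"
    if "exp u \<le> A * (exp (v - e * real L) + exp (w - e * real L))" "A > 0" "e > 0" "(ln (2 * A) + \<eta>) / e \<le> real L"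
    for u v w A e
  proof -
    have "ln (2 * A) + \<eta> \<le> e * real L" using that by (simp add: field_simps)
    have "exp (v - e * real L) + exp (w - e * real L) \<le> 2 * exp (max v w - e * real L)"
      by (smt (verit) exp_le_cancel_iff max.cobounded1 max.cobounded2)
    then have "exp u \<le> A * (2 * exp (max v w - e * real L))"
      using that by (smt (verit) mult_left_mono)
    also have "\<dots> = exp (ln (2 * A) + (max v w - e * real L))"
      unfolding exp_add using that(2) by simp
    finally show ?thesis using \<open>ln (2 * A) + \<eta> \<le> e * real L\<close> by simp
  qed
  have dich: "\<phi> k + \<eta> \<le> \<phi> (k + int L) \<or> \<phi> (k + int L) \<le> \<phi> k - \<eta>" for k
  proof -
    have "- \<phi> (k + int L) \<le> max (- \<phi> k) (- \<phi> (k + int L + int L)) - \<eta>"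
      by (rule max_bound[OF _ K(1) \<rho>(1) L(1)]) (use lower[of k "k + int L" "k + int L + int L"] in simp)
    moreover have "\<phi> (k + int L) \<le> max (\<phi> k) (\<phi> (k + int L + int L)) - \<eta>"
      by (rule max_bound[OF _ K(2) \<rho>(2) L(2)]) (use upper[of k "k + int L" "k + int L + int L"] in simp)
    ultimately show ?thesis using \<eta> by (auto simp: max_def split: if_splits)
  qed
  have up_iff: "\<phi> k + \<eta> \<le> \<phi> (k + int L) \<longleftrightarrow> \<phi> (k + 1) + \<eta> \<le> \<phi> (k + 1 + int L)" for k
    using dich[of k] dich[of "k + 1"] lip[of k] lip[of "k + int L"]
    unfolding \<eta>_def by (auto simp: algebra_simps abs_le_iff)
  have all: "\<phi> k + \<eta> \<le> \<phi> (k + int L) \<longleftrightarrow> \<phi> 0 + \<eta> \<le> \<phi> (0 + int L)" for k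
  proof (induction k rule: int_induct[where k = 0])
    case (step1 i)
    then show ?case using up_iff[of i] by simp
  next
    case (step2 i)
    then show ?case using up_iff[of "i - 1"] by simp
  qed simp
  show ?thesis
  proof (rule that[of L \<eta>])
    show "(\<forall>k. \<phi> k + \<eta> \<le> \<phi> (k + int L)) \<or> (\<forall>k. \<phi> (k + int L) \<le> \<phi> k - \<eta>)"
      using all dich by blast
  qed (use \<eta> in \<open>auto simp: L_def\<close>)
qed

lemma block_iterate:
  fixes S :: "int \<Rightarrow> real"
  assumes "\<And>k. x \<le> S (k + int L) - S k"
  shows "real m * x \<le> S (k + int (L * m)) - S k"
proof (induction m)
  case (Suc m)
  have "k + int (L * Suc m) = k + int (L * m) + int L" by simp
  then show ?case
    using Suc assms[of "k + int (L * m)"] by (simp only: of_nat_Suc distrib_right mult_1_left)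
qed simp

lemma cumul_diff_bound:
  assumes D: "\<And>i. \<bar>f i\<bar> \<le> D" and "a \<le> b"
  shows "\<bar>cumul f b - cumul f a\<bar> \<le> D * of_int (b - a)"
proof -
  have "\<bar>\<Sum>i\<in>{a<..b}. f i\<bar> \<le> (\<Sum>i\<in>{a<..b}. D)"
    by (rule order_trans[OF sum_abs sum_mono]) (rule D)
  then show ?thesis using assms(2) by (simp add: sum_eq_cumul mult.commute)
qed

text \<open>The displacements are bounded, so their block averages lie above very negative
  half-integers and below very large ones. Any \<open>h\<close> at which \<open>up\<close> switches
  off is the required shift: the dichotomy for \<open>h + 1\<close> then supplies the opposite
  bound.\<close>

lemma averages_of_localized_inverse:
  assumes c: "Re c > 0" and mono: "strict_mono \<mu>" and \<sigma>: "\<sigma> > 0" and D: "\<And>i. \<bar>\<mu> i - of_int i\<bar> \<le> D"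
    and sep: "\<And>i j. i \<noteq> j \<Longrightarrow> \<sigma> \<le> \<bar>\<mu> i - \<mu> j\<bar>" and B: "localized_inverse c \<mu> B"
  obtains h :: int and N :: nat and \<kappa> where "N \<ge> 1" "\<kappa> > 0"
    "\<And>k. \<bar>(\<Sum>i\<in>{k<..k + int N}. \<mu> i - of_int i - of_int h)\<bar> \<le> real N / 2 - \<kappa>"
proof -
  let ?S = "cumul (\<lambda>i. \<mu> i - of_int i)"
  define \<alpha> where "\<alpha> = Re c"
  have \<alpha>: "\<alpha> > 0" using c by (simp add: \<alpha>_def)
  \<comment> \<open>The block length may depend on \<open>h\<close> and on the direction; the two
    lengths found are reconciled at the end.\<close>
  define up where "up = (\<lambda>h::int. \<exists>L::nat. \<exists>\<eta>>0. L \<ge> 1 \<and> (\<forall>k. (of_int h - 1 / 2) * real L + \<eta> \<le> ?S (k + int L) - ?S k))"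
  define dn where "dn = (\<lambda>h::int. \<exists>L::nat. \<exists>\<eta>>0. L \<ge> 1 \<and> (\<forall>k. ?S (k + int L) - ?S k \<le> (of_int h - 1 / 2) * real L - \<eta>))"
  have dich: "up h \<or> dn h" for h
  proof -
    obtain K \<epsilon> where lower: "K > 0" "\<epsilon> > 0" "\<And>k t n. k \<le> t \<Longrightarrow> t \<le> n \<Longrightarrow>
     exp (- (2 * Re c * profile \<mu> h t)) \<le> K * (exp (- (2 * Re c * profile \<mu> h k) - \<epsilon> * of_int (t - k))
        + exp (- (2 * Re c * profile \<mu> h n) - \<epsilon> * of_int (n - t)))"
      using profile_lower[OF c mono \<sigma> D sep B] by blast
    obtain K' \<epsilon>' where upper: "K' > 0" "\<epsilon>' > 0" "\<And>k t n. k \<le> t \<Longrightarrow> t \<le> n \<Longrightarrow>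
     exp (2 * Re c * profile \<mu> h t) \<le> K' * (exp (2 * Re c * profile \<mu> h k - \<epsilon>' * of_int (t - k))
        + exp (2 * Re c * profile \<mu> h n - \<epsilon>' * of_int (n - t)))"
      using profile_upper[OF c \<sigma> D sep B] by blast
    have lip: "\<bar>2 * Re c * profile \<mu> h (t + 1) - 2 * Re c * profile \<mu> h t\<bar> \<le> 2 * \<alpha> * (D + \<bar>of_int h\<bar> + 1)" for t
    proof -
      have "\<bar>profile \<mu> h (t + 1) - profile \<mu> h t\<bar> \<le> D + \<bar>of_int h\<bar> + 1"
        using profile_lipschitz[where \<mu> = \<mu> and h = h and i = "t + 1" and j = t, OF D] by simp
      then have "2 * \<alpha> * \<bar>profile \<mu> h (t + 1) - profile \<mu> h t\<bar> \<le> 2 * \<alpha> * (D + \<bar>of_int h\<bar> + 1)"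
        using \<alpha> by (intro mult_left_mono) auto
      moreover have "2 * Re c * profile \<mu> h (t + 1) - 2 * Re c * profile \<mu> h t = 2 * \<alpha> * (profile \<mu> h (t + 1) - profile \<mu> h t)"
        by (simp add: \<alpha>_def right_diff_distrib)
      ultimately show ?thesis using \<alpha> by (simp add: abs_mult)
    qed
    obtain L :: nat and \<eta> where L: "L \<ge> 1" and \<eta>: "\<eta> > 0"
      and or: "(\<forall>k. 2 * Re c * profile \<mu> h k + \<eta> \<le> 2 * Re c * profile \<mu> h (k + int L))
        \<or> (\<forall>k. 2 * Re c * profile \<mu> h (k + int L) \<le> 2 * Re c * profile \<mu> h k - \<eta>)"
      using block_dichotomy[where \<phi> = "\<lambda>t. 2 * Re c * profile \<mu> h t", OF lower(1) upper(1) lower(2) upper(2) lip lower(3) upper(3)]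
      by blast
    have diff: "profile \<mu> h (k + int L) - profile \<mu> h k = ?S (k + int L) - ?S k - (of_int h - 1 / 2) * real L" for k
      by (simp add: profile_def algebra_simps)
    have \<eta>': "\<eta> / (2 * \<alpha>) > 0" using \<eta> \<alpha> by simp
    have scale: "x / (2 * \<alpha>) \<le> y - z" if "2 * Re c * z + x \<le> 2 * Re c * y" for x y z
      using that \<alpha> by (simp add: \<alpha>_def[symmetric] field_simps)
    from or show ?thesis
    proof
      assume *: "\<forall>k. 2 * Re c * profile \<mu> h k + \<eta> \<le> 2 * Re c * profile \<mu> h (k + int L)"
      have "(of_int h - 1 / 2) * real L + \<eta> / (2 * \<alpha>) \<le> ?S (k + int L) - ?S k" for k
        using scale[OF spec[OF *, of k]] diff[of k] by linarith
      then show ?thesis unfolding up_def using \<eta>' L by blast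
    next
      assume *: "\<forall>k. 2 * Re c * profile \<mu> h (k + int L) \<le> 2 * Re c * profile \<mu> h k - \<eta>"
      have "?S (k + int L) - ?S k \<le> (of_int h - 1 / 2) * real L - \<eta> / (2 * \<alpha>)" for k
        using scale[of "profile \<mu> h (k + int L)" \<eta> "profile \<mu> h k"] spec[OF *, of k] diff[of k] by linarith
      then show ?thesis unfolding dn_def using \<eta>' L by blast
    qed
  qed
  have Sb: "\<bar>?S (k + int L) - ?S k\<bar> \<le> D * real L" for k L
    using cumul_diff_bound[of "\<lambda>i. \<mu> i - of_int i" D k "k + int L", OF D] by simp
  obtain M :: nat where M: "D + 1 \<le> real M" using real_arch_simple by blast
  have "\<not> dn (- int M)"
  proof
    assume "dn (- int M)"
    then obtain L :: nat and \<eta> where "\<eta> > 0"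
      and "\<forall>k. ?S (k + int L) - ?S k \<le> (of_int (- int M) - 1 / 2) * real L - \<eta>"
      unfolding dn_def by blast
    from this(1) spec[OF this(2), of 0] have "\<eta> > 0" "?S (0 + int L) - ?S 0 \<le> (- real M - 1 / 2) * real L - \<eta>"
      by simp_all
    moreover have "(- real M - 1 / 2) * real L \<le> - D * real L"
      using M by (intro mult_right_mono) auto
    ultimately show False using Sb[of 0 L] by simp
  qed
  then have up0: "up (- int M)" using dich by blast
  have not_up: "\<not> up (int M + 1)"
  proof
    assume "up (int M + 1)"
    then obtain L :: nat and \<eta> where "\<eta> > 0"
      and "\<forall>k. (of_int (int M + 1) - 1 / 2) * real L + \<eta> \<le> ?S (k + int L) - ?S k"
      unfolding up_def by blast
    from this(1) spec[OF this(2), of 0] have "\<eta> > 0" "(real M + 1 - 1 / 2) * real L + \<eta> \<le> ?S (0 + int L) - ?S 0"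
      by simp_all
    moreover have "D * real L \<le> (real M + 1 - 1 / 2) * real L"
      using M by (intro mult_right_mono) auto
    ultimately show False using Sb[of 0 L] by simp
  qed
  have "\<exists>h. up h \<and> \<not> up (h + 1)"
  proof (rule ccontr)
    assume *: "\<not> (\<exists>h. up h \<and> \<not> up (h + 1))"
    have "up j" if "- int M \<le> j" for j
      using that
    proof (induction j rule: int_ge_induct)
      case (step i)
      then show ?case using * by blast
    qed (rule up0)
    from this[of "int M + 1"] show False using not_up by simp
  qed
  then obtain h where h: "up h" "\<not> up (h + 1)" by blast
  then have "dn (h + 1)" using dich by blast
  then obtain L2 :: nat and \<eta>2 where L2: "L2 \<ge> 1" "\<eta>2 > 0"
    "\<And>k. ?S (k + int L2) - ?S k \<le> (of_int h + 1 / 2) * real L2 - \<eta>2"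
    unfolding dn_def by (auto simp: algebra_simps)
  obtain L1 :: nat and \<eta>1 where L1: "L1 \<ge> 1" "\<eta>1 > 0"
    "\<And>k. (of_int h - 1 / 2) * real L1 + \<eta>1 \<le> ?S (k + int L1) - ?S k"
    using h(1) unfolding up_def by blast
  show ?thesis
  \<comment> \<open>A block of length \<open>L1 * L2\<close> consists of \<open>L2\<close> blocks of
    length \<open>L1\<close>, and also of \<open>L1\<close> blocks of length \<open>L2\<close>, so
    both one-sided bounds apply to it.\<close>
  proof (rule that[of "L1 * L2" "min \<eta>1 \<eta>2" h])
    show "L1 * L2 \<ge> 1" using L1(1) L2(1) by simp
    show "min \<eta>1 \<eta>2 > 0" using L1(2) L2(2) by simp
    fix k
    let ?N = "L1 * L2"
    have lo: "real L2 * ((of_int h - 1 / 2) * real L1 + \<eta>1) \<le> ?S (k + int ?N) - ?S k"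
      by (rule block_iterate) (rule L1(3))
    have "- ((of_int h + 1 / 2) * real L2 - \<eta>2) \<le> - ?S (k + int L2) - - ?S k" for k
      using L2(3)[of k] by simp
    then have hi: "real L1 * (- ((of_int h + 1 / 2) * real L2 - \<eta>2)) \<le> - ?S (k + int (L2 * L1)) - - ?S k"
      by (rule block_iterate[where S = "\<lambda>t. - ?S t"])
    have m1: "min \<eta>1 \<eta>2 \<le> real L2 * \<eta>1"
    proof -
      have "1 * \<eta>1 \<le> real L2 * \<eta>1" using L2(1) L1(2) by (intro mult_right_mono) auto
      then show ?thesis using min.cobounded1[of \<eta>1 \<eta>2] by linarith
    qed
    have m2: "min \<eta>1 \<eta>2 \<le> real L1 * \<eta>2"
    proof -
      have "1 * \<eta>2 \<le> real L1 * \<eta>2" using L1(1) L2(2) by (intro mult_right_mono) auto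
      then show ?thesis using min.cobounded2[of \<eta>1 \<eta>2] by linarith
    qed
    have "(\<Sum>i\<in>{k<..k + int ?N}. \<mu> i - of_int i - of_int h) = ?S (k + int ?N) - ?S k - real ?N * of_int h"
      by (simp add: sum_subtractf[of "\<lambda>i. \<mu> i - of_int i"] sum_eq_cumul del: of_nat_mult)
    moreover have "\<bar>?S (k + int ?N) - ?S k - real ?N * of_int h\<bar> \<le> real ?N / 2 - min \<eta>1 \<eta>2"
    proof -
      have gen: "\<bar>T - P\<bar> \<le> Q - m" if "P - Q + u \<le> T" "- (P + Q - v) \<le> - T" "m \<le> u" "m \<le> v" for T P Q u v m :: real
        using that by linarith
      have eqs: "real L2 * ((of_int h - 1 / 2) * real L1 + \<eta>1) = real ?N * of_int h - real ?N / 2 + real L2 * \<eta>1"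
        "real L1 * (- ((of_int h + 1 / 2) * real L2 - \<eta>2)) = - (real ?N * of_int h + real ?N / 2 - real L1 * \<eta>2)"
        by (simp_all add: field_simps)
      show ?thesis
      proof (rule gen[OF _ _ m1 m2])
        show "real ?N * of_int h - real ?N / 2 + real L2 * \<eta>1 \<le> ?S (k + int ?N) - ?S k"
          using lo unfolding eqs .
        show "- (real ?N * of_int h + real ?N / 2 - real L1 * \<eta>2) \<le> - (?S (k + int ?N) - ?S k)"
          using hi unfolding eqs mult.commute[of L2] by simp
      qed
    qed
    ultimately show "\<bar>(\<Sum>i\<in>{k<..k + int ?N}. \<mu> i - of_int i - of_int h)\<bar> \<le> real ?N / 2 - min \<eta>1 \<eta>2"
      by simp
  qed
qed

text \<open>Cut the stretch into complete blocks of length \<open>N\<close>, whose bounds add up,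
  and a remainder shorter than \<open>N\<close>, which costs at most
  \<open>D * real N\<close>.\<close>

lemma cumul_average_bound:
  fixes f :: "int \<Rightarrow> real"
  assumes D: "\<And>i. \<bar>f i\<bar> \<le> D" and N: "N \<ge> 1" and d: "d \<ge> 0"
    and avg: "\<And>k. \<bar>cumul f (k + int N) - cumul f k\<bar> \<le> d * real N"
  shows "\<bar>cumul f n - cumul f m\<bar> \<le> d * \<bar>of_int (n - m)\<bar> + D * real N"
proof -
  have D0: "D \<ge> 0" using order_trans[OF abs_ge_zero D] .
  have main: "\<bar>cumul f n - cumul f m\<bar> \<le> d * of_int (n - m) + D * real N" if "m \<le> n" for m n
  proof -
    define l where "l = nat (n - m)"
    define a where "a = m + int (N * (l div N))"
    have n: "n = m + int l" using that by (simp add: l_def)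
    have r: "n - a = int (l mod N)"
      unfolding n a_def using div_mult_mod_eq[of l N] by (simp add: algebra_simps flip: of_nat_mult of_nat_add)
    have "real (l div N) * (- (d * real N)) \<le> cumul f a - cumul f m"
      unfolding a_def by (rule block_iterate) (use avg in \<open>simp add: abs_le_iff algebra_simps\<close>)
    moreover have "real (l div N) * (- (d * real N)) \<le> - cumul f a - - cumul f m"
      unfolding a_def by (rule block_iterate[where S = "\<lambda>t. - cumul f t"]) (use avg in \<open>simp add: abs_le_iff algebra_simps\<close>)
    ultimately have 1: "\<bar>cumul f a - cumul f m\<bar> \<le> d * real (l div N * N)"
      by (simp add: abs_le_iff algebra_simps)
    also have "\<dots> \<le> d * real l"
      using d by (intro mult_left_mono of_nat_mono div_times_less_eq_dividend)
    also have "real l = of_int (n - m)" by (simp add: n)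
    finally have 1: "\<bar>cumul f a - cumul f m\<bar> \<le> d * of_int (n - m)" .
    have "\<bar>cumul f n - cumul f a\<bar> \<le> D * of_int (n - a)"
      by (rule cumul_diff_bound[OF D]) (use r in simp)
    also have "\<dots> \<le> D * real N"
      using D0 N mod_less_divisor[of N l] unfolding r by (intro mult_left_mono) auto
    finally show ?thesis using 1 by linarith
  qed
  show ?thesis
    using main[of m n] main[of n m] by (cases "m \<le> n") (simp_all add: abs_minus_commute)
qed

section \<open>Change of enumeration and the final equivalence\<close>

lemma complete_interpolating_reindex:
  assumes \<pi>: "bij \<pi>" and cis: "complete_interpolating c \<mu>"
  shows "complete_interpolating c (\<mu> \<circ> \<pi>)"
proof -
  have sum: "(\<lambda>n. f (\<pi> n)) summable_on UNIV \<longleftrightarrow> f summable_on UNIV"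
    and inf: "(\<Sum>\<^sub>\<infinity>n. f (\<pi> n)) = infsum f UNIV" for f :: "int \<Rightarrow> real"
    using summable_on_reindex_bij_betw[OF \<pi>] infsum_reindex_bij_betw[OF \<pi>] by auto
  have "interpolating c (\<mu> \<circ> \<pi>)"
    unfolding interpolating_def
  proof
    fix a :: "int \<Rightarrow> complex" assume a: "a \<in> ell2"
    have "(\<lambda>n. a (inv \<pi> n)) \<in> ell2"
      using a summable_on_reindex_bij_betw[OF bij_imp_bij_inv[OF \<pi>], of "\<lambda>n. (cmod (a n))\<^sup>2"] by (simp add: ell2_def)
    moreover have "\<exists>f\<in>gauss_space c. \<forall>n. f (\<mu> n) = b n" if "b \<in> ell2" for b
      using cis that unfolding complete_interpolating_def interpolating_def by blast
    ultimately obtain f where f: "f \<in> gauss_space c" "\<And>n. f (\<mu> n) = a (inv \<pi> n)"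
      by blast
    then show "\<exists>f\<in>gauss_space c. \<forall>n. f ((\<mu> \<circ> \<pi>) n) = a n"
      using \<pi> by (intro bexI[of _ f]) (simp_all add: bij_is_inj)
  qed
  moreover have "sampling c (\<mu> \<circ> \<pi>)"
    using cis sum[of "\<lambda>n. (cmod (f (\<mu> n)))\<^sup>2" for f] inf[of "\<lambda>n. (cmod (f (\<mu> n)))\<^sup>2" for f]
    unfolding complete_interpolating_def sampling_def by (simp add: o_def)
  ultimately show ?thesis unfolding complete_interpolating_def by blast
qed

text \<open>Injectivity makes the set of distances nonempty, so its \<open>Inf\<close> is a genuine
  greatest lower bound.\<close>

lemma separated_range_iff:
  assumes "inj (f :: int \<Rightarrow> real)"
  shows "separated (range f) \<longleftrightarrow> (\<exists>\<sigma>>0. \<forall>i j. i \<noteq> j \<longrightarrow> \<sigma> \<le> \<bar>f i - f j\<bar>)"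
proof -
  let ?X = "{\<bar>x - y\<bar> | x y. x \<in> range f \<and> y \<in> range f \<and> x \<noteq> y}"
  have mem: "\<bar>f i - f j\<bar> \<in> ?X" if "i \<noteq> j" for i j
    by (intro CollectI exI[of _ "f i"] exI[of _ "f j"]) (use assms that in \<open>auto simp: inj_eq\<close>)
  have ne: "?X \<noteq> {}" using mem[of 0 1] by auto
  have bdd: "bdd_below ?X" by (rule bdd_belowI[of _ 0]) auto
  show ?thesis
  proof
    assume "separated (range f)"
    then have "0 < Inf ?X" by (simp add: separated_def)
    then show "\<exists>\<sigma>>0. \<forall>i j. i \<noteq> j \<longrightarrow> \<sigma> \<le> \<bar>f i - f j\<bar>"
      using cInf_lower[OF mem bdd] by blast
  next
    assume "\<exists>\<sigma>>0. \<forall>i j. i \<noteq> j \<longrightarrow> \<sigma> \<le> \<bar>f i - f j\<bar>"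
    then obtain \<sigma> where \<sigma>: "\<sigma> > 0" "\<And>i j. i \<noteq> j \<Longrightarrow> \<sigma> \<le> \<bar>f i - f j\<bar>" by blast
    have "\<sigma> \<le> Inf ?X"
    proof (rule cInf_greatest[OF ne])
      fix x assume "x \<in> ?X"
      then obtain i j where x: "x = \<bar>f i - f j\<bar>" "f i \<noteq> f j" by blast
      then have "i \<noteq> j" by blast
      then show "\<sigma> \<le> x" unfolding x(1) by (rule \<sigma>(2))
    qed
    then show "separated (range f)" using \<sigma>(1) by (simp add: separated_def)
  qed
qed

text \<open>The enumeration \<open>\<mu>\<close> may list the nodes in an order different from that
  of \<open>\<Lambda>\<close>, so the inverse is built for \<open>\<mu>\<close> and the property is
  carried over by the permutation relating the two.\<close>

lemma complete_interpolating_sufficient: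
  fixes c :: complex and \<Lambda> \<mu> \<delta> :: "int \<Rightarrow> real"
  assumes c: "Re c > 0" and mono: "strict_mono \<Lambda>" and sepd: "separated (range \<Lambda>)"
    and bij: "bij_betw \<mu> UNIV (range \<Lambda>)" and \<mu>: "\<forall>n. \<mu> n = of_int n + \<delta> n"
    and bdd: "bounded (range \<delta>)" and N: "N \<ge> 1" and d: "d > 0"
    and sup: "(SUP n. 1 / real N * \<bar>\<Sum>k = n + 1..n + int N. \<delta> k\<bar>) \<le> d" and d2: "d < 1 / 2"
  shows "complete_interpolating c \<Lambda>"
proof -
  have inj: "inj \<Lambda>" using mono by (rule strict_mono_imp_inj_on)
  have ivl: "{n + 1..n + int N} = {n<..n + int N}" for n by auto
  have inj\<mu>: "inj \<mu>" and ran: "range \<mu> = range \<Lambda>"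
    using bij by (auto simp: bij_betw_def)
  obtain \<sigma> where \<sigma>: "\<sigma> > 0" and sep: "\<And>i j. i \<noteq> j \<Longrightarrow> \<sigma> \<le> \<bar>\<mu> i - \<mu> j\<bar>"
    using iffD1[OF separated_range_iff[OF inj\<mu>], unfolded ran, OF sepd] by blast
  obtain D where D: "\<And>i. \<bar>\<delta> i\<bar> \<le> D"
    using bdd unfolding bounded_iff by auto
  have \<delta>: "\<mu> i - of_int i = \<delta> i" for i using \<mu> by simp
  have avg: "\<bar>cumul \<delta> (n + int N) - cumul \<delta> n\<bar> \<le> d * real N" for n
  proof -
    \<comment> \<open>A supremum of reals bounds its terms only if the family is bounded above;
      boundedness of \<open>\<delta>\<close> ensures this.\<close>
    have "1 / real N * \<bar>\<Sum>k = n + 1..n + int N. \<delta> k\<bar> \<le> (SUP n. 1 / real N * \<bar>\<Sum>k = n + 1..n + int N. \<delta> k\<bar>)"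
    proof (rule cSUP_upper)
      show "bdd_above (range (\<lambda>n. 1 / real N * \<bar>\<Sum>k = n + 1..n + int N. \<delta> k\<bar>))"
      proof (rule bdd_aboveI2)
        fix n
        show "1 / real N * \<bar>\<Sum>k = n + 1..n + int N. \<delta> k\<bar> \<le> 1 / real N * (D * real N)"
          unfolding ivl using cumul_diff_bound[OF D, of n "n + int N"]
          by (intro mult_left_mono) (simp_all add: sum_eq_cumul)
      qed
    qed simp
    then have "1 / real N * \<bar>\<Sum>k = n + 1..n + int N. \<delta> k\<bar> \<le> d" using sup by linarith
    then show ?thesis
      unfolding ivl using N by (simp add: sum_eq_cumul field_simps)
  qed
  have "\<exists>B. localized_inverse c \<mu> B"
  proof (rule localized_inverse_of_average[OF c \<sigma> _ sep d2])
    show "\<bar>\<mu> i - of_int i\<bar> \<le> D" for i unfolding \<delta> by (rule D)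
    show "\<bar>cumul (\<lambda>i. \<mu> i - of_int i) n - cumul (\<lambda>i. \<mu> i - of_int i) m\<bar>
        \<le> d * \<bar>of_int (n - m)\<bar> + D * real N" for n m
      unfolding \<delta> using d by (intro cumul_average_bound[OF D N _ avg]) simp
  qed
  then obtain B where B: "localized_inverse c \<mu> B" ..
  obtain B0 where B0: "localized_inverse c of_int B0"
    using localized_inverse_of_int[OF c] by blast
  have "spread \<mu>"
    by (rule spread_of_bounded[of _ D]) (unfold \<delta>, rule D)
  then have cis: "complete_interpolating c \<mu>"
    by (rule complete_interpolating_of_localized_inverse[OF c B0 _ B])
  define \<pi> where "\<pi> = inv \<mu> \<circ> \<Lambda>"
  have \<mu>\<pi>: "\<mu> \<circ> \<pi> = \<Lambda>"
    unfolding \<pi>_def using ran by (auto simp: fun_eq_iff f_inv_into_f)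
  have "bij \<pi>"
    unfolding \<pi>_def
    by (rule bij_betw_trans[OF inj_on_imp_bij_betw[OF inj] bij_betw_inv_into[OF bij]])
  from complete_interpolating_reindex[OF this cis] show ?thesis
    unfolding \<mu>\<pi> .
qed

theorem theorem1p3:
  fixes c :: complex and \<Lambda> :: "int \<Rightarrow> real"
  assumes "Re c > 0" and "strict_mono \<Lambda>"
  shows "complete_interpolating c \<Lambda> \<longleftrightarrow>
    separated (range \<Lambda>) \<and>
    (\<exists>(\<mu> :: int \<Rightarrow> real) (\<delta> :: int \<Rightarrow> real).
       bij_betw \<mu> UNIV (range \<Lambda>) \<and>
       (\<forall>n. \<mu> n = real_of_int n + \<delta> n) \<and>
       bounded (range \<delta>) \<and>
       (\<exists>(N :: nat) (d :: real). N \<ge> 1 \<and> d > 0 \<and>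
          (SUP n. 1 / real N * \<bar>\<Sum>k = n + 1..n + int N. \<delta> k\<bar>) \<le> d \<and> d < 1 / 2))"
    (is "_ \<longleftrightarrow> _ \<and> ?cond")
proof -
  note c = assms(1) and mono = assms(2)
  have inj: "inj \<Lambda>" using mono by (rule strict_mono_imp_inj_on)
  show ?thesis
  proof (intro iffI conjI)
    assume cis: "complete_interpolating c \<Lambda>"
    obtain \<sigma> B where \<sigma>: "\<sigma> > 0" and sep: "\<And>i j. i \<noteq> j \<Longrightarrow> \<sigma> \<le> \<bar>\<Lambda> i - \<Lambda> j\<bar>" and B: "localized_inverse c \<Lambda> B"
      using complete_interpolating_necessary[OF c mono cis] by blast
    show "separated (range \<Lambda>)"
      unfolding separated_range_iff[OF inj] using \<sigma> sep by blast
    obtain D where D: "\<And>i. \<bar>\<Lambda> i - real_of_int i\<bar> \<le> D"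
      using localized_inverse_counting[OF c mono spread_of_separated[OF mono \<sigma> sep] B] by blast
    obtain h :: int and N :: nat and \<kappa> where N: "N \<ge> 1" and \<kappa>: "\<kappa> > 0"
      and avg: "\<And>k. \<bar>(\<Sum>i\<in>{k<..k + int N}. \<Lambda> i - real_of_int i - real_of_int h)\<bar> \<le> real N / 2 - \<kappa>"
      by (rule averages_of_localized_inverse[OF c mono \<sigma> D sep B]) (assumption | rule that)+
    \<comment> \<open>Index \<open>n\<close> receives the node \<open>\<Lambda> (n - h)\<close>,
      which lowers every displacement by \<open>h\<close>.\<close>
    define \<delta> where "\<delta> = (\<lambda>n. \<Lambda> (n - h) - real_of_int n)"
    \<comment> \<open>\<open>1 / 2 - \<kappa> / real N\<close> may be 0 while a positive bound is
      demanded; \<open>1 / 4\<close> stands for any number strictly between 0 and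
      \<open>1 / 2\<close>.\<close>
    define d where "d = max (1 / 4) (1 / 2 - \<kappa> / real N)"
    show ?cond
    proof (intro exI conjI allI)
      show "bij_betw (\<lambda>n. \<Lambda> (n - h)) UNIV (range \<Lambda>)"
      proof (rule bij_betw_imageI)
        show "inj (\<lambda>n. \<Lambda> (n - h))" by (auto intro!: injI dest!: injD[OF inj])
        show "range (\<lambda>n. \<Lambda> (n - h)) = range \<Lambda>"
        proof (intro equalityI subsetI)
          fix x assume "x \<in> range \<Lambda>"
          then obtain i where "x = \<Lambda> i" by blast
          then have "x = \<Lambda> ((i + h) - h)" by simp
          then show "x \<in> range (\<lambda>n. \<Lambda> (n - h))" by (rule range_eqI)
        qed auto
      qed
      show "\<Lambda> (n - h) = real_of_int n + \<delta> n" for n by (simp add: \<delta>_def)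
      have "\<bar>\<delta> n\<bar> \<le> D + \<bar>real_of_int h\<bar>" for n
        using D[of "n - h"] by (simp add: \<delta>_def)
      then show "bounded (range \<delta>)" unfolding bounded_iff by auto
      show "N \<ge> 1" by (rule N)
      show "d > 0" by (simp add: d_def)
      have "\<kappa> / real N > 0" using \<kappa> N by simp
      then show "d < 1 / 2" unfolding d_def by linarith
      show "(SUP n. 1 / real N * \<bar>\<Sum>k = n + 1..n + int N. \<delta> k\<bar>) \<le> d"
      proof (rule cSUP_least)
        fix n
        have "(\<Sum>k = n + 1..n + int N. \<delta> k) = (\<Sum>i\<in>{n - h<..n - h + int N}. \<Lambda> i - real_of_int i - real_of_int h)"
          by (rule sum.reindex_bij_witness[where i = "\<lambda>i. i + h" and j = "\<lambda>k. k - h"]) (auto simp: \<delta>_def)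
        then have "1 / real N * \<bar>\<Sum>k = n + 1..n + int N. \<delta> k\<bar> \<le> 1 / real N * (real N / 2 - \<kappa>)"
          using avg[of "n - h"] by (intro mult_left_mono) auto
        also have "\<dots> = 1 / 2 - \<kappa> / real N" using N by (simp add: field_simps)
        finally show "1 / real N * \<bar>\<Sum>k = n + 1..n + int N. \<delta> k\<bar> \<le> d" by (simp add: d_def)
      qed simp
    qed
  next
    assume "separated (range \<Lambda>) \<and> ?cond"
    then show "complete_interpolating c \<Lambda>"
      by (elim conjE exE) (rule complete_interpolating_sufficient[OF c mono]; assumption)
  qed
qed

end
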